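(* Let $\mathbf f\in[L^2(\Omega)]^d$, let $\mathbf g$ be Dirichlet data on $\partial\Omega$, and let $k\ge1$ be an integer. Let $\mathbf u_h=\{\mathbf u_0,\mathbf u_b\}\in V_h$, $p_h\in W_h$ be the first two components of the solution $(\mathbf u_h;p_h;\boldsymbol\lambda_h)$ of the hybridized weak Galerkin scheme (HWG). Then $[\![\mathbf u_h]\!]_e=0$ for all $e\in\mathcal E_h^0$, i.e. $\mathbf u_h\in\mathcal V_h$, and $\mathbf u_b=Q_b\mathbf g$ on $\partial\Omega$. Furthermore, $\mathbf u_h$ and $p_h$ satisfy the equations of the weak Galerkin scheme (WG); that is, $\mathbf u_h=\bar{\mathbf u}_h$ and $p_h=\bar p_h$, where $(\bar{\mathbf u}_h;\bar p_h)$ is the solution of (WG).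
   Context: **Mesh.** $\Omega\subset\mathbb R^d$, $d\in\{2,3\}$, is a (bounded, connected) polygonal/polyhedral domain. $\mathcal T_h$ is a partition of $\Omega$ into polygons ($d=2$) or polyhedra ($d=3$), $\mathcal E_h$ is the set of all edges/flat faces, $\mathcal E_h^0=\mathcal E_h\setminus\partial\Omega$ the interior ones. $h_T$, $h_e$ are the diameters of $T$, $e$; $h=\max_T h_T$. $\mathcal T_h$ is shape regular: there are fixed positive constants such that (A1) $\rho_v h_T^d\le|T|$ and $\rho_e h_e^{d-1}\le|e|$ for all $T$ and all edges/faces $e\subset\partial T$; (A2) $\kappa h_T\le h_e$ for all $e\subset\partial T$; (A3) for every $T$ and $e\subset\partial T$ there is a pyramid contained in $T$ with base $e$, apex $A_e\in T$ and height $\sigma_e h_T$ with $\sigma_e\ge\sigma_*>0$, such that the angle between $x_e-A_e$ and the outward normal of $e$ lies in $[0,\theta_0]$ with $\theta_0<\pi/2$ for all $x_e\in e$; (A4) each $T$ has a shape-regular circumscribed simplex $S(T)$ with diameter at most $\gamma_* h_T$, and each $S(T)$ intersects only a fixed, small number of the other such simplices. **Spaces.** Fix an integer $k\ge1$. $P_r$ denotes polynomials of total degree at most $r$. - $V_h=\prod_T V_k(T)$, where $V_k(T)$ consists of pairs $\mathbf v=\{\mathbf v_0,\mathbf v_b\}$ with $\mathbf v_0\in[P_k(T)]^d$ on $T$ and $\mathbf v_b|_e\in[P_{k-1}(e)]^d$ on each edge/face $e\subset\partial T$ (two values of $\mathbf v_b$ on each interior edge/face). $V_h^0=\{\mathbf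 v\in V_h:\mathbf v_b=0\text{ on }\partial\Omega\}$. - The jump is $[\![\mathbf v]\!]_e=\mathbf v_b|_{\partial T_1}-\mathbf v_b|_{\partial T_2}$ for $e\in\mathcal E_h^0$ shared by $T_1,T_2$ (fixed order), and $[\![\mathbf v]\!]_e=\mathbf v_b$ for $e\subset\partial\Omega$. $\mathcal V_h=\{\mathbf v\in V_h:[\![\mathbf v]\!]_e=0\ \forall e\in\mathcal E_h^0\}$, $\mathcal V_h^0=\{\mathbf v\in\mathcal V_h:\mathbf v_b=0\text{ on }\partial\Omega\}$. - $W_h=\{q\in L^2(\Omega):\int_\Omega q=0,\ q|_T\in P_{k-1}(T)\ \forall T\in\mathcal T_h\}$. - $\Lambda_h=\prod_T\Lambda_k(\partial T)$, $\Lambda_k(\partial T)=\{\boldsymbol\lambda:\boldsymbol\lambda|_e\in[P_{k-1}(e)]^d,\ e\subset\partial T\}$ (two values on each interior edge/face). - $\Xi_h$ is the set of $\boldsymbol\lambda\in\Lambda_h$ such that $\boldsymbol\lambda|_{\partial T_1}+\boldsymbol\lambda|_{\partial T_2}=0$ on each interior edge/face $e$ shared by $T_1,T_2$, and $\boldsymbol\lambda=0$ on each edge/face contained in $\partial\Omega$. **Weak derivatives.** For $\mathbf v\in V_h$, on each $T$, $\nabla_w\mathbf v\in[P_{k-1}(T)]^{d\times d}$ and $\nabla_w\cdot\mathbf v\in P_{k-1}(T)$ are defined by $(\nabla_w\mathbf v,q)_T=-(\mathbf v_0,\nabla\cdot q)_T+\langle\mathbf v_b,q\cdot\mathbf n\rangle_{\partial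 T}$ for all $q\in[P_{k-1}(T)]^{d\times d}$ (row-wise divergence), and $(\nabla_w\cdot\mathbf v,\varphi)_T=-(\mathbf v_0,\nabla\varphi)_T+\langle\mathbf v_b\cdot\mathbf n,\varphi\rangle_{\partial T}$ for all $\varphi\in P_{k-1}(T)$, where $\mathbf n$ is the outward unit normal on $\partial T$ and $(\cdot,\cdot)_T$, $\langle\cdot,\cdot\rangle_{\partial T}$ are $L^2$ inner products. **Forms.** $Q_b$ is the $L^2$ projection onto $[P_{k-1}(e)]^d$ on each edge/face $e$. Then $s(\mathbf v,\mathbf w)=\sum_T h_T^{-1}\langle Q_b\mathbf v_0-\mathbf v_b,Q_b\mathbf w_0-\mathbf w_b\rangle_{\partial T}$, $a(\mathbf v,\mathbf w)=\sum_T(\nabla_w\mathbf v,\nabla_w\mathbf w)_T+s(\mathbf v,\mathbf w)$, $b(\mathbf v,q)=\sum_T(\nabla_w\cdot\mathbf v,q)_T$, $c(\mathbf v,\boldsymbol\lambda)=\sum_T\langle\mathbf v_b,\boldsymbol\lambda\rangle_{\partial T}$. The data $\mathbf g$ are such that $Q_b\mathbf g$ makes sense, e.g. $\mathbf g\in[L^2(\partial\Omega)]^d$. **Scheme (WG).** Find $\bar{\mathbf u}_h=\{\bar{\mathbf u}_0,\bar{\mathbf u}_b\}\in\mathcal V_h$, $\bar p_h\in W_h$ with $\bar{\mathbf u}_b=Q_b\mathbf g$ on $\partial\Omega$ and $a(\bar{\mathbf u}_h,\mathbf v)-b(\mathbf v,\bar p_h)=(\mathbf f,\mathbf v_0)$,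 $b(\bar{\mathbf u}_h,q)=0$ for all $\mathbf v\in\mathcal V_h^0$, $q\in W_h$. (It is known to have a unique solution.) **Scheme (HWG).** Find $(\mathbf u_h;p_h;\boldsymbol\lambda_h)\in V_h\times W_h\times\Xi_h$ with $\mathbf u_b=Q_b\mathbf g$ on $\partial\Omega$ and $a(\mathbf u_h,\mathbf v)-b(\mathbf v,p_h)-c(\mathbf v,\boldsymbol\lambda_h)=(\mathbf f,\mathbf v_0)$, $b(\mathbf u_h,q)+c(\mathbf u_h,\boldsymbol\mu)=0$ for all $\mathbf v\in V_h^0$, $q\in W_h$, $\boldsymbol\mu\in\Xi_h$. (It has a unique solution.) *)

theory Defs
  imports "HOL-Analysis.Analysis"
begin

section \<open>Polyhedral sets, surface measure, outward normals\<close>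

text \<open>A closed, possibly non-convex, polyhedral set of dimension m: a finite union of convex
  polytopes without lower-dimensional parts and with connected relative interior.  For
  m = 1, 2, 3 these are the closed segments, polygons and polyhedra.\<close>

definition polyhedral :: "nat \<Rightarrow> (real^'n) set \<Rightarrow> bool" where
  "polyhedral m S \<longleftrightarrow>
     (\<exists>\<P>. finite \<P> \<and> (\<forall>P\<in>\<P>. polytope P) \<and> S = \<Union>\<P>) \<and>
     aff_dim S = int m \<and>
     closure (rel_interior S) = S \<and>
     connected (rel_interior S)"

text \<open>The condition on the interior of the closure says that the domain has no slits.\<close>

definition polyhedral_domain :: "(real^'n) set \<Rightarrow> bool" where
  "polyhedral_domain \<Omega> \<longleftrightarrow>
     bounded \<Omega> \<and> open \<Omega> \<and> connected \<Omega> \<and> \<Omega> \<noteq> {} \<and>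
     interior (closure \<Omega>) = \<Omega> \<and> polyhedral CARD('n) (closure \<Omega>)"

definition unit_normal :: "(real^'n) set \<Rightarrow> real^'n" where
  "unit_normal e = (SOME n. norm n = 1 \<and> (\<forall>x\<in>e. \<forall>y\<in>e. n \<bullet> (x - y) = 0))"

definition prism :: "(real^'n) set \<Rightarrow> (real^'n) set" where
  "prism e = {x + t *\<^sub>R unit_normal e | x t. x \<in> e \<and> 0 \<le> t \<and> t \<le> 1}"

text \<open>The (d-1)-dimensional surface measure on a set e contained in a hyperplane: the d-dimensional
  Lebesgue measure on the right prism of height 1 over e, projected orthogonally onto the
  hyperplane.  It is carried by e.  Because of the completion, measurability depends on the
  values on e only.\<close>

definition surface_measure :: "(real^'n) set \<Rightarrow> (real^'n) measure" where
  "surface_measure e =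
     completion (distr (restrict_space lborel (prism e)) borel (closest_point (affine hull e)))"

definition is_outward_normal :: "(real^'n) set \<Rightarrow> (real^'n) set \<Rightarrow> real^'n \<Rightarrow> bool" where
  "is_outward_normal T e n \<longleftrightarrow>
     norm n = 1 \<and> (\<forall>x\<in>e. \<forall>y\<in>e. n \<bullet> (x - y) = 0) \<and>
     (\<forall>x\<in>rel_interior e. \<exists>\<delta>>0. \<forall>t. 0 < t \<and> t < \<delta> \<longrightarrow> x - t *\<^sub>R n \<in> T \<and> x + t *\<^sub>R n \<notin> T)"

definition outward_normal :: "(real^'n) set \<Rightarrow> (real^'n) set \<Rightarrow> real^'n" where
  "outward_normal T e = (THE n. is_outward_normal T e n)"


section \<open>Meshes\<close>

text \<open>A mesh is given by the set \<open>\<T>\<close> of its (closed) elements and the set \<open>\<E>\<close> of its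
  (closed) edges/flat faces.  Hanging nodes are allowed: a flat piece of the boundary of an
  element may be subdivided into several members of \<open>\<E>\<close>.\<close>

definition faces :: "(real^'n) set set \<Rightarrow> (real^'n) set \<Rightarrow> (real^'n) set set" where
  "faces \<E> T = {e \<in> \<E>. e \<subseteq> frontier T}"

definition boundary_faces :: "(real^'n) set \<Rightarrow> (real^'n) set set \<Rightarrow> (real^'n) set set" where
  "boundary_faces \<Omega> \<E> = {e \<in> \<E>. e \<subseteq> frontier \<Omega>}"

definition interior_faces :: "(real^'n) set \<Rightarrow> (real^'n) set set \<Rightarrow> (real^'n) set set" where
  "interior_faces \<Omega> \<E> = {e \<in> \<E>. \<not> e \<subseteq> frontier \<Omega>}"

definition shared_by ::
  "(real^'n) set set \<Rightarrow> (real^'n) set set \<Rightarrow> (real^'n) set \<Rightarrow> (real^'n) set \<Rightarrow> (real^'n) set \<Rightarrow> bool"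
  where
  "shared_by \<T> \<E> e T1 T2 \<longleftrightarrow>
     T1 \<in> \<T> \<and> T2 \<in> \<T> \<and> T1 \<noteq> T2 \<and> e \<in> faces \<E> T1 \<and> e \<in> faces \<E> T2"

definition mesh :: "(real^'n) set \<Rightarrow> (real^'n) set set \<Rightarrow> (real^'n) set set \<Rightarrow> bool" where
  "mesh \<Omega> \<T> \<E> \<longleftrightarrow>
     finite \<T> \<and> (\<forall>T\<in>\<T>. polyhedral CARD('n) T) \<and>
     \<Union>\<T> = closure \<Omega> \<and>
     (\<forall>T\<in>\<T>. \<forall>T'\<in>\<T>. T \<noteq> T' \<longrightarrow> interior T \<inter> interior T' = {}) \<and>
     finite \<E> \<and> (\<forall>e\<in>\<E>. polyhedral (CARD('n) - 1) e) \<and>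
     (\<forall>e\<in>\<E>. \<forall>e'\<in>\<E>. e \<noteq> e' \<longrightarrow> rel_interior e \<inter> rel_interior e' = {}) \<and>
     (\<forall>T\<in>\<T>. \<Union>(faces \<E> T) = frontier T) \<and>
     (\<forall>T\<in>\<T>. \<forall>e\<in>faces \<E> T. \<exists>n. is_outward_normal T e n) \<and>
     (\<forall>e\<in>\<E>. \<exists>T\<in>\<T>. e \<in> faces \<E> T) \<and>
     (\<forall>e\<in>interior_faces \<Omega> \<E>. card {T \<in> \<T>. e \<in> faces \<E> T} = 2)"

text \<open>The pyramid with base e and apex A; the base need not be convex.\<close>

definition pyramid :: "(real^'n) set \<Rightarrow> real^'n \<Rightarrow> (real^'n) set" where
  "pyramid e A = (\<Union>x\<in>e. closed_segment A x)"

definition angle_between :: "real^'n \<Rightarrow> real^'n \<Rightarrow> real" where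
  "angle_between x y = arccos ((x \<bullet> y) / (norm x * norm y))"

text \<open>\<open>\<tau>\<close> is the shape regularity constant of the circumscribed
  simplices \<open>S T\<close> (ratio of the radius of a contained ball to the diameter), N bounds the number
  of other simplices met by each of them.\<close>

definition shape_regular ::
  "real \<Rightarrow> real \<Rightarrow> real \<Rightarrow> real \<Rightarrow> real \<Rightarrow> real \<Rightarrow> real \<Rightarrow> nat \<Rightarrow>
   (real^'n) set set \<Rightarrow> (real^'n) set set \<Rightarrow> bool" where
  "shape_regular \<rho>v \<rho>e \<kappa> \<sigma>s \<theta>0 \<gamma>s \<tau> N \<T> \<E> \<longleftrightarrow>
     0 < \<rho>v \<and> 0 < \<rho>e \<and> 0 < \<kappa> \<and> 0 < \<sigma>s \<and> 0 \<le> \<theta>0 \<and> \<theta>0 < pi / 2 \<and> 0 < \<gamma>s \<and> 0 < \<tau> \<and>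
     (\<forall>T\<in>\<T>. \<rho>v * diameter T ^ CARD('n) \<le> measure lebesgue T) \<and>
     (\<forall>T\<in>\<T>. \<forall>e\<in>faces \<E> T.
        \<rho>e * diameter e ^ (CARD('n) - 1) \<le> measure (surface_measure e) e) \<and>
     (\<forall>T\<in>\<T>. \<forall>e\<in>faces \<E> T. \<kappa> * diameter T \<le> diameter e) \<and>
     (\<forall>T\<in>\<T>. \<forall>e\<in>faces \<E> T. \<exists>A\<in>T. \<exists>\<sigma>\<ge>\<sigma>s.
        pyramid e A \<subseteq> T \<and>
        infdist A (affine hull e) = \<sigma> * diameter T \<and>
        (\<forall>x\<in>e. angle_between (x - A) (outward_normal T e) \<in> {0..\<theta>0})) \<and>
     (\<exists>S. \<forall>T\<in>\<T>. int CARD('n) simplex (S T) \<and> T \<subseteq> S T \<and>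
        (\<exists>z. ball z (\<tau> * diameter (S T)) \<subseteq> S T) \<and>
        diameter (S T) \<le> \<gamma>s * diameter T \<and>
        card {T' \<in> \<T>. T' \<noteq> T \<and> S T' \<inter> S T \<noteq> {}} \<le> N)"


section \<open>Polynomials and $L^2$\<close>

definition poly_fun :: "nat \<Rightarrow> (real^'n \<Rightarrow> real) \<Rightarrow> bool" where
  "poly_fun r p \<longleftrightarrow>
     (\<exists>c. p = (\<lambda>x. \<Sum>\<alpha> | (\<Sum>i\<in>UNIV. \<alpha> i) \<le> r. c \<alpha> * (\<Prod>i\<in>UNIV. (x $ i) ^ \<alpha> i)))"

text \<open>Membership in $P_r(S)$, $[P_r(S)]^d$, $[P_r(S)]^{d\times d}$ for S an element or a face.
  Only the values on S matter; polynomials on a face are the restrictions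
  to it of polynomials on the whole space.\<close>

definition poly_on :: "nat \<Rightarrow> (real^'n) set \<Rightarrow> (real^'n \<Rightarrow> real) \<Rightarrow> bool" where
  "poly_on r S f \<longleftrightarrow> (\<exists>p. poly_fun r p \<and> (\<forall>x\<in>S. f x = p x))"

definition vpoly_on :: "nat \<Rightarrow> (real^'n) set \<Rightarrow> (real^'n \<Rightarrow> real^'n) \<Rightarrow> bool" where
  "vpoly_on r S f \<longleftrightarrow> (\<forall>i. poly_on r S (\<lambda>x. f x $ i))"

definition mpoly_on :: "nat \<Rightarrow> (real^'n) set \<Rightarrow> (real^'n \<Rightarrow> real^'n^'n) \<Rightarrow> bool" where
  "mpoly_on r S f \<longleftrightarrow> (\<forall>i j. poly_on r S (\<lambda>x. f x $ i $ j))"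

definition L2_on :: "(real^'n) set \<Rightarrow> (real^'n \<Rightarrow> 'b::euclidean_space) \<Rightarrow> bool" where
  "L2_on S f \<longleftrightarrow>
     f \<in> borel_measurable (lebesgue_on S) \<and> integrable (lebesgue_on S) (\<lambda>x. (norm (f x))\<^sup>2)"

text \<open>The $L^2$ inner products on an element and on a face; for matrices \<open>\<bullet>\<close> is the
  Frobenius inner product.\<close>

definition ip :: "(real^'n) set \<Rightarrow> (real^'n \<Rightarrow> 'b::euclidean_space) \<Rightarrow> (real^'n \<Rightarrow> 'b) \<Rightarrow> real"
  where "ip T f g = (LINT x:T|lebesgue. f x \<bullet> g x)"

definition ip_face :: "(real^'n) set \<Rightarrow> (real^'n \<Rightarrow> 'b::euclidean_space) \<Rightarrow> (real^'n \<Rightarrow> 'b) \<Rightarrow> real"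
  where "ip_face e f g = (LINT x|surface_measure e. f x \<bullet> g x)"

definition grad :: "(real^'n \<Rightarrow> real) \<Rightarrow> real^'n \<Rightarrow> real^'n" where
  "grad \<phi> x = (\<chi> j. frechet_derivative \<phi> (at x) (axis j 1))"

definition row_div :: "(real^'n \<Rightarrow> real^'n^'n) \<Rightarrow> real^'n \<Rightarrow> real^'n" where
  "row_div q x = (\<chi> i. \<Sum>j\<in>UNIV. frechet_derivative (\<lambda>y. q y $ i $ j) (at x) (axis j 1))"


section \<open>Weak Galerkin spaces\<close>

text \<open>A pair \<open>(v0, vb)\<close>: \<open>v0 T\<close> is the interior component on the element T, and \<open>vb T e\<close> is the
  boundary component on the face e as seen from T (hence two values on interior faces).
  Multipliers have the same form as boundary components.\<close>

type_synonym 'n bfun = "(real^'n) set \<Rightarrow> (real^'n) set \<Rightarrow> real^'n \<Rightarrow> real^'n"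
type_synonym 'n wfun = "((real^'n) set \<Rightarrow> real^'n \<Rightarrow> real^'n) \<times> 'n bfun"

definition Lambda_h :: "nat \<Rightarrow> (real^'n) set set \<Rightarrow> (real^'n) set set \<Rightarrow> 'n bfun set" where
  "Lambda_h k \<T> \<E> = {l. \<forall>T\<in>\<T>. \<forall>e\<in>faces \<E> T. vpoly_on (k - 1) e (l T e)}"

definition Xi_h ::
  "nat \<Rightarrow> (real^'n) set \<Rightarrow> (real^'n) set set \<Rightarrow> (real^'n) set set \<Rightarrow> 'n bfun set" where
  "Xi_h k \<Omega> \<T> \<E> = {l \<in> Lambda_h k \<T> \<E>.
     (\<forall>e\<in>interior_faces \<Omega> \<E>. \<forall>T1 T2. shared_by \<T> \<E> e T1 T2 \<longrightarrow>
        (\<forall>x\<in>e. l T1 e x + l T2 e x = 0)) \<and>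
     (\<forall>e\<in>boundary_faces \<Omega> \<E>. \<forall>T\<in>\<T>. e \<in> faces \<E> T \<longrightarrow> (\<forall>x\<in>e. l T e x = 0))}"

definition V_h :: "nat \<Rightarrow> (real^'n) set set \<Rightarrow> (real^'n) set set \<Rightarrow> 'n wfun set" where
  "V_h k \<T> \<E> = {(v0, vb).
     (\<forall>T\<in>\<T>. vpoly_on k T (v0 T)) \<and>
     (\<forall>T\<in>\<T>. \<forall>e\<in>faces \<E> T. vpoly_on (k - 1) e (vb T e))}"

text \<open>The boundary component of v equals w on the boundary of \<open>\<Omega>\<close>; w is given face by face.\<close>

definition bdry_eq ::
  "(real^'n) set \<Rightarrow> (real^'n) set set \<Rightarrow> (real^'n) set set \<Rightarrow> 'n wfun \<Rightarrow>
   ((real^'n) set \<Rightarrow> real^'n \<Rightarrow> real^'n) \<Rightarrow> bool" where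
  "bdry_eq \<Omega> \<T> \<E> v w \<longleftrightarrow>
     (\<forall>e\<in>boundary_faces \<Omega> \<E>. \<forall>T\<in>\<T>. e \<in> faces \<E> T \<longrightarrow> (\<forall>x\<in>e. snd v T e x = w e x))"

definition V_h0 ::
  "nat \<Rightarrow> (real^'n) set \<Rightarrow> (real^'n) set set \<Rightarrow> (real^'n) set set \<Rightarrow> 'n wfun set" where
  "V_h0 k \<Omega> \<T> \<E> = {v \<in> V_h k \<T> \<E>. bdry_eq \<Omega> \<T> \<E> v (\<lambda>e x. 0)}"

definition jump ::
  "(real^'n) set \<Rightarrow> (real^'n) set \<Rightarrow> (real^'n) set \<Rightarrow> 'n wfun \<Rightarrow> real^'n \<Rightarrow> real^'n" where
  "jump e T1 T2 v x = snd v T1 e x - snd v T2 e x"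

text \<open>The jump across an interior face e vanishes, for either order of the two elements sharing e.\<close>

definition no_jump ::
  "(real^'n) set set \<Rightarrow> (real^'n) set set \<Rightarrow> 'n wfun \<Rightarrow> (real^'n) set \<Rightarrow> bool" where
  "no_jump \<T> \<E> v e \<longleftrightarrow>
     (\<forall>T1 T2. shared_by \<T> \<E> e T1 T2 \<longrightarrow> (\<forall>x\<in>e. jump e T1 T2 v x = 0))"

definition cV_h ::
  "nat \<Rightarrow> (real^'n) set \<Rightarrow> (real^'n) set set \<Rightarrow> (real^'n) set set \<Rightarrow> 'n wfun set" where
  "cV_h k \<Omega> \<T> \<E> = {v \<in> V_h k \<T> \<E>. \<forall>e\<in>interior_faces \<Omega> \<E>. no_jump \<T> \<E> v e}"

definition cV_h0 ::
  "nat \<Rightarrow> (real^'n) set \<Rightarrow> (real^'n) set set \<Rightarrow> (real^'n) set set \<Rightarrow> 'n wfun set" where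
  "cV_h0 k \<Omega> \<T> \<E> = {v \<in> cV_h k \<Omega> \<T> \<E>. bdry_eq \<Omega> \<T> \<E> v (\<lambda>e x. 0)}"

definition W_h ::
  "nat \<Rightarrow> (real^'n) set \<Rightarrow> (real^'n) set set \<Rightarrow> (real^'n \<Rightarrow> real) set" where
  "W_h k \<Omega> \<T> = {q. L2_on \<Omega> q \<and> (LINT x:\<Omega>|lebesgue. q x) = 0 \<and>
     (\<forall>T\<in>\<T>. \<exists>r. poly_fun (k - 1) r \<and> (AE x in lebesgue_on T. q x = r x))}"


section \<open>Weak derivatives, bilinear forms, and the two schemes\<close>

text \<open>The objects selected by \<open>SOME\<close> are determined by their defining equations on the element
  (resp. face); only these values enter the forms.\<close>

definition weak_grad ::
  "nat \<Rightarrow> (real^'n) set set \<Rightarrow> 'n wfun \<Rightarrow> (real^'n) set \<Rightarrow> real^'n \<Rightarrow> real^'n^'n" where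
  "weak_grad k \<E> v T = (SOME G. mpoly_on (k - 1) T G \<and>
     (\<forall>q. mpoly_on (k - 1) T q \<longrightarrow>
        ip T G q = - ip T (fst v T) (row_div q)
          + (\<Sum>e\<in>faces \<E> T. ip_face e (snd v T e) (\<lambda>x. q x *v outward_normal T e))))"

definition weak_div ::
  "nat \<Rightarrow> (real^'n) set set \<Rightarrow> 'n wfun \<Rightarrow> (real^'n) set \<Rightarrow> real^'n \<Rightarrow> real" where
  "weak_div k \<E> v T = (SOME D. poly_on (k - 1) T D \<and>
     (\<forall>\<phi>. poly_on (k - 1) T \<phi> \<longrightarrow>
        ip T D \<phi> = - ip T (fst v T) (grad \<phi>)
          + (\<Sum>e\<in>faces \<E> T. ip_face e (\<lambda>x. snd v T e x \<bullet> outward_normal T e) \<phi>)))"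

definition Qb ::
  "nat \<Rightarrow> (real^'n) set \<Rightarrow> (real^'n \<Rightarrow> real^'n) \<Rightarrow> real^'n \<Rightarrow> real^'n" where
  "Qb k e w = (SOME r. vpoly_on (k - 1) e r \<and>
     (\<forall>\<phi>. vpoly_on (k - 1) e \<phi> \<longrightarrow> ip_face e r \<phi> = ip_face e w \<phi>))"

definition s_form ::
  "nat \<Rightarrow> (real^'n) set set \<Rightarrow> (real^'n) set set \<Rightarrow> 'n wfun \<Rightarrow> 'n wfun \<Rightarrow> real" where
  "s_form k \<T> \<E> v w = (\<Sum>T\<in>\<T>. inverse (diameter T) * (\<Sum>e\<in>faces \<E> T.
     ip_face e (\<lambda>x. Qb k e (fst v T) x - snd v T e x) (\<lambda>x. Qb k e (fst w T) x - snd w T e x)))"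

definition a_form ::
  "nat \<Rightarrow> (real^'n) set set \<Rightarrow> (real^'n) set set \<Rightarrow> 'n wfun \<Rightarrow> 'n wfun \<Rightarrow> real" where
  "a_form k \<T> \<E> v w =
     (\<Sum>T\<in>\<T>. ip T (weak_grad k \<E> v T) (weak_grad k \<E> w T)) + s_form k \<T> \<E> v w"

definition b_form ::
  "nat \<Rightarrow> (real^'n) set set \<Rightarrow> (real^'n) set set \<Rightarrow> 'n wfun \<Rightarrow> (real^'n \<Rightarrow> real) \<Rightarrow> real" where
  "b_form k \<T> \<E> v q = (\<Sum>T\<in>\<T>. ip T (weak_div k \<E> v T) q)"

definition c_form ::
  "(real^'n) set set \<Rightarrow> (real^'n) set set \<Rightarrow> 'n wfun \<Rightarrow> 'n bfun \<Rightarrow> real" where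
  "c_form \<T> \<E> v l = (\<Sum>T\<in>\<T>. \<Sum>e\<in>faces \<E> T. ip_face e (snd v T e) (l T e))"

definition load ::
  "(real^'n) set set \<Rightarrow> (real^'n \<Rightarrow> real^'n) \<Rightarrow> 'n wfun \<Rightarrow> real" where
  "load \<T> f v = (\<Sum>T\<in>\<T>. ip T f (fst v T))"

text \<open>The condition under which the defining equations of \<open>Qb k e g\<close> make sense on all boundary
  faces; it holds in particular if g is square integrable on the boundary.\<close>

definition dirichlet_data ::
  "(real^'n) set \<Rightarrow> (real^'n) set set \<Rightarrow> (real^'n \<Rightarrow> real^'n) \<Rightarrow> bool" where
  "dirichlet_data \<Omega> \<E> g \<longleftrightarrow> (\<forall>e\<in>boundary_faces \<Omega> \<E>. integrable (surface_measure e) g)"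

definition WG_solution ::
  "nat \<Rightarrow> (real^'n) set \<Rightarrow> (real^'n) set set \<Rightarrow> (real^'n) set set \<Rightarrow>
   (real^'n \<Rightarrow> real^'n) \<Rightarrow> (real^'n \<Rightarrow> real^'n) \<Rightarrow> 'n wfun \<Rightarrow> (real^'n \<Rightarrow> real) \<Rightarrow> bool" where
  "WG_solution k \<Omega> \<T> \<E> f g u p \<longleftrightarrow>
     u \<in> cV_h k \<Omega> \<T> \<E> \<and> p \<in> W_h k \<Omega> \<T> \<and>
     bdry_eq \<Omega> \<T> \<E> u (\<lambda>e. Qb k e g) \<and>
     (\<forall>v\<in>cV_h0 k \<Omega> \<T> \<E>. a_form k \<T> \<E> u v - b_form k \<T> \<E> v p = load \<T> f v) \<and>
     (\<forall>q\<in>W_h k \<Omega> \<T>. b_form k \<T> \<E> u q = 0)"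

definition HWG_solution ::
  "nat \<Rightarrow> (real^'n) set \<Rightarrow> (real^'n) set set \<Rightarrow> (real^'n) set set \<Rightarrow>
   (real^'n \<Rightarrow> real^'n) \<Rightarrow> (real^'n \<Rightarrow> real^'n) \<Rightarrow>
   'n wfun \<Rightarrow> (real^'n \<Rightarrow> real) \<Rightarrow> 'n bfun \<Rightarrow> bool" where
  "HWG_solution k \<Omega> \<T> \<E> f g u p l \<longleftrightarrow>
     u \<in> V_h k \<T> \<E> \<and> p \<in> W_h k \<Omega> \<T> \<and> l \<in> Xi_h k \<Omega> \<T> \<E> \<and>
     bdry_eq \<Omega> \<T> \<E> u (\<lambda>e. Qb k e g) \<and>
     (\<forall>v\<in>V_h0 k \<Omega> \<T> \<E>.
        a_form k \<T> \<E> u v - b_form k \<T> \<E> v p - c_form \<T> \<E> v l = load \<T> f v) \<and>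
     (\<forall>q\<in>W_h k \<Omega> \<T>. \<forall>\<mu>\<in>Xi_h k \<Omega> \<T> \<E>. b_form k \<T> \<E> u q + c_form \<T> \<E> u \<mu> = 0)"

text \<open>Equality in \<open>V_h\<close>: equality on the elements and on the faces, the values elsewhere being
  irrelevant.\<close>

definition same_wfun ::
  "(real^'n) set set \<Rightarrow> (real^'n) set set \<Rightarrow> 'n wfun \<Rightarrow> 'n wfun \<Rightarrow> bool" where
  "same_wfun \<T> \<E> u v \<longleftrightarrow>
     (\<forall>T\<in>\<T>. \<forall>x\<in>T. fst u T x = fst v T x) \<and>
     (\<forall>T\<in>\<T>. \<forall>e\<in>faces \<E> T. \<forall>x\<in>e. snd u T e x = snd v T e x)"

end

theory Submission
  imports Defs
begin

text \<open>The jump of \<open>u\<close> vanishes because it is itself an admissible multiplier. On an interior face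
  \<open>e\<close> the function that equals the jump seen from one side and minus the jump seen from the other,
  and vanishes on every other face, belongs to \<open>Xi_h\<close>; tested with it and \<open>q = 0\<close>, the second
  equation of (HWG) says that the jump has norm zero on \<open>e\<close>
  (\<open>multiplier_test_no_jump\<close>). Conversely, a multiplier is antisymmetric across interior faces
  and vanishes on the boundary, so its pairing with a test function without jumps cancels
  (\<open>c_form_orthogonal\<close>) and the first equation reduces to that of (WG). The right-hand side and the
  boundary data are carried along untouched.

  It remains to see that (WG) has at most one solution (\<open>WG_solution_unique\<close>). The difference \<open>d\<close> of
  two velocities satisfies \<open>a(d,d) = 0\<close>, so its weak gradient vanishes and \<open>Qb\<close> of its interior part
  is its boundary part. By Green's identity the classical gradient of the interior part then vanishes
  too: on each element \<open>d\<close> is one constant, inside and on the faces (\<open>element_rigidity\<close>). These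
  constants agree across interior faces and are zero at a boundary face, hence \<open>d = 0\<close>
  (\<open>a_form_definite\<close>). The difference \<open>r\<close> of the two pressures is now orthogonal to the weak
  divergences of all test functions. Testing with \<open>grad r\<close> inside the elements makes \<open>r\<close> constant on
  each element; testing with the normal of one interior face makes neighbouring constants equal
  (\<open>pressure_constant\<close>); mean zero finishes the proof.

  Two geometric facts carry this argument. First, any two elements are joined by a chain of elements
  with common faces (\<open>elements_connected\<close>). The faces' relative boundaries lie in finitely many affine
  sets of codimension two, so a generic segment misses them, and it can only pass from one element to
  another through the relative interior of a shared face. Secondly, the divergence theorem holds on an
  element, which need not be convex (\<open>divergence_theorem_directional\<close>). It is obtained by
  averaging over unit segments in a fixed direction: on almost every segment the fundamental theorem of
  calculus leaves endpoint terms, which cancel by translation invariance, and one term for each face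
  that is crossed. The segments crossing a face fill a slanted prism over it, whose volume is compared
  with the right prism in the definition of the surface measure by a linear change of variables. The
  latter is derived for the few maps needed from the uniqueness of translation invariant measures.\<close>

section \<open>Linear maps and Lebesgue measure\<close>

lemma nn_integral_lborel_translate:
  fixes f :: "'a::euclidean_space \<Rightarrow> ennreal"
  assumes "f \<in> borel_measurable borel"
  shows "(\<integral>\<^sup>+x. f (a + x) \<partial>lborel) = (\<integral>\<^sup>+x. f x \<partial>lborel)"
proof -
  have "(\<integral>\<^sup>+x. f x \<partial>lborel) = (\<integral>\<^sup>+x. f x \<partial>distr lborel borel ((+) a))"
    by (simp add: lborel_distr_plus)
  also have "\<dots> = (\<integral>\<^sup>+x. f (a + x) \<partial>lborel)"
    using assms by (subst nn_integral_distr) auto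
  finally show ?thesis by simp
qed

lemma nn_integral_lborel_reflect:
  fixes f :: "'a::euclidean_space \<Rightarrow> ennreal"
  assumes "f \<in> borel_measurable borel"
  shows "(\<integral>\<^sup>+x. f (a - x) \<partial>lborel) = (\<integral>\<^sup>+x. f x \<partial>lborel)"
proof -
  have "lborel = distr lborel borel (\<lambda>x. a - x :: 'a)"
    using lborel_affine[of "-1" a] by (simp add: density_1)
  then have "(\<integral>\<^sup>+x. f x \<partial>lborel) = (\<integral>\<^sup>+x. f x \<partial>distr lborel borel (\<lambda>x. a - x :: 'a))"
    by simp
  also have "\<dots> = (\<integral>\<^sup>+x. f (a - x) \<partial>lborel)"
    using assms by (subst nn_integral_distr) auto
  finally show ?thesis by simp
qed

text \<open>The factor is the reciprocal of the modulus of the determinant, but characterizing it by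
  integrals makes composition immediate and needs no matrices.\<close>
definition scales_volume :: "('a::euclidean_space \<Rightarrow> 'a) \<Rightarrow> ennreal \<Rightarrow> bool" where
  "scales_volume L c \<longleftrightarrow> L \<in> borel_measurable borel \<and>
     (\<forall>f\<in>borel_measurable borel. (\<integral>\<^sup>+x. f (L x) \<partial>lborel) = c * (\<integral>\<^sup>+x. f x \<partial>lborel))"

lemma emeasure_unit_ball_bounds:
  "emeasure lborel (ball (0::'a::euclidean_space) 1) \<noteq> 0"
  "emeasure lborel (ball (0::'a::euclidean_space) 1) \<noteq> top"
proof -
  show "emeasure lborel (ball (0::'a::euclidean_space) 1) \<noteq> 0"
    using open_not_negligible[of "ball (0::'a) 1"] negligible_iff_emeasure0[of "ball (0::'a) 1"]
    by (auto simp: emeasure_completion)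
  show "emeasure lborel (ball (0::'a::euclidean_space) 1) \<noteq> top"
    using emeasure_bounded_finite[of "ball (0::'a) 1"] by (auto simp: less_top)
qed

lemma linear_borel_measurable:
  fixes L :: "'a::euclidean_space \<Rightarrow> 'b::euclidean_space"
  assumes "linear L" shows "L \<in> borel_measurable borel"
  by (intro borel_measurable_continuous_onI linear_continuous_on)
     (use assms in \<open>simp add: linear_conv_bounded_linear\<close>)

text \<open>Uniqueness of Haar measure: with \<open>g\<close> the indicator of the unit ball, the double integral of
  \<open>f (L x) * g (L x + y)\<close> is evaluated in both orders. Integrating over \<open>y\<close> first gives the left-hand
  side times the volume of the ball. After translating \<open>x\<close> by the preimage of \<open>-y\<close> and swapping,
  the integral over \<open>y\<close> of \<open>f (L x - y)\<close> separates off.\<close>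
lemma linear_scales_volume:
  fixes L :: "'a::euclidean_space \<Rightarrow> 'a"
  assumes L: "linear L" and bij: "bij L"
  shows "scales_volume L (emeasure lborel (L -` ball 0 1) / emeasure lborel (ball (0::'a) 1))"
proof -
  define g :: "'a \<Rightarrow> ennreal" where "g = indicator (ball 0 1)"
  have [measurable]: "g \<in> borel_measurable borel"
    unfolding g_def by (intro borel_measurable_indicator) simp
  have Lm [measurable]: "L \<in> borel_measurable borel" by (rule linear_borel_measurable[OF L])
  have "(\<integral>\<^sup>+x. f (L x) \<partial>lborel) * (\<integral>\<^sup>+y. g y \<partial>lborel) = (\<integral>\<^sup>+x. g (L x) \<partial>lborel) * (\<integral>\<^sup>+y. f y \<partial>lborel)"
    if f [measurable]: "f \<in> borel_measurable borel" for f :: "'a \<Rightarrow> ennreal"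
  proof -
    have "(\<integral>\<^sup>+x. f (L x) \<partial>lborel) * (\<integral>\<^sup>+y. g y \<partial>lborel)
        = (\<integral>\<^sup>+x. (\<integral>\<^sup>+y. f (L x) * g (L x + y) \<partial>lborel) \<partial>lborel)"
      by (simp add: nn_integral_cmult nn_integral_multc nn_integral_lborel_translate)
    also have "\<dots> = (\<integral>\<^sup>+y. (\<integral>\<^sup>+x. f (L x) * g (L x + y) \<partial>lborel) \<partial>lborel)"
      by (rule lborel_pair.Fubini'[symmetric]) measurable
    also have "\<dots> = (\<integral>\<^sup>+y. (\<integral>\<^sup>+x. f (L x - y) * g (L x) \<partial>lborel) \<partial>lborel)"
    proof (rule nn_integral_cong)
      fix y :: 'a
      obtain z where z: "L z = y" using bij by (metis bij_pointE)
      have "(\<integral>\<^sup>+x. f (L x) * g (L x + y) \<partial>lborel)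
        = (\<integral>\<^sup>+x. f (L (- z + x)) * g (L (- z + x) + y) \<partial>lborel)"
        by (rule nn_integral_lborel_translate[symmetric]) measurable
      then show "(\<integral>\<^sup>+x. f (L x) * g (L x + y) \<partial>lborel) = (\<integral>\<^sup>+x. f (L x - y) * g (L x) \<partial>lborel)"
        by (simp add: linear_add[OF L] linear_diff[OF L] linear_neg[OF L] z)
    qed
    also have "\<dots> = (\<integral>\<^sup>+x. (\<integral>\<^sup>+y. f (L x - y) * g (L x) \<partial>lborel) \<partial>lborel)"
      by (rule lborel_pair.Fubini') measurable
    also have "\<dots> = (\<integral>\<^sup>+x. g (L x) \<partial>lborel) * (\<integral>\<^sup>+y. f y \<partial>lborel)"
      by (simp add: nn_integral_cmult nn_integral_multc nn_integral_lborel_reflect mult.commute)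
    finally show ?thesis .
  qed
  moreover have "(\<integral>\<^sup>+y. g y \<partial>lborel) = emeasure lborel (ball (0::'a) 1)"
    by (simp add: g_def)
  moreover have "(\<integral>\<^sup>+x. g (L x) \<partial>lborel) = emeasure lborel (L -` ball (0::'a) 1)"
  proof -
    have "(\<lambda>x. g (L x)) = indicator (L -` ball 0 1)" by (auto simp: g_def indicator_def)
    moreover have "L -` ball 0 1 \<in> sets borel"
      using measurable_sets[OF Lm, of "ball 0 1"] by simp
    ultimately show ?thesis by simp
  qed
  ultimately have eq: "(\<integral>\<^sup>+x. f (L x) \<partial>lborel) * emeasure lborel (ball (0::'a) 1)
      = emeasure lborel (L -` ball (0::'a) 1) * (\<integral>\<^sup>+y. f y \<partial>lborel)"
    if "f \<in> borel_measurable borel" for f :: "'a \<Rightarrow> ennreal"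
    using that by simp
  show ?thesis unfolding scales_volume_def
  proof (intro conjI ballI Lm)
    fix f :: "'a \<Rightarrow> ennreal" assume "f \<in> borel_measurable borel"
    from eq[OF this] show "(\<integral>\<^sup>+x. f (L x) \<partial>lborel)
      = emeasure lborel (L -` ball 0 1) / emeasure lborel (ball (0::'a) 1) * (\<integral>\<^sup>+y. f y \<partial>lborel)"
      using emeasure_unit_ball_bounds[where 'a='a]
      by (metis ennreal_mult_divide_eq ennreal_times_divide mult.commute)
  qed
qed

lemma scales_volume_unique:
  fixes L :: "'a::euclidean_space \<Rightarrow> 'a"
  assumes "scales_volume L c" "scales_volume L d"
  shows "c = d"
proof -
  have m: "indicator (ball 0 1) \<in> borel_measurable (borel :: 'a measure)"
    by (intro borel_measurable_indicator) simp
  have "c * emeasure lborel (ball (0::'a) 1) = d * emeasure lborel (ball (0::'a) 1)"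
    using assms m unfolding scales_volume_def by fastforce
  then show ?thesis
    using emeasure_unit_ball_bounds[where 'a='a] by (metis ennreal_mult_divide_eq)
qed

lemma scales_volume_comp:
  assumes "scales_volume L c" "scales_volume M d"
  shows "scales_volume (\<lambda>x. L (M x)) (c * d)"
  unfolding scales_volume_def
proof (intro conjI ballI)
  have [measurable]: "L \<in> borel_measurable borel" "M \<in> borel_measurable borel"
    using assms by (auto simp: scales_volume_def)
  show "(\<lambda>x. L (M x)) \<in> borel_measurable borel" by measurable
  fix f :: "'a \<Rightarrow> ennreal" assume [measurable]: "f \<in> borel_measurable borel"
  have "(\<integral>\<^sup>+x. f (L (M x)) \<partial>lborel) = d * (\<integral>\<^sup>+x. f (L x) \<partial>lborel)"
    using assms(2)[unfolded scales_volume_def, THEN conjunct2, THEN bspec, of "\<lambda>x. f (L x)"] by simp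
  also have "\<dots> = d * (c * (\<integral>\<^sup>+x. f x \<partial>lborel))"
    using assms(1)[unfolded scales_volume_def, THEN conjunct2, THEN bspec, of f] by simp
  finally show "(\<integral>\<^sup>+x. f (L (M x)) \<partial>lborel) = c * d * (\<integral>\<^sup>+x. f x \<partial>lborel)"
    by (simp add: mult_ac)
qed

lemma scales_volume_id: "scales_volume (\<lambda>x. x) 1"
  by (simp add: scales_volume_def)

lemma orthogonal_scales_volume:
  fixes R :: "'a::euclidean_space \<Rightarrow> 'a"
  assumes "orthogonal_transformation R"
  shows "scales_volume R 1"
proof -
  have "R -` ball 0 1 = ball 0 1"
    using assms by (auto simp: orthogonal_transformation_norm)
  moreover have "bij R" using assms by (simp add: orthogonal_transformation_bij)
  ultimately show ?thesis
    using linear_scales_volume[of R] assms emeasure_unit_ball_bounds[where 'a='a]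
    by (simp add: orthogonal_transformation_linear ennreal_divide_self less_top)
qed

text \<open>Conjugating the shear with the reflection in the hyperplane orthogonal to \<open>n\<close> inverts it. The
  reflection is an isometry, so the shear and its inverse have the same factor, whose square is one.\<close>
lemma shear_scales_volume:
  fixes n u :: "'a::euclidean_space"
  assumes n: "norm n = 1" and u: "n \<bullet> u = 0"
  shows "scales_volume (\<lambda>z. z + (n \<bullet> z) *\<^sub>R u) 1"
proof -
  let ?S = "\<lambda>u z. z + (n \<bullet> z) *\<^sub>R u :: 'a" and ?R = "\<lambda>z. z - (2 * (n \<bullet> z)) *\<^sub>R n"
  have nn: "n \<bullet> n = 1" using n by (simp add: dot_square_norm)
  have lin: "linear (?S w)" for w
    by (auto intro!: linearI simp: inner_add_right algebra_simps)
  have inv: "?S w (?S (- w) z) = z" if "n \<bullet> w = 0" for w z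
    using that by (simp add: inner_add_right inner_diff_right)
  have bij: "bij (?S u)"
    by (rule o_bij[of "?S (- u)"]) (use inv[of u] inv[of "- u"] u in \<open>auto simp: o_def\<close>)
  have R: "orthogonal_transformation ?R"
    unfolding orthogonal_transformation_def
    by (auto intro!: linearI simp: inner_add_right inner_diff_left inner_diff_right algebra_simps nn inner_commute)
  obtain c where c: "scales_volume (?S u) c" using linear_scales_volume[OF lin bij] by blast
  have "scales_volume (\<lambda>z. ?S u (?R (?S u (?R z)))) (c * (1 * (c * 1)))"
    by (intro scales_volume_comp c orthogonal_scales_volume R)
  moreover have "?S u (?R (?S u (?R z))) = z" for z
    using u nn by (simp add: inner_add_right inner_diff_right algebra_simps)
  ultimately have "c * c = 1"
    using scales_volume_unique[OF _ scales_volume_id] by simp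
  moreover have "c * c \<le> c" if "c \<le> 1" using mult_left_mono[OF that, of c] by simp
  moreover have "c \<le> c * c" if "1 \<le> c" using mult_left_mono[OF that, of c] by simp
  ultimately have "c = 1" using linear[of c 1] by force
  with c show ?thesis by simp
qed

text \<open>A rotation taking \<open>n\<close> to a coordinate direction turns the map into a diagonal one.\<close>
lemma dilation_scales_volume:
  fixes n :: "real^'n"
  assumes n: "norm n = 1" and t: "t \<noteq> 0"
  shows "scales_volume (\<lambda>z. z + ((t - 1) * (n \<bullet> z)) *\<^sub>R n) (ennreal (1 / \<bar>t\<bar>))"
proof -
  obtain b :: "real^'n" where b: "b \<in> Basis" using nonempty_Basis by blast
  obtain Q where Q: "orthogonal_transformation Q" "Q n = b"
    using orthogonal_transformation_exists[of n b] n b by (metis norm_Basis)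
  define Q' where "Q' = inv Q"
  have Q': "orthogonal_transformation Q'" unfolding Q'_def
    by (rule orthogonal_transformation_inv[OF Q(1)])
  have QQ': "Q (Q' x) = x" "Q' (Q x) = x" for x
    using orthogonal_transformation_bij[OF Q(1)] 
    by (simp_all add: Q'_def bij_inv_eq_iff bij_is_inj surj_f_inv_f bij_is_surj)
  let ?D = "\<lambda>z. z + ((t - 1) * (b \<bullet> z)) *\<^sub>R b"
  have D: "(\<lambda>x. 0 + (\<Sum>j\<in>Basis. ((if j = b then t else 1) * (x \<bullet> j)) *\<^sub>R j)) = ?D"
  proof
    fix x :: "real^'n"
    have "(\<Sum>j\<in>Basis. ((if j = b then t else 1) * (x \<bullet> j)) *\<^sub>R j)
      = (\<Sum>j\<in>Basis. (x \<bullet> j) *\<^sub>R j + (if j = b then ((t - 1) * (x \<bullet> b)) *\<^sub>R b else 0))"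
      by (intro sum.cong) (auto simp: algebra_simps)
    also have "\<dots> = ?D x"
      using b by (simp add: sum.distrib euclidean_representation inner_commute[of b])
    finally show "0 + (\<Sum>j\<in>Basis. ((if j = b then t else 1) * (x \<bullet> j)) *\<^sub>R j) = ?D x" by simp
  qed
  have "(\<Prod>j\<in>Basis. \<bar>if j = b then t else 1\<bar>) = (\<Prod>j\<in>Basis. if j = b then \<bar>t\<bar> else 1)"
    by (rule prod.cong) auto
  also have "\<dots> = \<bar>t\<bar>" using b by simp
  finally have prod: "(\<Prod>j\<in>Basis. \<bar>if j = b then t else 1\<bar>) = \<bar>t\<bar>" .
  have lb: "(lborel :: (real^'n) measure) = density (distr lborel borel ?D) (\<lambda>_. \<bar>t\<bar>)"
    using lborel_affine_euclidean[of "\<lambda>j. if j = b then t else 1" 0, unfolded D prod] t by auto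
  have lin: "linear ?D" by (auto intro!: linearI simp: inner_add_right algebra_simps)
  have [measurable]: "?D \<in> borel_measurable borel" by (rule linear_borel_measurable[OF lin])
  have sD: "scales_volume ?D (ennreal (1 / \<bar>t\<bar>))"
    unfolding scales_volume_def
  proof (intro conjI ballI)
    fix f :: "real^'n \<Rightarrow> ennreal" assume [measurable]: "f \<in> borel_measurable borel"
    have "(\<integral>\<^sup>+x. f x \<partial>lborel) = ennreal \<bar>t\<bar> * (\<integral>\<^sup>+x. f (?D x) \<partial>lborel)"
      by (subst lb, subst nn_integral_density) (auto simp: nn_integral_distr nn_integral_cmult)
    then have "ennreal (1 / \<bar>t\<bar>) * (\<integral>\<^sup>+x. f x \<partial>lborel)
        = ennreal (1 / \<bar>t\<bar>) * ennreal \<bar>t\<bar> * (\<integral>\<^sup>+x. f (?D x) \<partial>lborel)"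
      by (simp add: mult.assoc)
    also have "ennreal (1 / \<bar>t\<bar>) * ennreal \<bar>t\<bar> = 1"
      using t by (simp flip: ennreal_mult')
    finally show "(\<integral>\<^sup>+x. f (?D x) \<partial>lborel) = ennreal (1 / \<bar>t\<bar>) * (\<integral>\<^sup>+x. f x \<partial>lborel)" by simp
  qed measurable
  have "scales_volume (\<lambda>z. Q' (?D (Q z))) (1 * (ennreal (1 / \<bar>t\<bar>) * 1))"
    by (intro scales_volume_comp orthogonal_scales_volume Q Q' sD)
  moreover have "Q' (?D (Q z)) = z + ((t - 1) * (n \<bullet> z)) *\<^sub>R n" for z
  proof -
    have "b \<bullet> Q z = n \<bullet> z"
      using Q by (metis orthogonal_transformation_def)
    moreover have "Q' b = n" using QQ'(2)[of n] Q(2) by simp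
    ultimately show ?thesis
      using orthogonal_transformation_linear[OF Q'] by (simp add: linear_add linear_scale QQ')
  qed
  ultimately show ?thesis by simp
qed

text \<open>The map fixes the hyperplane orthogonal to \<open>n\<close> and takes \<open>n\<close> to \<open>v\<close>; it is a dilation along
  \<open>n\<close> followed by a shear.\<close>
lemma transvection_scales_volume:
  fixes n v :: "real^'n"
  assumes n: "norm n = 1" and v: "n \<bullet> v \<noteq> 0"
  shows "scales_volume (\<lambda>z. z + (n \<bullet> z) *\<^sub>R (v - n)) (ennreal (1 / \<bar>n \<bullet> v\<bar>))"
proof -
  have nn: "n \<bullet> n = 1" using n by (simp add: dot_square_norm)
  define t where "t = n \<bullet> v"
  define u where "u = (1 / t) *\<^sub>R (v - t *\<^sub>R n)"
  have u: "n \<bullet> u = 0" by (simp add: u_def inner_diff_right nn t_def)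
  have tu: "t *\<^sub>R u = v - t *\<^sub>R n" using v by (simp add: u_def t_def)
  let ?S = "\<lambda>z. z + (n \<bullet> z) *\<^sub>R u" and ?D = "\<lambda>z. z + ((t - 1) * (n \<bullet> z)) *\<^sub>R n"
  have S: "scales_volume (\<lambda>z. ?S (?D z)) (1 * ennreal (1 / \<bar>t\<bar>))"
    by (intro scales_volume_comp shear_scales_volume dilation_scales_volume n u) (use v in \<open>simp add: t_def\<close>)
  have "?S (?D z) = z + (n \<bullet> z) *\<^sub>R (v - n)" for z
  proof -
    have "?S (?D z) = ?D z + (n \<bullet> z) *\<^sub>R (t *\<^sub>R u)"
      by (simp add: inner_add_right nn algebra_simps)
    then show ?thesis unfolding tu by (simp add: algebra_simps)
  qed
  then have eq: "(\<lambda>z. ?S (?D z)) = (\<lambda>z. z + (n \<bullet> z) *\<^sub>R (v - n))" by (rule ext)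
  show ?thesis using S[unfolded eq] by (simp add: t_def)
qed

section \<open>Surface measure on a flat face\<close>

lemma (in complete_measure) measurable_cong_AE_complete:
  fixes f g :: "'a \<Rightarrow> real"
  assumes ae: "AE x in M. f x = g x" and f: "f \<in> borel_measurable M"
  shows "g \<in> borel_measurable M"
proof (rule measurableI)
  fix A :: "real set" assume A: "A \<in> sets borel"
  have "AE x in M. x \<in> f -` A \<inter> space M \<longleftrightarrow> x \<in> g -` A \<inter> space M"
    using ae by eventually_elim auto
  then show "g -` A \<inter> space M \<in> sets M"
    by (rule in_sets_AE[OF _ measurable_sets[OF f A]]) auto
qed simp

text \<open>On a complete measure space, changing a function on a null set affects neither its measurability
  nor its integral. Functions prescribed only on an element or a face need this form, as nothing is known
  about their measurability elsewhere.\<close>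
lemma (in complete_measure) integral_cong_AE_complete:
  fixes f g :: "'a \<Rightarrow> real"
  assumes ae: "AE x in M. f x = g x"
  shows "integral\<^sup>L M f = integral\<^sup>L M g" and "integrable M f \<longleftrightarrow> integrable M g"
proof -
  have ae': "AE x in M. g x = f x" using ae by eventually_elim simp
  have meas: "f \<in> borel_measurable M \<longleftrightarrow> g \<in> borel_measurable M"
    using measurable_cong_AE_complete[OF ae] measurable_cong_AE_complete[OF ae'] by blast
  show int: "integrable M f \<longleftrightarrow> integrable M g"
    using meas integrable_cong_AE[OF _ _ ae] by (meson borel_measurable_integrable)
  show "integral\<^sup>L M f = integral\<^sup>L M g"
  proof (cases "integrable M f")
    case True
    then show ?thesis using meas ae by (intro integral_cong_AE) auto
  next
    case False
    then show ?thesis using int by (simp add: not_integrable_integral_eq)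
  qed
qed

definition normal_to :: "(real^'n) set \<Rightarrow> real^'n \<Rightarrow> bool" where
  "normal_to e n \<longleftrightarrow> norm n = 1 \<and> (\<forall>x\<in>e. \<forall>y\<in>e. n \<bullet> (x - y) = 0)"

text \<open>A set of codimension one spans a hyperplane, and any of its unit normals describes it.\<close>
lemma affine_hull_normal:
  fixes e :: "(real^'n) set"
  assumes dim: "aff_dim e = int (CARD('n) - 1)" and n: "normal_to e n" and a: "a \<in> affine hull e"
  shows "affine hull e = {x. n \<bullet> (x - a) = 0}"
proof -
  have n0: "n \<noteq> 0" using n by (auto simp: normal_to_def)
  have "e \<noteq> {}" using a by auto
  then obtain b where b: "b \<in> e" by blast
  have sub: "e \<subseteq> {x. n \<bullet> x = n \<bullet> b}"
  proof
    fix x assume "x \<in> e"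
    then have "n \<bullet> (x - b) = 0" using n b by (simp only: normal_to_def)
    then show "x \<in> {x. n \<bullet> x = n \<bullet> b}" by (simp add: inner_diff_right)
  qed
  then have "affine hull e \<subseteq> {x. n \<bullet> x = n \<bullet> b}"
    by (intro hull_minimal affine_hyperplane)
  moreover have "aff_dim (affine hull e) = aff_dim {x. n \<bullet> x = n \<bullet> b}"
    using dim n0 by (simp add: aff_dim_affine_hull of_nat_diff)
  ultimately have "affine hull e = {x. n \<bullet> x = n \<bullet> b}"
    using b by (intro affine_dim_equal affine_affine_hull affine_hyperplane) (auto simp: hull_inc)
  then show ?thesis using a by (auto simp: inner_diff_right)
qed

lemma normal_to_unique:
  fixes e :: "(real^'n) set"
  assumes dim: "aff_dim e = int (CARD('n) - 1)" and "normal_to e n" "normal_to e m"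
  shows "m = n \<or> m = - n"
proof -
  have nn: "n \<bullet> n = 1" "m \<bullet> m = 1" using assms by (auto simp: normal_to_def dot_square_norm)
  have "e \<noteq> {}" using dim by auto
  then obtain a where a: "a \<in> affine hull e" using hull_inc by fastforce
  define w where "w = m - (n \<bullet> m) *\<^sub>R n"
  have nw: "n \<bullet> w = 0" by (simp add: w_def inner_diff_right nn)
  then have "a + w \<in> affine hull e" using affine_hull_normal[OF dim assms(2) a] by simp
  then have mw: "m \<bullet> w = 0" using affine_hull_normal[OF dim assms(3) a] by simp
  have "w \<bullet> w = 0"
    using nw mw by (simp add: w_def inner_diff_left)
  then have m: "m = (n \<bullet> m) *\<^sub>R n" by (simp add: w_def)
  then have "(n \<bullet> m) * (n \<bullet> m) = 1"
    using nn by (metis inner_scaleR_left inner_scaleR_right mult.right_neutral)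
  then have "n \<bullet> m = 1 \<or> n \<bullet> m = -1" by (simp add: square_eq_1_iff)
  then show ?thesis using m by (metis scaleR_minus1_left scaleR_one)
qed

lemma normal_to_unit_normal:
  fixes e :: "(real^'n) set"
  assumes dim: "aff_dim e = int (CARD('n) - 1)"
  shows "normal_to e (unit_normal e)"
proof -
  have "CARD('n) > 0" by simp
  then have "aff_dim e < DIM(real^'n)" unfolding dim DIM_cart DIM_real by linarith
  then obtain a b where ab: "a \<noteq> 0" "e \<subseteq> {x. a \<bullet> x = b}" by (rule aff_lowdim_subset_hyperplane)
  have "a \<bullet> (x - y) = 0" if "x \<in> e" "y \<in> e" for x y
    using subsetD[OF ab(2) that(1)] subsetD[OF ab(2) that(2)] by (simp add: inner_diff_right)
  then have "normal_to e ((1 / norm a) *\<^sub>R a)"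
    using ab(1) by (simp add: normal_to_def)
  then show ?thesis
    unfolding unit_normal_def normal_to_def by (rule someI)
qed

lemma closest_point_hyperplane:
  fixes e :: "(real^'n) set"
  assumes dim: "aff_dim e = int (CARD('n) - 1)" and n: "normal_to e n" and a: "a \<in> affine hull e"
  shows "closest_point (affine hull e) x = x - (n \<bullet> (x - a)) *\<^sub>R n"
proof -
  let ?y = "x - (n \<bullet> (x - a)) *\<^sub>R n"
  have nn: "n \<bullet> n = 1" using n by (simp add: normal_to_def dot_square_norm)
  note H = affine_hull_normal[OF assms]
  have y: "?y \<in> affine hull e"
    unfolding H by (simp add: inner_diff_right nn)
  have "dist x ?y \<le> dist x z" if z: "z \<in> affine hull e" for z
  proof -
    have "n \<bullet> (x - a) = n \<bullet> (x - z)" using z unfolding H by (simp add: inner_diff_right)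
    moreover have "\<bar>n \<bullet> (x - z)\<bar> \<le> norm n * norm (x - z)" by (rule Cauchy_Schwarz_ineq2)
    ultimately show ?thesis using n by (simp add: dist_norm normal_to_def)
  qed
  then show ?thesis
    using closest_point_unique[OF affine_imp_convex[OF affine_affine_hull] closed_affine_hull y] by metis
qed

text \<open>The prism over \<open>e\<close> with edges \<open>v\<close>; the right prism is the case of a unit normal.\<close>
definition slant :: "(real^'n) set \<Rightarrow> real^'n \<Rightarrow> (real^'n) set" where
  "slant e v = {x + t *\<^sub>R v | x t. x \<in> e \<and> 0 \<le> t \<and> t \<le> 1}"

lemma prism_eq_slant: "prism e = slant e (unit_normal e)"
  by (simp add: prism_def slant_def)

lemma compact_slant: "compact e \<Longrightarrow> compact (slant e v)"
proof -
  assume e: "compact e"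
  have "slant e v = (\<lambda>(x, t). x + t *\<^sub>R v) ` (e \<times> {0..1::real})"
    by (auto simp: slant_def image_iff) (metis)
  moreover have "compact ((\<lambda>(x, t). x + t *\<^sub>R v) ` (e \<times> {0..1::real}))"
    by (intro compact_continuous_image compact_Times e compact_Icc)
       (auto simp: split_beta intro!: continuous_intros)
  ultimately show ?thesis by simp
qed

lemma continuous_closest_point_hull:
  fixes e :: "(real^'n) set"
  assumes "aff_dim e = int (CARD('n) - 1)"
  shows "continuous_on UNIV (closest_point (affine hull e))"
proof -
  have "e \<noteq> {}" using assms by auto
  then obtain a where a: "a \<in> affine hull e" using hull_inc by fastforce
  show ?thesis
    using closest_point_hyperplane[OF assms normal_to_unit_normal[OF assms] a]
    by (auto intro!: continuous_intros simp: fun_eq_iff cong: continuous_on_cong)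
qed

lemma closest_point_prism:
  fixes e :: "(real^'n) set"
  assumes dim: "aff_dim e = int (CARD('n) - 1)" and x: "x \<in> e"
  shows "closest_point (affine hull e) (x + t *\<^sub>R unit_normal e) = x"
proof -
  note n = normal_to_unit_normal[OF dim]
  have "unit_normal e \<bullet> unit_normal e = 1" using n by (simp add: normal_to_def dot_square_norm)
  then show ?thesis
    using closest_point_hyperplane[OF dim n hull_inc[OF x]] by simp
qed

lemma surface_integral:
  fixes e :: "(real^'n) set" and F :: "real^'n \<Rightarrow> real"
  assumes dim: "aff_dim e = int (CARD('n) - 1)" and e: "compact e" and F: "continuous_on UNIV F"
  shows "integrable (surface_measure e) F" (is ?int)
    and "integrable lborel (\<lambda>x. indicator (prism e) x *\<^sub>R F (closest_point (affine hull e) x))" (is ?intb)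
    and "(LINT x|surface_measure e. F x)
       = (LINT x|lborel. indicator (prism e) x *\<^sub>R F (closest_point (affine hull e) x))" (is ?eq)
proof -
  have cp: "continuous_on UNIV (closest_point (affine hull e))"
    by (rule continuous_closest_point_hull[OF dim])
  note [measurable] = borel_measurable_continuous_onI[OF cp] borel_measurable_continuous_onI[OF F]
  have [measurable]: "closest_point (affine hull e) \<in> borel_measurable (restrict_space lborel (prism e))"
    by (rule measurable_restrict_space1) measurable
  have K: "compact (prism e)" unfolding prism_eq_slant by (rule compact_slant[OF e])
  then have K' [measurable]: "prism e \<in> sets borel" by (intro borel_closed compact_imp_closed)
  have "continuous_on UNIV (\<lambda>x. F (closest_point (affine hull e) x))"
    by (rule continuous_on_compose2[OF F cp]) auto
  then show ?intb
    using borel_integrable_compact[OF K, of "\<lambda>x. F (closest_point (affine hull e) x)"]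
    by (auto simp: set_integrable_def intro: continuous_on_subset)
  then have "integrable (restrict_space lborel (prism e)) (\<lambda>x. F (closest_point (affine hull e) x))"
    by (subst integrable_restrict_space) (auto simp: mult.commute)
  then show ?int
    unfolding surface_measure_def
    by (subst integrable_completion, measurable, subst integrable_distr_eq) auto
  show ?eq
    unfolding surface_measure_def
    by (subst integral_completion, measurable, subst integral_distr)
       (auto simp: integral_restrict_space)
qed

lemma AE_surface_measure:
  fixes e :: "(real^'n) set"
  assumes dim: "aff_dim e = int (CARD('n) - 1)" and e: "compact e"
  shows "AE x in surface_measure e. x \<in> e"
proof -
  have cp: "continuous_on UNIV (closest_point (affine hull e))"
    by (rule continuous_closest_point_hull[OF dim])
  note [measurable] = borel_measurable_continuous_onI[OF cp]
  have [measurable]: "closest_point (affine hull e) \<in> borel_measurable (restrict_space lborel (prism e))"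
    by (rule measurable_restrict_space1) measurable
  have [measurable]: "e \<in> sets borel" using e by (intro borel_closed compact_imp_closed)
  have "AE x in restrict_space lborel (prism e). closest_point (affine hull e) x \<in> e"
    by (rule AE_I2) (auto simp: space_restrict_space prism_def closest_point_prism[OF dim])
  then have "AE x in distr (restrict_space lborel (prism e)) borel (closest_point (affine hull e)). x \<in> e"
    by (subst AE_distr_iff) auto
  then show ?thesis unfolding surface_measure_def by (rule AE_completion)
qed

lemma surface_integral_cong:
  fixes e :: "(real^'n) set" and F :: "real^'n \<Rightarrow> real"
  assumes dim: "aff_dim e = int (CARD('n) - 1)" and e: "compact e"
    and FG: "\<And>x. x \<in> e \<Longrightarrow> F x = G x"
  shows "(LINT x|surface_measure e. F x) = (LINT x|surface_measure e. G x)"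
    and "integrable (surface_measure e) F \<longleftrightarrow> integrable (surface_measure e) G"
proof -
  have "AE x in surface_measure e. F x = G x"
    using AE_surface_measure[OF dim e] by eventually_elim (rule FG)
  then show "(LINT x|surface_measure e. F x) = (LINT x|surface_measure e. G x)"
    "integrable (surface_measure e) F \<longleftrightarrow> integrable (surface_measure e) G"
    unfolding surface_measure_def by (rule completion.integral_cong_AE_complete)+
qed

text \<open>The linear map that fixes the directions of the face and takes its normal to \<open>v\<close> carries the
  right prism onto the slanted one, and the orthogonal projection to the projection along \<open>v\<close>. It changes
  volumes by the modulus of the normal component of \<open>v\<close>.\<close>
lemma slant_surface_integral:
  fixes e :: "(real^'n) set" and F :: "real^'n \<Rightarrow> real"
  assumes dim: "aff_dim e = int (CARD('n) - 1)" and e: "compact e" and F: "continuous_on UNIV F"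
    and n: "normal_to e n" and v: "n \<bullet> v \<noteq> 0" and a: "a \<in> affine hull e"
  shows "integrable lborel (\<lambda>x. indicator (slant e v) x *\<^sub>R F (x - ((n \<bullet> (x - a)) / (n \<bullet> v)) *\<^sub>R v))" (is ?int)
    and "(LINT x|lborel. indicator (slant e v) x *\<^sub>R F (x - ((n \<bullet> (x - a)) / (n \<bullet> v)) *\<^sub>R v))
       = \<bar>n \<bullet> v\<bar> * (LINT x|surface_measure e. F x)" (is ?eq)
proof -
  define m where "m = unit_normal e"
  have m: "normal_to e m" unfolding m_def by (rule normal_to_unit_normal[OF dim])
  have mm: "m \<bullet> m = 1" using m by (simp add: normal_to_def dot_square_norm)
  have "m = n \<or> m = - n" using normal_to_unique[OF dim n m] .
  then have mn: "m \<bullet> v \<noteq> 0" "\<bar>n \<bullet> v\<bar> = \<bar>m \<bullet> v\<bar>" "(n \<bullet> (x - a)) / (n \<bullet> v) = (m \<bullet> (x - a)) / (m \<bullet> v)" for x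
    using v by auto
  define \<pi> where "\<pi> = (\<lambda>x. x - ((m \<bullet> (x - a)) / (m \<bullet> v)) *\<^sub>R v)"
  define S where "S = (\<lambda>x. indicator (slant e v) x *\<^sub>R F (\<pi> x))"
  have "continuous_on UNIV (\<lambda>x. F (\<pi> x))"
    unfolding \<pi>_def by (rule continuous_on_compose2[OF F]) (auto intro!: continuous_intros simp: mn)
  then show int: ?int
    using borel_integrable_compact[OF compact_slant[OF e], of v "\<lambda>x. F (\<pi> x)"]
    by (auto simp: set_integrable_def \<pi>_def mn intro: continuous_on_subset)
  then have [measurable]: "S \<in> borel_measurable borel"
    using borel_measurable_integrable[OF int] by (simp add: S_def \<pi>_def mn)
  define L where "L = (\<lambda>z. z + (m \<bullet> z) *\<^sub>R (v - m))"
  define A where "A = (\<lambda>x. a + L (x - a))"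
  have L: "scales_volume L (ennreal (1 / \<bar>m \<bullet> v\<bar>))"
    unfolding L_def using m mn by (intro transvection_scales_volume) (auto simp: normal_to_def)
  have [measurable]: "L \<in> borel_measurable borel" using L by (simp add: scales_volume_def)
  have [measurable]: "A \<in> borel_measurable borel" unfolding A_def by measurable
  have "distr lborel borel A = density lborel (\<lambda>_. ennreal (1 / \<bar>m \<bullet> v\<bar>))"
  proof (rule measure_eqI)
    fix X assume "X \<in> sets (distr lborel borel A)"
    then have [measurable]: "X \<in> sets borel" by simp
    have i [measurable]: "(\<lambda>x. indicator X (a + x) :: ennreal) \<in> borel_measurable borel" by measurable
    have "emeasure (distr lborel borel A) X = (\<integral>\<^sup>+x. indicator X x \<partial>distr lborel borel A)" by simp
    also have "\<dots> = (\<integral>\<^sup>+x. indicator X (a + L (- a + x)) \<partial>lborel)"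
      by (subst nn_integral_distr) (auto simp: A_def)
    also have "\<dots> = (\<integral>\<^sup>+x. indicator X (a + L x) \<partial>lborel)"
      by (rule nn_integral_lborel_translate) measurable
    also have "\<dots> = ennreal (1 / \<bar>m \<bullet> v\<bar>) * (\<integral>\<^sup>+x. indicator X (a + x) \<partial>lborel)"
      using L[unfolded scales_volume_def, THEN conjunct2, THEN bspec, OF i] by simp
    also have "(\<integral>\<^sup>+x. indicator X (a + x) \<partial>lborel) = (\<integral>\<^sup>+x. indicator X x \<partial>lborel)"
      by (rule nn_integral_lborel_translate) measurable
    finally show "emeasure (distr lborel borel A) X
        = emeasure (density lborel (\<lambda>_. ennreal (1 / \<bar>m \<bullet> v\<bar>))) X"
      by (simp add: emeasure_density nn_integral_cmult)
  qed simp
  then have "(LINT x|distr lborel borel A. S x) = (LINT x|density lborel (\<lambda>_. ennreal (1 / \<bar>m \<bullet> v\<bar>)). S x)"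
    by simp
  then have "(LINT x|lborel. S (A x)) = (1 / \<bar>m \<bullet> v\<bar>) * (LINT x|lborel. S x)"
    by (simp add: integral_distr integral_density)
  moreover have "S (A x) = indicator (prism e) x *\<^sub>R F (closest_point (affine hull e) x)" for x
  proof -
    let ?c = "x - (m \<bullet> (x - a)) *\<^sub>R m"
    have A: "A x = ?c + (m \<bullet> (x - a)) *\<^sub>R v"
      by (simp add: A_def L_def algebra_simps)
    have mA: "m \<bullet> (A x - a) = (m \<bullet> (x - a)) * (m \<bullet> v)"
      by (simp add: A inner_add_right inner_diff_right mm)
    have \<pi>A: "\<pi> (A x) = ?c" using mn(1) by (simp add: \<pi>_def mA) (simp add: A)
    have me: "m \<bullet> (y - a) = 0" if "y \<in> e" for y
      using affine_hull_normal[OF dim m a] hull_inc[OF that, of affine] by auto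
    have slant: "z \<in> slant e w \<longleftrightarrow> z - t *\<^sub>R w \<in> e \<and> 0 \<le> t \<and> t \<le> 1"
      if "m \<bullet> w \<noteq> 0" "m \<bullet> (z - a) = t * (m \<bullet> w)" for z w t
    proof
      assume "z \<in> slant e w"
      then obtain y s where ys: "z = y + s *\<^sub>R w" "y \<in> e" "0 \<le> s" "s \<le> 1" by (auto simp: slant_def)
      have "m \<bullet> (z - a) = m \<bullet> (y - a) + s * (m \<bullet> w)"
        by (simp add: ys inner_add_right inner_diff_right)
      then have "s = t" using that me[OF ys(2)] by simp
      then show "z - t *\<^sub>R w \<in> e \<and> 0 \<le> t \<and> t \<le> 1" using ys by simp
    next
      assume "z - t *\<^sub>R w \<in> e \<and> 0 \<le> t \<and> t \<le> 1"
      moreover have "z = (z - t *\<^sub>R w) + t *\<^sub>R w" by simp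
      ultimately show "z \<in> slant e w" unfolding slant_def by blast
    qed
    have "A x \<in> slant e v \<longleftrightarrow> ?c \<in> e \<and> 0 \<le> m \<bullet> (x - a) \<and> m \<bullet> (x - a) \<le> 1"
      using slant[OF mn(1) mA] by (simp add: A)
    moreover have "x \<in> prism e \<longleftrightarrow> ?c \<in> e \<and> 0 \<le> m \<bullet> (x - a) \<and> m \<bullet> (x - a) \<le> 1"
      using slant[of m x "m \<bullet> (x - a)"] by (simp add: mm prism_eq_slant flip: m_def)
    ultimately show ?thesis
      by (simp add: S_def \<pi>A closest_point_hyperplane[OF dim m a] indicator_def)
  qed
  ultimately have "(LINT x|lborel. S x) = \<bar>m \<bullet> v\<bar> * (LINT x|surface_measure e. F x)"
    using surface_integral(3)[OF dim e F] mn(1) by (simp add: field_simps)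
  then show ?eq by (simp add: S_def \<pi>_def mn)
qed

section \<open>Geometry of polyhedral meshes\<close>

lemma negligible_aff_dim:
  fixes S :: "(real^'n) set"
  assumes "aff_dim S < int CARD('n)" shows "negligible S"
proof -
  have "aff_dim S < DIM(real^'n)" using assms by simp
  then obtain a b where "a \<noteq> 0" "S \<subseteq> {x. a \<bullet> x = b}" by (rule aff_lowdim_subset_hyperplane)
  then show ?thesis using negligible_hyperplane[of a b] negligible_subset by blast
qed

text \<open>A cylinder over an affine set of codimension two, and likewise a cone, lies in an affine set of
  codimension one. This is why a generic segment misses finitely many sets of codimension two.\<close>
lemma negligible_affine_cylinder:
  fixes A :: "(real^'n) set"
  assumes A: "affine A" and dim: "aff_dim A < int CARD('n) - 1"
  shows "negligible {x. \<exists>s. x + s *\<^sub>R v \<in> A}"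
proof (cases "A = {}")
  case False
  then obtain a where a: "a \<in> A" by blast
  let ?B = "affine hull (insert (a + v) A)"
  have "{x. \<exists>s. x + s *\<^sub>R v \<in> A} \<subseteq> ?B"
  proof safe
    fix x s assume "x + s *\<^sub>R v \<in> A"
    then have "x + s *\<^sub>R v \<in> ?B" "a + v \<in> ?B" "a \<in> ?B" using a by (auto intro: hull_inc)
    then have "(x + s *\<^sub>R v) + (- s) *\<^sub>R ((a + v) - a) \<in> ?B"
      by (metis affine_affine_hull mem_affine_3_minus)
    then show "x \<in> ?B" by simp
  qed
  moreover have "aff_dim ?B < int CARD('n)"
    using dim by (simp add: aff_dim_affine_hull aff_dim_insert)
  ultimately show ?thesis using negligible_aff_dim negligible_subset by blast
qed simp

lemma negligible_affine_cone:
  fixes A :: "(real^'n) set"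
  assumes A: "affine A" and dim: "aff_dim A < int CARD('n) - 1" and p: "p \<notin> A"
  shows "negligible {b. \<exists>s. p + s *\<^sub>R (b - p) \<in> A}"
proof -
  let ?B = "affine hull (insert p A)"
  have "{b. \<exists>s. p + s *\<^sub>R (b - p) \<in> A} \<subseteq> ?B"
  proof safe
    fix b s assume s: "p + s *\<^sub>R (b - p) \<in> A"
    with p have s0: "s \<noteq> 0" by auto
    from s have "p + s *\<^sub>R (b - p) \<in> ?B" "p \<in> ?B" by (auto intro: hull_inc)
    then have "p + (1 / s) *\<^sub>R ((p + s *\<^sub>R (b - p)) - p) \<in> ?B"
      by (metis affine_affine_hull mem_affine_3_minus)
    then show "b \<in> ?B" using s0 by simp
  qed
  moreover have "aff_dim ?B < int CARD('n)"
    using dim by (simp add: aff_dim_affine_hull aff_dim_insert)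
  ultimately show ?thesis using negligible_aff_dim negligible_subset by blast
qed

text \<open>Away from the relative interiors of its full-dimensional convex pieces, a polyhedral set is covered
  by the facets of these pieces and by the pieces of lower dimension.\<close>
lemma polyhedral_rim:
  fixes S :: "(real^'n) set"
  assumes S: "polyhedral m S"
  shows "\<exists>\<A>. finite \<A> \<and> (\<forall>A\<in>\<A>. affine A \<and> aff_dim A < int m) \<and> S - rel_interior S \<subseteq> \<Union>\<A>"
proof -
  obtain \<P> where P: "finite \<P>" "\<And>P. P \<in> \<P> \<Longrightarrow> polytope P" "S = \<Union>\<P>" and dim: "aff_dim S = int m"
    using S by (auto simp: polyhedral_def)
  let ?F = "\<lambda>P. if aff_dim P < int m then {P} else {F. F facet_of P}"
  let ?A = "(\<lambda>F. affine hull F) ` (\<Union>P\<in>\<P>. ?F P)"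
  have le: "aff_dim P \<le> int m" if "P \<in> \<P>" for P
    using that P(3) dim aff_dim_subset[of P S] by auto
  have "finite ?A"
    using P(1,2) by (auto simp: finite_polytope_facets)
  moreover have "\<forall>A\<in>?A. affine A \<and> aff_dim A < int m"
    using le by (fastforce simp: aff_dim_affine_hull facet_of_def split: if_splits)
  moreover have "S - rel_interior S \<subseteq> \<Union>?A"
  proof
    fix x assume x: "x \<in> S - rel_interior S"
    then obtain Q where Q: "Q \<in> \<P>" "x \<in> Q" using P(3) by auto
    show "x \<in> \<Union>?A"
    proof (cases "aff_dim Q < int m")
      case True
      then show ?thesis using Q by (auto intro!: bexI[of _ Q] hull_inc)
    next
      case False
      then have "aff_dim Q = aff_dim S" using le[OF Q(1)] dim by simp
      moreover have sub: "Q \<subseteq> S" using Q P(3) by auto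
      ultimately have "affine hull Q = affine hull S"
        using Q by (intro affine_dim_equal affine_affine_hull hull_mono)
          (auto simp: aff_dim_affine_hull)
      then have "rel_interior Q \<subseteq> rel_interior S" by (rule subset_rel_interior[OF sub])
      then have "x \<in> Q - rel_interior Q" using x Q by blast
      moreover have "polyhedron Q" using P(2)[OF Q(1)] polytope_imp_polyhedron by blast
      ultimately obtain F where "F facet_of Q" "x \<in> F"
        using rel_boundary_of_polyhedron[of Q] by auto
      then show ?thesis using Q False by (auto intro!: bexI[of _ Q] exI[of _ F] hull_inc)
    qed
  qed
  ultimately show ?thesis by blast
qed

locale polyhedral_mesh =
  fixes \<Omega> :: "(real^'n) set" and \<T> \<E> :: "(real^'n) set set"
  assumes dim2: "2 \<le> CARD('n)" and domain: "polyhedral_domain \<Omega>" and mesh: "mesh \<Omega> \<T> \<E>"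
begin

lemma mesh_conditions:
  shows "finite \<T>" and "\<forall>T\<in>\<T>. polyhedral CARD('n) T" and "\<Union>\<T> = closure \<Omega>"
    and "\<forall>T\<in>\<T>. \<forall>T'\<in>\<T>. T \<noteq> T' \<longrightarrow> interior T \<inter> interior T' = {}"
    and "finite \<E>" and "\<forall>e\<in>\<E>. polyhedral (CARD('n) - 1) e"
    and "\<forall>e\<in>\<E>. \<forall>e'\<in>\<E>. e \<noteq> e' \<longrightarrow> rel_interior e \<inter> rel_interior e' = {}"
    and "\<forall>T\<in>\<T>. \<Union>(faces \<E> T) = frontier T"
    and "\<forall>T\<in>\<T>. \<forall>e\<in>faces \<E> T. \<exists>n. is_outward_normal T e n"
    and "\<forall>e\<in>interior_faces \<Omega> \<E>. card {T \<in> \<T>. e \<in> faces \<E> T} = 2"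
  using mesh unfolding mesh_def by satx+

lemmas finite_elements = mesh_conditions(1) and finite_all_faces = mesh_conditions(5)
  and Union_elements = mesh_conditions(3)

lemma finite_faces: "finite (faces \<E> T)"
  using finite_all_faces by (auto simp: faces_def)

lemma compact_polyhedral: "polyhedral m S \<Longrightarrow> compact S"
proof -
  assume "polyhedral m S"
  then obtain \<P> where "finite \<P>" "\<forall>P\<in>\<P>. polytope P" "S = \<Union>\<P>" unfolding polyhedral_def by (elim conjE exE)
  then show "compact S" by (simp add: compact_Union polytope_imp_compact)
qed

lemma element:
  assumes "T \<in> \<T>"
  shows "compact T" "closed T" "closure (interior T) = T" "connected (interior T)" "interior T \<noteq> {}"
proof -
  have p: "polyhedral CARD('n) T" using assms mesh_conditions(2) by blast
  then show c: "compact T" by (rule compact_polyhedral)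
  then show "closed T" by (rule compact_imp_closed)
  have d: "aff_dim T = int CARD('n)" using p by (auto simp: polyhedral_def)
  then have "affine hull T = UNIV" using aff_dim_eq_full[of T] by simp
  then have "rel_interior T = interior T" by (rule rel_interior_interior)
  then show cl: "closure (interior T) = T" and "connected (interior T)"
    using p by (auto simp: polyhedral_def)
  have "T \<noteq> {}" using d by auto
  then show "interior T \<noteq> {}" using cl by auto
qed

lemma face:
  assumes "e \<in> \<E>"
  shows "compact e" "closed e" "closure (rel_interior e) = e" "rel_interior e \<noteq> {}"
    "aff_dim e = int (CARD('n) - 1)"
proof -
  have p: "polyhedral (CARD('n) - 1) e" using assms mesh_conditions(6) by blast
  then show c: "compact e" by (rule compact_polyhedral)
  then show "closed e" by (rule compact_imp_closed)
  show d: "aff_dim e = int (CARD('n) - 1)" and cl: "closure (rel_interior e) = e"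
    using p by (auto simp: polyhedral_def)
  have "e \<noteq> {}" using d by auto
  then show "rel_interior e \<noteq> {}" using cl by auto
qed

lemma faces_subset:
  assumes "T \<in> \<T>" "e \<in> faces \<E> T" shows "e \<in> \<E>" "e \<subseteq> frontier T" "e \<subseteq> T"
  using assms element(2)[OF assms(1)] by (auto simp: faces_def frontier_subset_eq dest: frontier_subset_closed)

lemma Union_faces: "T \<in> \<T> \<Longrightarrow> \<Union>(faces \<E> T) = frontier T"
  using mesh_conditions(8) by blast

lemma negligible_face: "e \<in> \<E> \<Longrightarrow> negligible e"
  using face(5)[of e] dim2 by (intro negligible_aff_dim) simp

lemma negligible_frontier_element: "T \<in> \<T> \<Longrightarrow> negligible (frontier T)"
  using Union_faces[of T] finite_faces[of T] negligible_face
  by (metis (no_types, lifting) faces_subset(1) negligible_Union)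

lemma interior_element_disjoint:
  assumes "T \<in> \<T>" "T' \<in> \<T>" "T \<noteq> T'" shows "interior T \<inter> T' = {}"
proof -
  have "interior T \<inter> interior T' = {}" using mesh_conditions(4) assms by blast
  then have "interior T \<inter> closure (interior T') = {}"
    by (simp add: open_Int_closure_eq_empty)
  then show ?thesis using element(3)[OF assms(2)] by simp
qed

lemma Omega: "bounded \<Omega>" "open \<Omega>" "connected \<Omega>" "\<Omega> \<noteq> {}" "interior (closure \<Omega>) = \<Omega>"
  using domain by (auto simp: polyhedral_domain_def)

lemma interior_element_subset: "T \<in> \<T> \<Longrightarrow> interior T \<subseteq> \<Omega>"
  using Union_elements Omega(5) interior_mono[of T "closure \<Omega>"] by auto

lemma rel_interiors_disjoint:
  "e \<in> \<E> \<Longrightarrow> e' \<in> \<E> \<Longrightarrow> x \<in> rel_interior e \<Longrightarrow> x \<in> rel_interior e' \<Longrightarrow> e = e'"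
  using mesh_conditions(7) by blast

definition skeleton :: "(real^'n) set" where
  "skeleton = (\<Union>e\<in>\<E>. e - rel_interior e)"

lemma skeleton_affine:
  obtains \<A> where "finite \<A>" "\<And>A. A \<in> \<A> \<Longrightarrow> affine A \<and> aff_dim A < int CARD('n) - 1"
    "skeleton \<subseteq> \<Union>\<A>"
proof -
  have "\<forall>e\<in>\<E>. \<exists>\<A>. finite \<A> \<and> (\<forall>A\<in>\<A>. affine A \<and> aff_dim A < int (CARD('n) - 1)) \<and> e - rel_interior e \<subseteq> \<Union>\<A>"
    using mesh_conditions(6) polyhedral_rim by blast
  then obtain f where f: "\<And>e. e \<in> \<E> \<Longrightarrow> finite (f e) \<and> (\<forall>A\<in>f e. affine A \<and> aff_dim A < int (CARD('n) - 1)) \<and> e - rel_interior e \<subseteq> \<Union>(f e)"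
    by metis
  show ?thesis
  proof (rule that[of "\<Union>e\<in>\<E>. f e"])
    show "finite (\<Union>e\<in>\<E>. f e)" using finite_all_faces f by blast
    show "affine A \<and> aff_dim A < int CARD('n) - 1" if "A \<in> (\<Union>e\<in>\<E>. f e)" for A
      using that f dim2 by (fastforce simp: of_nat_diff)
    show "skeleton \<subseteq> \<Union>(\<Union>e\<in>\<E>. f e)" 
      unfolding skeleton_def
    proof (rule UN_least)
      fix e assume "e \<in> \<E>"
      then have "e - rel_interior e \<subseteq> \<Union>(f e)" "f e \<subseteq> (\<Union>e\<in>\<E>. f e)" using f by blast+
      then show "e - rel_interior e \<subseteq> \<Union>(\<Union>e\<in>\<E>. f e)" by (meson Union_mono order_trans)
    qed
  qed
qed

lemma negligible_skeleton_cylinder: "negligible {x. \<exists>s. x + s *\<^sub>R v \<in> skeleton}"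
proof -
  obtain \<A> where A: "finite \<A>" "\<And>A. A \<in> \<A> \<Longrightarrow> affine A \<and> aff_dim A < int CARD('n) - 1"
    "skeleton \<subseteq> \<Union>\<A>" using skeleton_affine by blast
  have "negligible (\<Union>A\<in>\<A>. {x. \<exists>s. x + s *\<^sub>R v \<in> A})"
    using A by (intro negligible_Union finite_imageI) (auto intro: negligible_affine_cylinder)
  then show ?thesis by (rule negligible_subset) (use A(3) in blast)
qed

text \<open>The first end point is chosen off the affine sets that cover the skeleton, so that the cones over
  them with this apex are negligible; the second one is chosen off these cones.\<close>
lemma generic_segment:
  assumes U: "open U" "U \<noteq> {}" and W: "open W" "W \<noteq> {}"
  obtains p b where "p \<in> U" "b \<in> W" "closed_segment p b \<inter> skeleton = {}"
proof -
  obtain \<A> where A: "finite \<A>" "\<And>A. A \<in> \<A> \<Longrightarrow> affine A \<and> aff_dim A < int CARD('n) - 1"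
    "skeleton \<subseteq> \<Union>\<A>" using skeleton_affine by blast
  have "negligible (\<Union>\<A>)"
    using A by (intro negligible_Union negligible_aff_dim) fastforce+
  then obtain p where p: "p \<in> U" "p \<notin> \<Union>\<A>"
    using open_not_negligible[OF U] negligible_subset by blast
  have "negligible (\<Union>A\<in>\<A>. {b. \<exists>s. p + s *\<^sub>R (b - p) \<in> A})"
    using A p by (intro negligible_Union finite_imageI) (auto intro: negligible_affine_cone)
  then obtain b where b: "b \<in> W" "b \<notin> (\<Union>A\<in>\<A>. {b. \<exists>s. p + s *\<^sub>R (b - p) \<in> A})"
    using open_not_negligible[OF W] negligible_subset by blast
  have "z \<notin> skeleton" if z: "z \<in> closed_segment p b" for z
  proof -
    obtain s where "z = p + s *\<^sub>R (b - p)"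
      using z by (auto simp: in_segment algebra_simps)
    then show ?thesis using b A(3) by blast
  qed
  then show ?thesis using that p b by blast
qed

lemma rel_interior_projection:
  fixes n :: "real^'n"
  assumes e: "e \<in> \<E>" and n: "normal_to e n" and y: "y \<in> rel_interior e"
  obtains r where "r > 0" "\<And>x. x \<in> ball y r \<Longrightarrow> x - (n \<bullet> (x - y)) *\<^sub>R n \<in> e"
    "\<And>x. x \<in> ball y r \<Longrightarrow> n \<bullet> (x - y) = 0 \<Longrightarrow> x \<in> e"
proof -
  obtain r where r: "r > 0" "ball y r \<inter> affine hull e \<subseteq> e"
    using y by (auto simp: mem_rel_interior_ball)
  have ye: "y \<in> affine hull e" using y rel_interior_subset hull_inc by (metis subsetD)
  have nn: "n \<bullet> n = 1" "norm n = 1" using n by (auto simp: normal_to_def dot_square_norm)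
  note H = affine_hull_normal[OF face(5)[OF e] n ye]
  have "x - (n \<bullet> (x - y)) *\<^sub>R n \<in> e" if x: "x \<in> ball y r" for x
  proof -
    let ?z = "x - (n \<bullet> (x - y)) *\<^sub>R n"
    have zh: "?z \<in> affine hull e" unfolding H by (simp add: inner_diff_right nn)
    have "closest_point (affine hull e) x = ?z"
      by (rule closest_point_hyperplane[OF face(5)[OF e] n ye])
    moreover have "closest_point (affine hull e) y = y" by (rule closest_point_self[OF ye])
    ultimately have "dist ?z y \<le> dist x y"
      using closest_point_lipschitz[of "affine hull e" x y] ye affine_imp_convex[OF affine_affine_hull]
      by (metis closed_affine_hull empty_iff)
    then have "?z \<in> ball y r" using x by (auto simp: dist_commute)
    then show ?thesis using zh r by blast
  qed
  moreover have "x \<in> e" if "x \<in> ball y r" "n \<bullet> (x - y) = 0" for x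
    using calculation[OF that(1)] that(2) by simp
  ultimately show ?thesis using that r(1) by blast
qed

text \<open>The orthogonal projection of a ball around a point of \<open>e\<close> stays in \<open>e\<close>; the points of the ball
  that project into the skeleton form a null set.\<close>
lemma rel_interior_not_subset_skeleton:
  assumes e: "e \<in> \<E>"
  obtains y where "y \<in> rel_interior e" "y \<notin> skeleton"
proof -
  define n where "n = unit_normal e"
  have n: "normal_to e n" unfolding n_def by (rule normal_to_unit_normal[OF face(5)[OF e]])
  obtain y0 where y0: "y0 \<in> rel_interior e" using face(4)[OF e] by blast
  obtain r where r: "r > 0" "\<And>x. x \<in> ball y0 r \<Longrightarrow> x - (n \<bullet> (x - y0)) *\<^sub>R n \<in> e"
    using rel_interior_projection[OF e n y0] by metis
  have "\<not> negligible (ball y0 r)" using r(1) by (intro open_not_negligible) auto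
  then obtain x where x: "x \<in> ball y0 r" "\<forall>s. x + s *\<^sub>R n \<notin> skeleton"
    using negligible_skeleton_cylinder[of n] negligible_subset[of "{x. \<exists>s. x + s *\<^sub>R n \<in> skeleton}" "ball y0 r"] by blast
  let ?y = "x + (- (n \<bullet> (x - y0))) *\<^sub>R n"
  have "?y \<in> e" using r(2)[OF x(1)] by simp
  moreover have "?y \<notin> skeleton" using x(2) by blast
  ultimately have "?y \<in> rel_interior e" "?y \<notin> skeleton" using e by (auto simp: skeleton_def)
  then show ?thesis by (rule that)
qed

lemma frontier_point_face:
  assumes "T \<in> \<T>" "x \<in> frontier T" "x \<notin> skeleton"
  obtains e where "e \<in> faces \<E> T" "x \<in> rel_interior e"
proof -
  obtain e where e: "e \<in> faces \<E> T" "x \<in> e" using Union_faces assms by blast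
  then have "x \<in> rel_interior e"
    using assms faces_subset(1)[OF assms(1)] by (auto simp: skeleton_def)
  with e(1) show ?thesis by (rule that)
qed

lemma outward_normal_exists: "T \<in> \<T> \<Longrightarrow> e \<in> faces \<E> T \<Longrightarrow> \<exists>n. is_outward_normal T e n"
  using mesh_conditions(9) by blast

lemma is_outward_normal_normal_to: "is_outward_normal T e n \<Longrightarrow> normal_to e n"
  by (simp add: is_outward_normal_def normal_to_def)

lemma is_outward_normal_outward_normal:
  assumes T: "T \<in> \<T>" and e: "e \<in> faces \<E> T"
  shows "is_outward_normal T e (outward_normal T e)"
proof -
  have eE: "e \<in> \<E>" by (rule faces_subset(1)[OF T e])
  obtain n where n: "is_outward_normal T e n" using outward_normal_exists[OF T e] by blast
  have "m = n" if m: "is_outward_normal T e m" for m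
  proof (rule ccontr)
    assume "m \<noteq> n"
    then have mn: "m = - n"
      using normal_to_unique[OF face(5)[OF eE]] is_outward_normal_normal_to[OF n] is_outward_normal_normal_to[OF m]
      by blast
    obtain x where x: "x \<in> rel_interior e" using face(4)[OF eE] by blast
    obtain d where d: "d > 0" "\<And>t. 0 < t \<Longrightarrow> t < d \<Longrightarrow> x - t *\<^sub>R n \<in> T"
      using n x unfolding is_outward_normal_def by blast
    obtain d' where d': "d' > 0" "\<And>t. 0 < t \<Longrightarrow> t < d' \<Longrightarrow> x + t *\<^sub>R m \<notin> T"
      using m x unfolding is_outward_normal_def by blast
    have "0 < min d d' / 2" "min d d' / 2 < d" "min d d' / 2 < d'" using d(1) d'(1) by auto
    then show False using d(2)[of "min d d' / 2"] d'(2)[of "min d d' / 2"] by (simp add: mn)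
  qed
  then show ?thesis unfolding outward_normal_def using n by (metis theI)
qed

lemma normal_to_outward_normal:
  "T \<in> \<T> \<Longrightarrow> e \<in> faces \<E> T \<Longrightarrow> normal_to e (outward_normal T e)"
  by (rule is_outward_normal_normal_to[OF is_outward_normal_outward_normal])

text \<open>Off the skeleton, \<open>y\<close> lies on no other face of \<open>T\<close>, so in a small ball the frontier of \<open>T\<close> is
  contained in the hyperplane of \<open>e\<close>. Each open half of the ball is connected and misses the frontier, hence
  lies on one side of it; the outward normal tells which half is inside.\<close>
lemma local_half_ball:
  assumes T: "T \<in> \<T>" and e: "e \<in> faces \<E> T" and y: "y \<in> rel_interior e" "y \<notin> skeleton"
  defines "n \<equiv> outward_normal T e"
  obtains r where "r > 0" "\<And>x. x \<in> ball y r \<Longrightarrow> x \<in> T \<longleftrightarrow> n \<bullet> (x - y) \<le> 0"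
proof -
  have n: "is_outward_normal T e n" unfolding n_def by (rule is_outward_normal_outward_normal[OF T e])
  have nt: "normal_to e n" by (rule is_outward_normal_normal_to[OF n])
  have nn: "n \<bullet> n = 1" "norm n = 1" using nt by (auto simp: normal_to_def dot_square_norm)
  have eE: "e \<in> \<E>" by (rule faces_subset(1)[OF T e])
  have ye: "y \<in> e" using y(1) rel_interior_subset by blast
  let ?K = "\<Union>(faces \<E> T - {e})"
  have "closed ?K" using finite_faces[of T] faces_subset(1)[OF T] face(2) by (intro closed_Union) auto
  moreover have "y \<notin> ?K"
  proof
    assume "y \<in> ?K"
    then obtain e' where e': "e' \<in> faces \<E> T" "e' \<noteq> e" "y \<in> e'" by blast
    then have "e' \<in> \<E>" using faces_subset(1)[OF T] by blast
    moreover from this have "y \<in> rel_interior e'" using e' y(2) by (auto simp: skeleton_def)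
    ultimately show False using rel_interiors_disjoint[OF eE _ y(1)] e'(2) by blast
  qed
  ultimately have "open (- ?K)" "y \<in> - ?K" by auto
  then obtain r1 where r1: "r1 > 0" "ball y r1 \<subseteq> - ?K" by (meson open_contains_ball)
  obtain r2 where r2: "r2 > 0" "\<And>x. x \<in> ball y r2 \<Longrightarrow> n \<bullet> (x - y) = 0 \<Longrightarrow> x \<in> e"
    using rel_interior_projection[OF eE nt y(1)] by metis
  obtain d where d: "d > 0" "\<And>t. 0 < t \<Longrightarrow> t < d \<Longrightarrow> y - t *\<^sub>R n \<in> T \<and> y + t *\<^sub>R n \<notin> T"
    using n y(1) unfolding is_outward_normal_def by blast
  define r where "r = min r1 r2"
  have r: "r > 0" using r1 r2 by (simp add: r_def)
  define t where "t = min d r / 2"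
  have t: "0 < t" "t < d" "t < r" using d r by (auto simp: t_def)
  have fr: "n \<bullet> (x - y) = 0" if "x \<in> ball y r" "x \<in> frontier T" for x
  proof -
    have "x \<in> ball y r1" using that(1) by (simp add: r_def)
    moreover have "x \<in> \<Union>(faces \<E> T)" using that(2) Union_faces[OF T] by simp
    ultimately have "x \<in> e" using r1(2) by blast
    then show ?thesis using nt ye by (auto simp: normal_to_def)
  qed
  have ip: "n \<bullet> (x - y) = n \<bullet> x - n \<bullet> y" for x by (simp add: inner_diff_right)
  let ?L = "ball y r \<inter> {x. n \<bullet> x < n \<bullet> y}" and ?R = "ball y r \<inter> {x. n \<bullet> x > n \<bullet> y}"
  have conn: "connected ?L" "connected ?R"
    by (intro convex_connected convex_Int convex_ball convex_halfspace_lt convex_halfspace_gt)+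
  have "?L \<inter> frontier T = {}" "?R \<inter> frontier T = {}" using fr by (auto simp: ip)
  moreover have "y - t *\<^sub>R n \<in> ?L \<inter> T" "y + t *\<^sub>R n \<in> ?R - T"
    using t d(2)[of t] nn by (auto simp: inner_diff_right inner_add_right dist_norm)
  ultimately have L: "?L - T = {}" and R: "?R \<inter> T = {}"
    using connected_Int_frontier[OF conn(1), of T] connected_Int_frontier[OF conn(2), of T] by blast+
  have "x \<in> T \<longleftrightarrow> n \<bullet> (x - y) \<le> 0" if x: "x \<in> ball y r" for x
  proof (cases "n \<bullet> (x - y)" "0::real" rule: linorder_cases)
    case less
    then show ?thesis using L x by (auto simp: ip)
  next
    case equal
    then show ?thesis using r2(2)[of x] x faces_subset(3)[OF T e] by (auto simp: r_def)
  next
    case greater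
    then show ?thesis using R x by (auto simp: ip)
  qed
  then show ?thesis using that r by blast
qed

text \<open>Near a generic point of a shared face, both elements are half balls with disjoint interiors, so
  they are opposite halves and together fill a neighbourhood. As the domain has no slits, the point is
  in the domain.\<close>
lemma shared_face:
  assumes s: "shared_by \<T> \<E> e T1 T2"
  shows "outward_normal T2 e = - outward_normal T1 e" (is ?n) and "e \<in> interior_faces \<Omega> \<E>" (is ?i)
    and "y \<in> rel_interior e \<Longrightarrow> y \<notin> skeleton \<Longrightarrow> y \<in> \<Omega>"
proof -
  from s have T: "T1 \<in> \<T>" "T2 \<in> \<T>" "T1 \<noteq> T2" and e: "e \<in> faces \<E> T1" "e \<in> faces \<E> T2"
    by (auto simp: shared_by_def)
  have eE: "e \<in> \<E>" by (rule faces_subset(1)[OF T(1) e(1)])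
  have both: "outward_normal T2 e = - outward_normal T1 e \<and> y \<in> \<Omega>"
    if y: "y \<in> rel_interior e" "y \<notin> skeleton" for y
  proof -
    let ?n1 = "outward_normal T1 e" and ?n2 = "outward_normal T2 e"
    obtain r1 where r1: "r1 > 0" "\<And>x. x \<in> ball y r1 \<Longrightarrow> x \<in> T1 \<longleftrightarrow> ?n1 \<bullet> (x - y) \<le> 0"
      using local_half_ball[OF T(1) e(1) y] by metis
    obtain r2 where r2: "r2 > 0" "\<And>x. x \<in> ball y r2 \<Longrightarrow> x \<in> T2 \<longleftrightarrow> ?n2 \<bullet> (x - y) \<le> 0"
      using local_half_ball[OF T(2) e(2) y] by metis
    define r where "r = min r1 r2"
    have r: "r > 0" using r1 r2 by (simp add: r_def)
    have nt: "normal_to e ?n1" "normal_to e ?n2" using T e normal_to_outward_normal by blast+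
    have "?n2 \<noteq> ?n1"
    proof
      assume eq: "?n2 = ?n1"
      let ?U = "ball y r \<inter> {x. ?n1 \<bullet> x < ?n1 \<bullet> y}"
      have sub: "?U \<subseteq> T1 \<inter> T2" using r1 r2 eq by (auto simp: r_def inner_diff_right)
      have "open ?U" by (intro open_Int open_ball open_halfspace_lt)
      then have "?U \<subseteq> interior T1" using sub by (intro interior_maximal) blast+
      moreover have "y - (r / 2) *\<^sub>R ?n1 \<in> ?U"
        using r nt by (auto simp: normal_to_def inner_diff_right dist_norm dot_square_norm)
      ultimately show False using sub interior_element_disjoint[OF T] by blast
    qed
    then have n: "?n2 = - ?n1" using normal_to_unique[OF face(5)[OF eE] nt] by blast
    have "ball y r \<subseteq> T1 \<union> T2" using r1 r2 n by (force simp: r_def)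
    also have "\<dots> \<subseteq> closure \<Omega>" using Union_elements T by blast
    finally have "y \<in> interior (closure \<Omega>)" using r by (meson centre_in_ball interior_maximal open_ball subsetD)
    then show ?thesis using n Omega(5) by simp
  qed
  obtain y where y: "y \<in> rel_interior e" "y \<notin> skeleton" by (rule rel_interior_not_subset_skeleton[OF eE])
  then show ?n using both by blast
  have "y \<notin> frontier \<Omega>" using both[OF y] Omega(2) by (auto simp: frontier_def interior_open)
  moreover have "y \<in> e" using y rel_interior_subset by blast
  ultimately show ?i using eE by (auto simp: interior_faces_def)
  show "y \<in> \<Omega>" if "y \<in> rel_interior e" "y \<notin> skeleton" for y using both that by blast
qed

lemma interior_face_shared:
  assumes "e \<in> interior_faces \<Omega> \<E>"
  obtains T1 T2 where "shared_by \<T> \<E> e T1 T2" "{T \<in> \<T>. e \<in> faces \<E> T} = {T1, T2}" "T1 \<noteq> T2"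
proof -
  have "card {T \<in> \<T>. e \<in> faces \<E> T} = 2" using assms mesh_conditions(10) by blast
  then obtain T1 T2 where "{T \<in> \<T>. e \<in> faces \<E> T} = {T1, T2}" "T1 \<noteq> T2" by (meson card_2_iff)
  then show ?thesis by (intro that) (auto simp: shared_by_def)
qed

lemma shared_elements:
  assumes "shared_by \<T> \<E> e T1 T2"
  shows "{T \<in> \<T>. e \<in> faces \<E> T} = {T1, T2}"
proof -
  have "e \<in> interior_faces \<Omega> \<E>" by (rule shared_face(2)[OF assms])
  then obtain S1 S2 where "{T \<in> \<T>. e \<in> faces \<E> T} = {S1, S2}" by (rule interior_face_shared)
  moreover have "T1 \<in> {T \<in> \<T>. e \<in> faces \<E> T}" "T2 \<in> {T \<in> \<T>. e \<in> faces \<E> T}" "T1 \<noteq> T2"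
    using assms by (auto simp: shared_by_def)
  ultimately show ?thesis by auto
qed

text \<open>A generic segment that leaves the domain meets its frontier at a point off the skeleton, and the
  face through that point cannot be an interior one.\<close>
lemma boundary_face_exists:
  obtains T e where "T \<in> \<T>" "e \<in> faces \<E> T" "e \<in> boundary_faces \<Omega> \<E>"
proof -
  have "- closure \<Omega> \<noteq> {}"
    using bounded_closure[OF Omega(1)] not_bounded_UNIV[where 'a="real^'n"] by (metis Compl_empty_eq double_compl)
  then obtain p b where pb: "p \<in> \<Omega>" "b \<in> - closure \<Omega>" "closed_segment p b \<inter> skeleton = {}"
    using generic_segment[OF Omega(2,4), of "- closure \<Omega>"] open_Compl[OF closed_closure] by metis
  have "closed_segment p b \<inter> frontier \<Omega> \<noteq> {}"
    using pb closure_subset[of \<Omega>] by (intro connected_Int_frontier) auto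
  then obtain y where y: "y \<in> frontier \<Omega>" "y \<notin> skeleton" using pb(3) by blast
  then obtain T where T: "T \<in> \<T>" "y \<in> T" using Union_elements by (auto simp: frontier_def)
  have y\<Omega>: "y \<notin> \<Omega>" using y Omega(2) by (simp add: frontier_def interior_open)
  then have "y \<notin> interior T" using interior_element_subset[OF T(1)] by blast
  then have "y \<in> frontier T" using T by (simp add: frontier_def element(2) closure_closed)
  then obtain e where e: "e \<in> faces \<E> T" "y \<in> rel_interior e"
    using frontier_point_face[OF T(1) _ y(2)] by blast
  have "e \<in> boundary_faces \<Omega> \<E>"
  proof (rule ccontr)
    assume "e \<notin> boundary_faces \<Omega> \<E>"
    then have "e \<in> interior_faces \<Omega> \<E>"
      using faces_subset(1)[OF T(1) e(1)] by (simp add: boundary_faces_def interior_faces_def)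
    then obtain T1 T2 where "shared_by \<T> \<E> e T1 T2" by (rule interior_face_shared)
    then show False using shared_face(3)[OF _ e(2) y(2)] y\<Omega> by blast
  qed
  then show ?thesis using that T(1) e(1) by blast
qed

text \<open>If the class were proper, its union and the union of the remaining elements would meet in the
  connected domain. Near a common point a generic segment joins the two unions, and at the point where it
  changes sides it lies in the relative interior of a face shared by elements of both classes.\<close>
lemma elements_connected:
  assumes "\<A> \<subseteq> \<T>" "\<A> \<noteq> {}"
    and step: "\<And>e T1 T2. shared_by \<T> \<E> e T1 T2 \<Longrightarrow> T1 \<in> \<A> \<Longrightarrow> T2 \<in> \<A>"
  shows "\<A> = \<T>"
proof (rule ccontr)
  assume "\<A> \<noteq> \<T>"
  let ?X = "\<Union>\<A>" and ?Y = "\<Union>(\<T> - \<A>)"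
  have fin: "finite \<A>" using assms(1) finite_elements finite_subset by blast
  have cl: "closed ?X" "closed ?Y"
    using assms(1) fin finite_elements element(2) by (auto intro!: closed_Union)
  have cover: "\<Omega> \<subseteq> ?X \<union> ?Y" using Union_elements closure_subset[of \<Omega>] assms(1) by blast
  have meets: "T \<inter> \<Omega> \<noteq> {}" if "T \<in> \<T>" for T
    using element(5)[OF that] interior_element_subset[OF that] interior_subset[of T] by blast
  have ne: "?X \<inter> \<Omega> \<noteq> {}" "?Y \<inter> \<Omega> \<noteq> {}"
    using assms(1,2) \<open>\<A> \<noteq> \<T>\<close> meets by blast+
  have "?X \<inter> ?Y \<inter> \<Omega> \<noteq> {}"
    using connected_closedD[OF Omega(3) _ cover cl] ne by metis
  then obtain x T T' where x: "x \<in> \<Omega>" "x \<in> T" "x \<in> T'" and T: "T \<in> \<A>" "T' \<in> \<T> - \<A>" by blast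
  obtain r where r: "r > 0" "ball x r \<subseteq> \<Omega>" using Omega(2) x(1) by (meson open_contains_ball)
  have ball_meets: "ball x r \<inter> interior S \<noteq> {}" if "S \<in> \<T>" "x \<in> S" for S
  proof -
    have "x \<in> closure (interior S)" using element(3)[OF that(1)] that(2) by simp
    then show ?thesis using r(1) by (metis centre_in_ball disjoint_iff open_Int_closure_eq_empty open_ball)
  qed
  obtain p b where pb: "p \<in> ball x r \<inter> interior T" "b \<in> ball x r \<inter> interior T'"
    "closed_segment p b \<inter> skeleton = {}"
    using generic_segment[of "ball x r \<inter> interior T" "ball x r \<inter> interior T'"]
      ball_meets[of T] ball_meets[of T'] T x assms(1) by blast
  have seg: "closed_segment p b \<subseteq> \<Omega>"
    using pb r(2) by (meson IntD1 closed_segment_subset convex_ball order_trans)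
  have "?X \<inter> ?Y \<inter> closed_segment p b \<noteq> {}"
  proof -
    have "?X \<inter> closed_segment p b \<noteq> {}" "?Y \<inter> closed_segment p b \<noteq> {}"
      using pb(1,2) T interior_subset[of T] interior_subset[of T']
        ends_in_segment(1)[of p b] ends_in_segment(2)[of b p] by blast+
    moreover have "connected (closed_segment p b)" by simp
    moreover have "closed_segment p b \<subseteq> ?X \<union> ?Y" using seg cover by (rule order_trans)
    ultimately show ?thesis using connected_closedD[of "closed_segment p b" ?X ?Y] cl by metis
  qed
  then obtain z T1 T2 where z: "z \<in> closed_segment p b" "z \<in> T1" "z \<in> T2" and T12: "T1 \<in> \<A>" "T2 \<in> \<T> - \<A>"
    by blast
  have z': "z \<notin> skeleton" using z(1) pb(3) by blast
  have T12': "T1 \<in> \<T>" "T2 \<in> \<T>" "T1 \<noteq> T2" using T12 assms(1) by auto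
  have "z \<in> frontier T1" "z \<in> frontier T2"
    using interior_element_disjoint[OF T12'] interior_element_disjoint[OF T12'(2,1)] T12' z
    by (auto simp: frontier_def closure_closed element(2))
  then obtain e1 e2 where e: "e1 \<in> faces \<E> T1" "z \<in> rel_interior e1" "e2 \<in> faces \<E> T2" "z \<in> rel_interior e2"
    using frontier_point_face T12'(1,2) z' by metis
  then have "e1 = e2" using rel_interiors_disjoint faces_subset(1) T12' by metis
  then have "shared_by \<T> \<E> e1 T1 T2" using e T12' by (simp add: shared_by_def)
  then show False using step T12 by blast
qed

end

section \<open>The divergence theorem on an element\<close>

lemma integral_lborel_translate:
  fixes f :: "'a::euclidean_space \<Rightarrow> real"
  assumes [measurable]: "f \<in> borel_measurable borel"
  shows "(LINT x|lborel. f (a + x)) = (LINT x|lborel. f x)"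
    and "integrable lborel (\<lambda>x. f (a + x)) \<longleftrightarrow> integrable lborel f"
proof -
  have "(LINT x|lborel. f x) = (LINT x|distr lborel borel ((+) a). f x)"
    by (simp add: lborel_distr_plus)
  also have "\<dots> = (LINT x|lborel. f (a + x))"
    by (subst integral_distr) auto
  finally show "(LINT x|lborel. f (a + x)) = (LINT x|lborel. f x)" by simp
  have "integrable lborel f \<longleftrightarrow> integrable (distr lborel borel ((+) a)) f"
    by (simp add: lborel_distr_plus)
  then show "integrable lborel (\<lambda>x. f (a + x)) \<longleftrightarrow> integrable lborel f"
    by (simp add: integrable_distr_eq)
qed

context polyhedral_mesh
begin

text \<open>The trace of \<open>T\<close> on the segment from \<open>x\<close> to \<open>x + v\<close> jumps by the opposite of the sign of \<open>n e \<bullet> v\<close>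
  at each crossing of a face \<open>e\<close>. The trace plus the sum of the signs of the faces already passed is
  therefore constant, and the indicator of \<open>T\<close> under the integral can be replaced by a sum over the crossings, to
  which the fundamental theorem of calculus applies.\<close>
lemma line_crossings:
  fixes x v :: "real^'n" and F :: "real^'n \<Rightarrow> real"
  assumes T: "T \<in> \<T>"
    and F: "\<And>y. (F has_derivative F' y) (at y)" and D: "continuous_on UNIV (\<lambda>y. F' y v)"
    and a: "\<And>e. e \<in> faces \<E> T \<Longrightarrow> a e \<in> e"
    and skel: "\<And>s. x + s *\<^sub>R v \<notin> skeleton"
    and par: "\<And>e. e \<in> faces \<E> T \<Longrightarrow> x \<notin> affine hull e"
    and x0: "x \<notin> frontier T" and x1: "x + v \<notin> frontier T"
  defines "n \<equiv> outward_normal T"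
  defines "c \<equiv> \<lambda>e. (n e \<bullet> (x - a e)) / (n e \<bullet> v)"
  shows "(LINT s|lborel. indicator {0..1} s *\<^sub>R (indicator T (x + s *\<^sub>R v) * F' (x + s *\<^sub>R v) v))
    = indicator T (x + v) * F (x + v) - indicator T x * F x
      + (\<Sum>e\<in>faces \<E> T. sgn (n e \<bullet> v) * (indicator (slant e (- v)) x * F (x - c e *\<^sub>R v)))"
proof -
  have fE: "e \<in> \<E>" if "e \<in> faces \<E> T" for e using faces_subset(1)[OF T that] .
  have nt: "normal_to e (n e)" if "e \<in> faces \<E> T" for e
    unfolding n_def by (rule normal_to_outward_normal[OF T that])
  have hull: "y \<in> affine hull e \<longleftrightarrow> n e \<bullet> (y - a e) = 0" if "e \<in> faces \<E> T" for e y
    using affine_hull_normal[OF face(5)[OF fE[OF that]] nt[OF that] hull_inc[OF a[OF that]]] by simp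
  have hit: "n e \<bullet> v \<noteq> 0 \<and> s = - c e" if e: "e \<in> faces \<E> T" and s: "x + s *\<^sub>R v \<in> e" for e s
  proof -
    have "n e \<bullet> (x + s *\<^sub>R v - a e) = 0" using hull[OF e] hull_inc[OF s] by blast
    then have eq: "n e \<bullet> (x - a e) + s * (n e \<bullet> v) = 0"
      by (simp add: inner_add_right inner_diff_right)
    moreover have "n e \<bullet> (x - a e) \<noteq> 0" using par[OF e] hull[OF e] by blast
    ultimately have "n e \<bullet> v \<noteq> 0" by auto
    moreover from this have "s = - c e" using eq by (simp add: c_def field_simps)
    ultimately show ?thesis by blast
  qed
  define C where "C = {e \<in> faces \<E> T. x \<in> slant e (- v)}"
  have finC: "finite C" unfolding C_def using finite_faces[of T] by simp
  define t where "t = (\<lambda>e. - c e)"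
  have C: "e \<in> faces \<E> T" "x \<in> slant e (- v)" "n e \<bullet> v \<noteq> 0" "x + t e *\<^sub>R v \<in> e" "0 < t e" "t e < 1" if "e \<in> C" for e
  proof -
    show e: "e \<in> faces \<E> T" and xs: "x \<in> slant e (- v)" using that by (simp_all add: C_def)
    obtain y s where s: "x = y + s *\<^sub>R (- v)" "y \<in> e" "0 \<le> s" "s \<le> 1"
      using xs unfolding slant_def by blast
    then have y: "x + s *\<^sub>R v \<in> e" by simp
    then have h: "n e \<bullet> v \<noteq> 0" "s = t e" using hit[OF e] by (auto simp: t_def)
    then show "n e \<bullet> v \<noteq> 0" "x + t e *\<^sub>R v \<in> e" using y by auto
    have fr: "x + s *\<^sub>R v \<in> frontier T" using y faces_subset(2)[OF T e] by blast
    then have "s \<noteq> 0" "s \<noteq> 1" using x0 x1 by auto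
    then show "0 < t e" "t e < 1" using s h by auto
  qed
  have C_I: "e \<in> C \<and> s = t e" if "e \<in> faces \<E> T" "x + s *\<^sub>R v \<in> e" "0 \<le> s" "s \<le> 1" for e s
  proof -
    have "x = (x + s *\<^sub>R v) + s *\<^sub>R (- v)" by simp
    then have "x \<in> slant e (- v)" using that unfolding slant_def by blast
    then show ?thesis using hit[OF that(1,2)] that(1) by (simp add: C_def t_def)
  qed
  define \<sigma> where "\<sigma> = (\<lambda>e. sgn (n e \<bullet> v))"
  define \<psi> :: "real \<Rightarrow> real" where "\<psi> = (\<lambda>s. indicator T (x + s *\<^sub>R v))"
  \<comment> \<open>At a crossing the closed set \<open>T\<close> contains the point, so an entrance counts as passed at once and
    an exit only afterwards. With this convention \<open>\<Phi>\<close> is locally constant at the crossings too.\<close>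
  define P :: "real \<Rightarrow> (real^'n) set \<Rightarrow> real" where
    "P = (\<lambda>s e. of_bool (t e < s \<or> t e = s \<and> n e \<bullet> v < 0))"
  define \<Phi> where "\<Phi> = (\<lambda>s. \<psi> s + (\<Sum>e\<in>C. \<sigma> e * P s e))"
  have P_loc: "\<forall>\<^sub>F s' in nhds s. P s' e = P s e" if "t e \<noteq> s" for s e
  proof (cases "t e < s")
    case True
    then have "\<forall>\<^sub>F s' in nhds s. s' \<in> {t e<..}" by (intro eventually_nhds_in_open) auto
    then show ?thesis by eventually_elim (use True in \<open>simp add: P_def\<close>)
  next
    case False
    then have "\<forall>\<^sub>F s' in nhds s. s' \<in> {..<t e}" using that by (intro eventually_nhds_in_open) auto
    then show ?thesis by eventually_elim (use False that in \<open>simp add: P_def\<close>)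
  qed
  have line: "((\<lambda>s'. x + s' *\<^sub>R v) \<longlongrightarrow> x + s *\<^sub>R v) (nhds s)" for s
    by (intro tendsto_intros filterlim_ident)
  have loc: "\<forall>\<^sub>F s' in nhds s. \<Phi> s' = \<Phi> s" if s: "s \<in> {0..1}" for s
  proof (cases "x + s *\<^sub>R v \<in> frontier T")
    case False
    have ne: "t e \<noteq> s" if "e \<in> C" for e
      using C[OF that] faces_subset(2)[OF T, of e] False by blast
    have "\<forall>\<^sub>F s' in nhds s. \<forall>e\<in>C. P s' e = P s e"
      using finC ne P_loc by (intro eventually_ball_finite) auto
    moreover have "\<forall>\<^sub>F s' in nhds s. \<psi> s' = \<psi> s"
    proof (cases "x + s *\<^sub>R v \<in> T")
      case True
      then have "x + s *\<^sub>R v \<in> interior T" using False element(2)[OF T] by (simp add: frontier_def closure_closed)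
      then have "\<forall>\<^sub>F s' in nhds s. x + s' *\<^sub>R v \<in> interior T"
        by (intro topological_tendstoD[OF line]) auto
      then show ?thesis
        by eventually_elim (use True interior_subset[of T] in \<open>auto simp: \<psi>_def indicator_def\<close>)
    next
      case out: False
      then have "\<forall>\<^sub>F s' in nhds s. x + s' *\<^sub>R v \<in> - T"
        using element(2)[OF T] by (intro topological_tendstoD[OF line]) auto
      then show ?thesis by eventually_elim (use out in \<open>auto simp: \<psi>_def indicator_def\<close>)
    qed
    ultimately show ?thesis by eventually_elim (simp add: \<Phi>_def)
  next
    case True
    let ?y = "x + s *\<^sub>R v"
    obtain e where e: "e \<in> faces \<E> T" "?y \<in> rel_interior e"
      using frontier_point_face[OF T True skel] by blast
    have ye: "?y \<in> e" using e(2) rel_interior_subset by blast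
    have eC: "e \<in> C" "s = t e" using C_I[OF e(1) ye] s by auto
    have ne: "t e' \<noteq> s" if "e' \<in> C - {e}" for e'
    proof
      assume "t e' = s"
      then have "?y \<in> e'" using C(4)[of e'] that by auto
      then have "?y \<in> rel_interior e'" using skel[of s] fE[of e'] that C(1)[of e'] by (auto simp: skeleton_def)
      then show False using rel_interiors_disjoint[OF fE[OF e(1)] fE[of e'] e(2)] that C(1)[of e'] by blast
    qed
    have others: "\<forall>\<^sub>F s' in nhds s. \<forall>e'\<in>C - {e}. P s' e' = P s e'"
      using finC ne P_loc by (intro eventually_ball_finite) auto
    obtain r where r: "r > 0" "\<And>z. z \<in> ball ?y r \<Longrightarrow> z \<in> T \<longleftrightarrow> n e \<bullet> (z - ?y) \<le> 0"
      using local_half_ball[OF T e skel] unfolding n_def by metis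
    have "\<forall>\<^sub>F s' in nhds s. x + s' *\<^sub>R v \<in> ball ?y r"
      using r(1) by (intro topological_tendstoD[OF line]) auto
    then have here: "\<forall>\<^sub>F s' in nhds s. \<psi> s' + \<sigma> e * P s' e = \<psi> s + \<sigma> e * P s e"
    proof eventually_elim
      case (elim s')
      have "x + s' *\<^sub>R v - ?y = (s' - s) *\<^sub>R v" by (simp add: algebra_simps)
      then have 1: "x + s' *\<^sub>R v \<in> T \<longleftrightarrow> (s' - s) * (n e \<bullet> v) \<le> 0"
        using r(2)[OF elim] by simp
      have 2: "?y \<in> T" using ye faces_subset(3)[OF T e(1)] by blast
      show ?case
      proof (cases "n e \<bullet> v > 0")
        case True
        then show ?thesis using 1 2 eC(2)
          by (auto simp: \<psi>_def \<sigma>_def P_def indicator_def mult_le_0_iff)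
      next
        case False
        then have "n e \<bullet> v < 0" using C(3)[OF eC(1)] by simp
        then show ?thesis using 1 2 eC(2)
          by (auto simp: \<psi>_def \<sigma>_def P_def indicator_def mult_le_0_iff)
      qed
    qed
    have split: "\<Phi> s' = (\<psi> s' + \<sigma> e * P s' e) + (\<Sum>e'\<in>C - {e}. \<sigma> e' * P s' e')" for s'
      unfolding \<Phi>_def using sum.remove[OF finC eC(1)] by simp
    show ?thesis using others here by eventually_elim (simp add: split)
  qed
  have const: "\<Phi> s = \<Phi> 0" if "s \<in> {0..1}" for s
  proof (rule connected_local_const[where A = "{0..1::real}" and f = \<Phi> and a = s and b = 0])
    show "\<forall>s\<in>{0..1}. \<forall>\<^sub>F s' in at s within {0..1}. \<Phi> s = \<Phi> s'"
    proof
      fix s :: real assume "s \<in> {0..1}"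
      from loc[OF this] have "\<forall>\<^sub>F s' in nhds s. \<Phi> s = \<Phi> s'" by eventually_elim simp
      then show "\<forall>\<^sub>F s' in at s within {0..1}. \<Phi> s = \<Phi> s'" unfolding eventually_at_filter by eventually_elim simp
    qed
  qed (use that in auto)
  have \<Phi>0: "\<Phi> 0 = \<psi> 0"
  proof -
    have "P 0 e = 0" if "e \<in> C" for e using C(5)[OF that] by (simp add: P_def)
    then show ?thesis by (simp add: \<Phi>_def)
  qed
  have \<psi>_eq: "\<psi> s = \<psi> 0 - (\<Sum>e\<in>C. \<sigma> e * P s e)" if "s \<in> {0..1}" for s
    using const[OF that] \<Phi>0 by (simp add: \<Phi>_def)
  have \<psi>1: "\<psi> 1 = \<psi> 0 - (\<Sum>e\<in>C. \<sigma> e)"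
  proof -
    have "P 1 e = 1" if "e \<in> C" for e using C(6)[OF that] by (simp add: P_def)
    then show ?thesis using \<psi>_eq[of 1] by simp
  qed
  define h where "h = (\<lambda>s. F (x + s *\<^sub>R v))"
  define h' where "h' = (\<lambda>s. F' (x + s *\<^sub>R v) v)"
  have h': "continuous_on UNIV h'"
    unfolding h'_def by (rule continuous_on_compose2[OF D]) (auto intro!: continuous_intros)
  have deriv: "(h has_vector_derivative h' s) (at s within S)" for s S
  proof -
    have "((\<lambda>s. x + s *\<^sub>R v) has_derivative (\<lambda>r. r *\<^sub>R v)) (at s)"
      by (auto intro!: derivative_eq_intros)
    then have "(h has_derivative (\<lambda>r. F' (x + s *\<^sub>R v) (r *\<^sub>R v))) (at s)"
      unfolding h_def by (rule has_derivative_compose) (rule F)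
    moreover have "F' (x + s *\<^sub>R v) (r *\<^sub>R v) = r *\<^sub>R h' s" for r
      unfolding h'_def by (rule linear_scale[OF has_derivative_linear[OF F]])
    ultimately have "(h has_vector_derivative h' s) (at s)"
      by (simp add: has_vector_derivative_def)
    then show ?thesis by (rule has_vector_derivative_at_within)
  qed
  have FTC: "(LINT s|lborel. indicator {p..q} s *\<^sub>R h' s) = h q - h p" if "p \<le> q" for p q
    by (rule integral_FTC_atLeastAtMost[OF that deriv]) (auto intro: continuous_on_subset[OF h'])
  have int: "integrable lborel (\<lambda>s. indicator {p..q} s *\<^sub>R h' s)" for p q :: real
    using borel_integrable_compact[of "{p..q}" h'] continuous_on_subset[OF h'] by auto
  have Tm [measurable]: "T \<in> sets borel" using element(2)[OF T] by simp
  have [measurable]: "h' \<in> borel_measurable borel" by (rule borel_measurable_continuous_onI[OF h'])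
  have "(LINT s|lborel. indicator {0..1} s *\<^sub>R (\<psi> s * h' s))
      = (LINT s|lborel. \<psi> 0 * (indicator {0..1} s *\<^sub>R h' s) - (\<Sum>e\<in>C. \<sigma> e * (indicator {t e..1} s *\<^sub>R h' s)))"
  proof (rule integral_cong_AE)
    show "(\<lambda>s. indicator {0..1} s *\<^sub>R (\<psi> s * h' s)) \<in> borel_measurable lborel"
      unfolding \<psi>_def by measurable
    show "(\<lambda>s. \<psi> 0 * (indicator {0..1} s *\<^sub>R h' s) - (\<Sum>e\<in>C. \<sigma> e * (indicator {t e..1} s *\<^sub>R h' s)))
      \<in> borel_measurable lborel" by measurable
    have "AE s in lborel. \<forall>e\<in>C. s \<noteq> t e"
      using finC by (intro AE_finite_allI AE_lborel_singleton)
    then show "AE s in lborel. indicator {0..1} s *\<^sub>R (\<psi> s * h' s)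
      = \<psi> 0 * (indicator {0..1} s *\<^sub>R h' s) - (\<Sum>e\<in>C. \<sigma> e * (indicator {t e..1} s *\<^sub>R h' s))"
    proof eventually_elim
      case (elim s)
      have ind: "indicator {t e..1} s = (if s \<in> {0..1} then P s e else 0)" if "e \<in> C" for e
        using elim that C(5)[OF that] by (auto simp: indicator_def P_def)
      show ?case
      proof (cases "s \<in> {0..1}")
        case True
        have "(\<Sum>e\<in>C. \<sigma> e * (indicator {t e..1} s *\<^sub>R h' s)) = (\<Sum>e\<in>C. \<sigma> e * P s e) * h' s"
          unfolding sum_distrib_right using True by (intro sum.cong) (auto simp: ind)
        then show ?thesis using True by (simp add: \<psi>_eq[OF True] algebra_simps)
      next
        case False
        then have "indicator {t e..1} s = (0::real)" if "e \<in> C" for e using ind[OF that] False by (simp only: if_False)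
        then show ?thesis using False by simp
      qed
    qed
  qed
  also have "\<dots> = \<psi> 0 * (h 1 - h 0) - (\<Sum>e\<in>C. \<sigma> e * (h 1 - h (t e)))"
  proof -
    have "(LINT s|lborel. (\<Sum>e\<in>C. \<sigma> e * (indicator {t e..1} s *\<^sub>R h' s))) = (\<Sum>e\<in>C. \<sigma> e * (h 1 - h (t e)))"
    proof -
      have "(LINT s|lborel. (\<Sum>e\<in>C. \<sigma> e * (indicator {t e..1} s *\<^sub>R h' s)))
         = (\<Sum>e\<in>C. LINT s|lborel. \<sigma> e * (indicator {t e..1} s *\<^sub>R h' s))"
        by (intro Bochner_Integration.integral_sum integrable_mult_right int)
      also have "\<dots> = (\<Sum>e\<in>C. \<sigma> e * (h 1 - h (t e)))"
        using C(6) by (intro sum.cong refl) (simp only: integral_mult_right_zero FTC less_imp_le)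
      finally show ?thesis .
    qed
    moreover have "(LINT s|lborel. \<psi> 0 * (indicator {0..1} s *\<^sub>R h' s)) = \<psi> 0 * (h 1 - h 0)"
      by (simp only: integral_mult_right_zero FTC zero_le_one)
    moreover have "integrable lborel (\<lambda>s. \<psi> 0 * (indicator {0..1} s *\<^sub>R h' s))"
      "integrable lborel (\<lambda>s. \<Sum>e\<in>C. \<sigma> e * (indicator {t e..1} s *\<^sub>R h' s))"
      by (intro Bochner_Integration.integrable_sum integrable_mult_right int)+
    ultimately show ?thesis by (simp only: Bochner_Integration.integral_diff)
  qed
  also have "\<dots> = \<psi> 1 * h 1 - \<psi> 0 * h 0 + (\<Sum>e\<in>C. \<sigma> e * h (t e))"
    unfolding \<psi>1 by (simp add: algebra_simps sum_subtractf sum_distrib_left)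
  also have "(\<Sum>e\<in>C. \<sigma> e * h (t e))
      = (\<Sum>e\<in>faces \<E> T. \<sigma> e * (indicator (slant e (- v)) x * F (x - c e *\<^sub>R v)))"
    unfolding C_def using finite_faces[of T]
    by (intro sum.mono_neutral_cong_left) (auto simp: h_def t_def)
  finally show ?thesis by (simp add: \<psi>_def h_def h'_def \<sigma>_def)
qed

text \<open>Translation invariance allows the integral over \<open>T\<close> to be replaced by its average over the
  translates of \<open>T\<close> by \<open>- s v\<close> with \<open>s\<close> in the unit interval. After swapping the integrals, the inner one is
  given by \<open>line_crossings\<close> on almost every segment. The endpoint terms have equal integrals, and the
  term of a face integrates to its surface integral by \<open>slant_surface_integral\<close>. Faces
  parallel to \<open>v\<close> are met by the segments from a null set only.\<close>
theorem divergence_theorem_directional: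
  fixes F :: "real^'n \<Rightarrow> real" and v :: "real^'n"
  assumes T: "T \<in> \<T>"
    and F: "\<And>y. (F has_derivative F' y) (at y)" and D: "continuous_on UNIV (\<lambda>y. F' y v)"
  shows "(LINT x:T|lebesgue. F' x v)
    = (\<Sum>e\<in>faces \<E> T. (outward_normal T e \<bullet> v) * (LINT x|surface_measure e. F x))"
proof -
  define D' where "D' = (\<lambda>y. F' y v)"
  have D'c: "continuous_on UNIV D'" using D by (simp add: D'_def)
  have Fc: "continuous_on UNIV F"
    by (intro continuous_at_imp_continuous_on ballI has_derivative_continuous[OF F])
  have Tm [measurable]: "T \<in> sets borel" using element(2)[OF T] by simp
  note [measurable] = borel_measurable_continuous_onI[OF D'c] borel_measurable_continuous_onI[OF Fc]
  define n where "n = outward_normal T"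
  define a where "a = (\<lambda>e::(real^'n) set. SOME y. y \<in> e)"
  have a: "a e \<in> e" if "e \<in> faces \<E> T" for e
  proof -
    have "e \<noteq> {}" using face(4)[OF faces_subset(1)[OF T that]] rel_interior_subset[of e] by blast
    then show ?thesis by (simp add: a_def some_in_eq)
  qed
  define c where "c = (\<lambda>e x. (n e \<bullet> (x - a e)) / (n e \<bullet> v))"
  define R where "R = (\<lambda>e x. sgn (n e \<bullet> v) * (indicator (slant e (- v)) x * F (x - c e x *\<^sub>R v)))"
  have intT: "integrable lborel (\<lambda>x. indicator T x * G x)" if "continuous_on UNIV G" for G :: "real^'n \<Rightarrow> real"
    using borel_integrable_compact[OF element(1)[OF T], of G] continuous_on_subset[OF that] by auto
  have R: "integrable lborel (R e) \<and> (LINT x|lborel. R e x) = (n e \<bullet> v) * (LINT x|surface_measure e. F x)"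
    if e: "e \<in> faces \<E> T" for e
  proof (cases "n e \<bullet> v = 0")
    case True
    then show ?thesis by (simp add: R_def)
  next
    case False
    have eE: "e \<in> \<E>" by (rule faces_subset(1)[OF T e])
    have nt: "normal_to e (n e)" unfolding n_def by (rule normal_to_outward_normal[OF T e])
    have v: "n e \<bullet> (- v) \<noteq> 0" using False by simp
    have eq: "indicator (slant e (- v)) x *\<^sub>R F (x - ((n e \<bullet> (x - a e)) / (n e \<bullet> (- v))) *\<^sub>R (- v))
       = indicator (slant e (- v)) x * F (x - c e x *\<^sub>R v)" for x
      by (simp add: c_def)
    note S = slant_surface_integral[OF face(5)[OF eE] face(1)[OF eE] Fc nt v hull_inc[OF a[OF e]], unfolded eq]
    have "integrable lborel (R e)" unfolding R_def by (intro integrable_mult_right S(1))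
    moreover have "(LINT x|lborel. R e x) = sgn (n e \<bullet> v) * (\<bar>n e \<bullet> (- v)\<bar> * (LINT x|surface_measure e. F x))"
      unfolding R_def by (simp only: integral_mult_right_zero S(2))
    moreover have "sgn (n e \<bullet> v) * \<bar>n e \<bullet> (- v)\<bar> = n e \<bullet> v"
      by (simp add: sgn_mult_abs)
    ultimately show ?thesis by (simp only: mult.assoc[symmetric])
  qed
  define f where "f = (\<lambda>x s. indicator {0..1::real} s *\<^sub>R (indicator T (x + s *\<^sub>R v) * D' (x + s *\<^sub>R v)))"
  have "integrable lborel (case_prod f)"
  proof -
    let ?K = "(\<lambda>(y, s). (y - s *\<^sub>R v, s)) ` (T \<times> {0..1::real})"
    have "compact ?K"
      by (intro compact_continuous_image compact_Times element(1)[OF T] compact_Icc)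
         (auto simp: split_beta intro!: continuous_intros)
    moreover have "continuous_on UNIV (\<lambda>z::(real^'n) \<times> real. D' (fst z + snd z *\<^sub>R v))"
      by (rule continuous_on_compose2[OF D'c]) (auto intro!: continuous_intros)
    ultimately have "integrable lborel (\<lambda>z. indicator ?K z *\<^sub>R D' (fst z + snd z *\<^sub>R v))"
      by (intro borel_integrable_compact) (auto intro: continuous_on_subset)
    moreover have "indicator ?K z *\<^sub>R D' (fst z + snd z *\<^sub>R v) = case_prod f z" for z
    proof -
      have "z \<in> ?K \<longleftrightarrow> snd z \<in> {0..1} \<and> fst z + snd z *\<^sub>R v \<in> T"
      proof
        assume "snd z \<in> {0..1} \<and> fst z + snd z *\<^sub>R v \<in> T"
        then show "z \<in> ?K"
          by (intro image_eqI[of _ _ "(fst z + snd z *\<^sub>R v, snd z)"]) auto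
      qed auto
      then show ?thesis by (simp add: f_def split_beta indicator_def)
    qed
    ultimately show ?thesis by simp
  qed
  then have fi: "integrable (lborel \<Otimes>\<^sub>M lborel) (case_prod f)" by (simp add: lborel_prod)
  have inner: "(LINT x|lborel. f x s) = indicator {0..1} s *\<^sub>R (LINT x|lborel. indicator T x * D' x)" for s
  proof -
    have "(LINT x|lborel. indicator T (s *\<^sub>R v + x) * D' (s *\<^sub>R v + x)) = (LINT x|lborel. indicator T x * D' x)"
      by (rule integral_lborel_translate) measurable
    then show ?thesis by (simp add: f_def add.commute)
  qed
  have gen: "AE x in lborel. (\<forall>s. x + s *\<^sub>R v \<notin> skeleton) \<and> (\<forall>e\<in>faces \<E> T. x \<notin> affine hull e)
      \<and> x \<notin> frontier T \<and> x + v \<notin> frontier T"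
  proof -
    have AE: "AE x in lborel. x \<notin> N" if "negligible N" for N :: "(real^'n) set"
    proof -
      have "AE x in lebesgue. x \<notin> N" using that by (simp add: negligible_iff_null_sets AE_not_in)
      then show ?thesis by (simp add: AE_completion_iff)
    qed
    have "AE x in lborel. x \<notin> {x. \<exists>s. x + s *\<^sub>R v \<in> skeleton}"
      by (rule AE[OF negligible_skeleton_cylinder])
    moreover have "AE x in lborel. \<forall>e\<in>faces \<E> T. x \<notin> affine hull e"
    proof (intro AE_finite_allI finite_faces AE)
      fix e assume "e \<in> faces \<E> T"
      then have "aff_dim e = int (CARD('n) - 1)" using face(5) faces_subset(1)[OF T] by blast
      then show "negligible (affine hull e)" using dim2
        by (intro negligible_aff_dim) (simp add: aff_dim_affine_hull)
    qed
    moreover have "AE x in lborel. x \<notin> frontier T"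
      by (rule AE[OF negligible_frontier_element[OF T]])
    moreover have "AE x in lborel. x \<notin> (+) (- v) ` frontier T"
      by (intro AE negligible_translation negligible_frontier_element[OF T])
    ultimately show ?thesis
    proof eventually_elim
      case (elim x)
      moreover have "x = - v + (x + v)" by simp
      ultimately show ?case by blast
    qed
  qed
  have vT [measurable]: "(\<lambda>x. indicator T (v + x) * F (v + x)) \<in> borel_measurable borel" by measurable
  have iF: "integrable lborel (\<lambda>x. indicator T x * F x)" by (rule intT[OF Fc])
  have ivF: "integrable lborel (\<lambda>x. indicator T (v + x) * F (v + x))"
    using iF by (subst integral_lborel_translate(2)[of "\<lambda>x. indicator T x * F x"]) auto
  have vF: "(LINT x|lborel. indicator T (v + x) * F (v + x)) = (LINT x|lborel. indicator T x * F x)"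
    by (rule integral_lborel_translate) measurable
  have iR: "integrable lborel (\<lambda>x. \<Sum>e\<in>faces \<E> T. R e x)"
    using R by (intro Bochner_Integration.integrable_sum) blast
  have "(LINT x:T|lebesgue. F' x v) = (LINT x|lborel. indicator T x * D' x)"
    unfolding set_lebesgue_integral_def D'_def[symmetric]
    by (subst integral_completion) (auto simp: D'_def[symmetric])
  also have "\<dots> = (LINT s|lborel. indicator {0..1::real} s *\<^sub>R (LINT x|lborel. indicator T x * D' x))"
    by simp
  also have "\<dots> = (LINT s|lborel. (LINT x|lborel. f x s))"
    by (simp only: inner)
  also have "\<dots> = (LINT x|lborel. (LINT s|lborel. f x s))"
    by (rule lborel_pair.Fubini_integral[OF fi])
  also have "\<dots> = (LINT x|lborel. (indicator T (v + x) * F (v + x) - indicator T x * F x) + (\<Sum>e\<in>faces \<E> T. R e x))"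
  proof (rule integral_cong_AE)
    show "(\<lambda>x. LINT s|lborel. f x s) \<in> borel_measurable lborel"
      using lborel_pair.integrable_fst'[OF fi] by (simp add: borel_measurable_integrable)
    show "(\<lambda>x. (indicator T (v + x) * F (v + x) - indicator T x * F x) + (\<Sum>e\<in>faces \<E> T. R e x)) \<in> borel_measurable lborel"
      using borel_measurable_integrable[OF iR] by measurable
    show "AE x in lborel. (LINT s|lborel. f x s)
      = (indicator T (v + x) * F (v + x) - indicator T x * F x) + (\<Sum>e\<in>faces \<E> T. R e x)"
      using gen
    proof eventually_elim
      case (elim x)
      have "(LINT s|lborel. f x s) = indicator T (x + v) * F (x + v) - indicator T x * F x + (\<Sum>e\<in>faces \<E> T. R e x)"
        unfolding f_def D'_def R_def c_def n_def
        by (rule line_crossings[OF T F D a]) (use elim in blast)+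
      then show ?case by (simp add: add.commute)
    qed
  qed
  also have "\<dots> = (\<Sum>e\<in>faces \<E> T. LINT x|lborel. R e x)"
    using R by (simp add: iF ivF vF iR Bochner_Integration.integral_sum)
  also have "\<dots> = (\<Sum>e\<in>faces \<E> T. (outward_normal T e \<bullet> v) * (LINT x|surface_measure e. F x))"
    using R by (simp add: n_def)
  finally show ?thesis .
qed

end

section \<open>Polynomials and Riesz representation\<close>

definition monomial :: "('n \<Rightarrow> nat) \<Rightarrow> real^'n \<Rightarrow> real" where
  "monomial \<alpha> x = (\<Prod>i\<in>UNIV. (x $ i) ^ \<alpha> i)"

definition exponents :: "nat \<Rightarrow> ('n::finite \<Rightarrow> nat) set" where
  "exponents r = {\<alpha>. (\<Sum>i\<in>UNIV. \<alpha> i) \<le> r}"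

lemma poly_fun_iff: "poly_fun r p \<longleftrightarrow> (\<exists>c. p = (\<lambda>x. \<Sum>\<alpha>\<in>exponents r. c \<alpha> * monomial \<alpha> x))"
  by (simp add: poly_fun_def monomial_def exponents_def)

lemma finite_exponents: "finite (exponents r :: ('n::finite \<Rightarrow> nat) set)"
proof (rule finite_subset)
  show "exponents r \<subseteq> (UNIV :: 'n set) \<rightarrow>\<^sub>E {..r}"
  proof
    fix \<alpha> :: "'n \<Rightarrow> nat" assume "\<alpha> \<in> exponents r"
    then have "\<alpha> i \<le> r" for i
      using member_le_sum[of i UNIV \<alpha>] by (simp add: exponents_def)
    then show "\<alpha> \<in> UNIV \<rightarrow>\<^sub>E {..r}" by auto
  qed
  show "finite ((UNIV :: 'n set) \<rightarrow>\<^sub>E {..r})" by (intro finite_PiE) auto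
qed

lemma poly_fun_add: "poly_fun r p \<Longrightarrow> poly_fun r q \<Longrightarrow> poly_fun r (\<lambda>x. p x + q x)"
  unfolding poly_fun_iff
proof (elim exE)
  fix c d assume "p = (\<lambda>x. \<Sum>\<alpha>\<in>exponents r. c \<alpha> * monomial \<alpha> x)" "q = (\<lambda>x. \<Sum>\<alpha>\<in>exponents r. d \<alpha> * monomial \<alpha> x)"
  then show "\<exists>c. (\<lambda>x. p x + q x) = (\<lambda>x. \<Sum>\<alpha>\<in>exponents r. c \<alpha> * monomial \<alpha> x)"
    by (intro exI[of _ "\<lambda>\<alpha>. c \<alpha> + d \<alpha>"]) (simp add: sum.distrib algebra_simps)
qed

lemma poly_fun_scale: "poly_fun r p \<Longrightarrow> poly_fun r (\<lambda>x. a * p x)"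
  unfolding poly_fun_iff
proof (elim exE)
  fix c assume "p = (\<lambda>x. \<Sum>\<alpha>\<in>exponents r. c \<alpha> * monomial \<alpha> x)"
  then show "\<exists>c. (\<lambda>x. a * p x) = (\<lambda>x. \<Sum>\<alpha>\<in>exponents r. c \<alpha> * monomial \<alpha> x)"
    by (intro exI[of _ "\<lambda>\<alpha>. a * c \<alpha>"]) (simp add: sum_distrib_left mult.assoc)
qed

lemma poly_fun_0: "poly_fun r (\<lambda>x. 0)"
  unfolding poly_fun_iff by (intro exI[of _ "\<lambda>_. 0"]) simp

lemma poly_fun_sum: "(\<And>i. i \<in> I \<Longrightarrow> poly_fun r (f i)) \<Longrightarrow> poly_fun r (\<lambda>x. \<Sum>i\<in>I. f i x)"
  by (induction I rule: infinite_finite_induct) (auto intro: poly_fun_0 poly_fun_add)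

lemma poly_fun_monomial:
  assumes "\<alpha> \<in> exponents r" shows "poly_fun r (monomial \<alpha>)"
  unfolding poly_fun_iff
  by (intro exI[of _ "\<lambda>\<beta>. if \<beta> = \<alpha> then 1 else 0"])
     (use assms in \<open>auto simp: finite_exponents if_distrib[of "\<lambda>c. c * _"] cong: if_cong\<close>)

lemma poly_fun_const: "poly_fun r (\<lambda>x. a)"
proof -
  have "poly_fun r (\<lambda>x. a * monomial (\<lambda>_. 0) x)"
    by (intro poly_fun_scale poly_fun_monomial) (simp add: exponents_def)
  then show ?thesis by (simp add: monomial_def)
qed

lemma poly_fun_mono:
  assumes "r \<le> s" "poly_fun r p" shows "poly_fun s p"
proof -
  obtain c where p: "p = (\<lambda>x. \<Sum>\<alpha>\<in>exponents r. c \<alpha> * monomial \<alpha> x)"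
    using assms(2) by (auto simp: poly_fun_iff)
  have "exponents r \<subseteq> exponents s" using assms(1) by (auto simp: exponents_def)
  then show ?thesis unfolding p by (intro poly_fun_sum poly_fun_scale poly_fun_monomial) blast
qed

definition partial :: "(real^'n \<Rightarrow> real) \<Rightarrow> 'n \<Rightarrow> real^'n \<Rightarrow> real" where
  "partial p j x = frechet_derivative p (at x) (axis j 1)"

lemma monomial_has_derivative:
  "(monomial \<alpha> has_derivative
     (\<lambda>h. \<Sum>j\<in>UNIV. h $ j * (real (\<alpha> j) * monomial (\<alpha>(j := \<alpha> j - 1)) x))) (at x)"
proof -
  have D: "(monomial \<alpha> has_derivative
      (\<lambda>h. \<Sum>j\<in>UNIV. (real (\<alpha> j) * (h $ j * (x $ j) ^ (\<alpha> j - 1))) * (\<Prod>i\<in>UNIV - {j}. (x $ i) ^ \<alpha> i))) (at x)"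
    unfolding monomial_def[abs_def] by (intro has_derivative_prod)
       (auto intro!: derivative_eq_intros bounded_linear_imp_has_derivative[OF bounded_linear_vec_nth])
  have eq: "(real (\<alpha> j) * (h $ j * (x $ j) ^ (\<alpha> j - 1))) * (\<Prod>i\<in>UNIV - {j}. (x $ i) ^ \<alpha> i)
      = h $ j * (real (\<alpha> j) * monomial (\<alpha>(j := \<alpha> j - 1)) x)" for h j
  proof -
    have "monomial (\<alpha>(j := \<alpha> j - 1)) x
      = (x $ j) ^ (\<alpha> j - 1) * (\<Prod>i\<in>UNIV - {j}. (x $ i) ^ (\<alpha>(j := \<alpha> j - 1)) i)"
      unfolding monomial_def by (subst prod.remove[of _ j]) auto
    also have "(\<Prod>i\<in>UNIV - {j}. (x $ i) ^ (\<alpha>(j := \<alpha> j - 1)) i) = (\<Prod>i\<in>UNIV - {j}. (x $ i) ^ \<alpha> i)"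
      by (rule prod.cong) auto
    finally show ?thesis by (simp only: mult_ac)
  qed
  show ?thesis using D unfolding eq .
qed

lemma poly_fun_derivative:
  assumes p: "poly_fun r p"
  shows "(p has_derivative (\<lambda>h. \<Sum>j\<in>UNIV. h $ j * partial p j x)) (at x)"
    and "poly_fun (r - 1) (partial p j)"
proof -
  obtain c where c: "p = (\<lambda>x. \<Sum>\<alpha>\<in>exponents r. c \<alpha> * monomial \<alpha> x)"
    using p by (auto simp: poly_fun_iff)
  define d where "d = (\<lambda>j x. \<Sum>\<alpha>\<in>exponents r. c \<alpha> * (real (\<alpha> j) * monomial (\<alpha>(j := \<alpha> j - 1)) x))"
  have D: "(p has_derivative (\<lambda>h. \<Sum>j\<in>UNIV. h $ j * d j x)) (at x)" for x
  proof -
    have "(p has_derivative (\<lambda>h. \<Sum>\<alpha>\<in>exponents r. c \<alpha> *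
        (\<Sum>j\<in>UNIV. h $ j * (real (\<alpha> j) * monomial (\<alpha>(j := \<alpha> j - 1)) x)))) (at x)"
      unfolding c by (intro has_derivative_sum has_derivative_mult_right monomial_has_derivative)
    moreover have "(\<Sum>\<alpha>\<in>exponents r. c \<alpha> * (\<Sum>j\<in>UNIV. h $ j * (real (\<alpha> j) * monomial (\<alpha>(j := \<alpha> j - 1)) x)))
        = (\<Sum>j\<in>UNIV. h $ j * d j x)" for h
      unfolding d_def sum_distrib_left by (subst sum.swap) (simp add: mult_ac)
    ultimately show ?thesis by simp
  qed
  have dp: "partial p j = d j" for j
  proof
    fix x
    have "partial p j x = (\<Sum>i\<in>UNIV. axis j 1 $ i * d i x)"
      unfolding partial_def using frechet_derivative_at[OF D[of x]] by metis
    then show "partial p j x = d j x"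
      by (simp add: axis_def if_distrib[of "\<lambda>c. c * _"] cong: if_cong)
  qed
  show "(p has_derivative (\<lambda>h. \<Sum>j\<in>UNIV. h $ j * partial p j x)) (at x)"
    using D by (simp add: dp)
  show "poly_fun (r - 1) (partial p j)"
    unfolding dp d_def
  proof (rule poly_fun_sum)
    fix \<alpha> :: "'a \<Rightarrow> nat" assume \<alpha>: "\<alpha> \<in> exponents r"
    show "poly_fun (r - 1) (\<lambda>x. c \<alpha> * (real (\<alpha> j) * monomial (\<alpha>(j := \<alpha> j - 1)) x))"
    proof (cases "\<alpha> j = 0")
      case True
      then show ?thesis by (simp add: poly_fun_0)
    next
      case False
      have "(\<Sum>i\<in>UNIV. \<alpha> i) = \<alpha> j + (\<Sum>i\<in>UNIV - {j}. \<alpha> i)" by (simp add: sum.remove[of _ j])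
      moreover have "(\<Sum>i\<in>UNIV. (\<alpha>(j := \<alpha> j - 1)) i) = (\<alpha> j - 1) + (\<Sum>i\<in>UNIV - {j}. \<alpha> i)"
        by (simp add: sum.remove[of _ j])
      ultimately have "\<alpha>(j := \<alpha> j - 1) \<in> exponents (r - 1)"
        using \<alpha> False unfolding exponents_def by (simp del: fun_upd_apply)
      then show ?thesis by (intro poly_fun_scale poly_fun_monomial)
    qed
  qed
qed

lemma poly_fun_continuous: "poly_fun r p \<Longrightarrow> continuous_on UNIV p"
  by (intro continuous_at_imp_continuous_on ballI has_derivative_continuous[OF poly_fun_derivative(1)])

lemma partial_add:
  assumes "poly_fun r p" "poly_fun s q"
  shows "partial (\<lambda>x. p x + q x) j x = partial p j x + partial q j x"
proof -
  note D = has_derivative_add[OF poly_fun_derivative(1)[OF assms(1)] poly_fun_derivative(1)[OF assms(2)], of x]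
  show ?thesis unfolding partial_def[of "\<lambda>x. p x + q x"] frechet_derivative_at[OF D, symmetric]
    by (simp add: axis_def if_distrib[of "\<lambda>c. c * _"] cong: if_cong)
qed

lemma partial_scale:
  assumes "poly_fun r p"
  shows "partial (\<lambda>x. a * p x) j x = a * partial p j x"
proof -
  note D = has_derivative_mult_right[OF poly_fun_derivative(1)[OF assms(1)], of a x]
  show ?thesis unfolding partial_def[of "\<lambda>x. a * p x"] frechet_derivative_at[OF D, symmetric]
    by (simp add: axis_def if_distrib[of "\<lambda>c. c * _"] cong: if_cong)
qed

lemma partial_cong_open:
  assumes "open S" "x \<in> S" "\<And>y. y \<in> S \<Longrightarrow> f y = g y"
  shows "partial f j x = partial g j x"
proof -
  have "(f has_derivative D) (at x) \<longleftrightarrow> (g has_derivative D) (at x)" for D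
    using has_derivative_transform_within_open[of f D x UNIV S g]
      has_derivative_transform_within_open[of g D x UNIV S f] assms by metis
  then show ?thesis by (simp add: partial_def frechet_derivative_def)
qed

text \<open>Scalar, vector and matrix valued polynomials at once, so that weak gradient, weak divergence and
  projection share one representation argument.\<close>
definition poly_map :: "nat \<Rightarrow> (real^'n \<Rightarrow> 'b::euclidean_space) \<Rightarrow> bool" where
  "poly_map r f \<longleftrightarrow> (\<forall>b\<in>Basis. poly_fun r (\<lambda>x. f x \<bullet> b))"

lemma poly_map_real: "poly_map r (f :: real^'n \<Rightarrow> real) \<longleftrightarrow> poly_fun r f"
  by (simp add: poly_map_def)

lemma poly_map_vector: "poly_map r (f :: real^'n \<Rightarrow> real^'m) \<longleftrightarrow> (\<forall>i. poly_fun r (\<lambda>x. f x $ i))"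
  by (auto simp: poly_map_def Basis_vec_def inner_axis)

lemma poly_map_matrix:
  "poly_map r (f :: real^'n \<Rightarrow> real^'m^'k) \<longleftrightarrow> (\<forall>i j. poly_fun r (\<lambda>x. f x $ i $ j))"
  by (auto simp: poly_map_def Basis_vec_def inner_axis)

lemma poly_map_0: "poly_map r (\<lambda>x. 0)"
  by (simp add: poly_map_def poly_fun_0)

lemma poly_map_add: "poly_map r f \<Longrightarrow> poly_map r g \<Longrightarrow> poly_map r (\<lambda>x. f x + g x)"
  by (simp add: poly_map_def poly_fun_add inner_add_left)

lemma poly_map_scale: "poly_map r f \<Longrightarrow> poly_map r (\<lambda>x. a *\<^sub>R f x)"
  by (simp add: poly_map_def poly_fun_scale)

lemma poly_map_diff: "poly_map r f \<Longrightarrow> poly_map r g \<Longrightarrow> poly_map r (\<lambda>x. f x - g x)"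
  using poly_map_add[of r f "\<lambda>x. (- 1) *\<^sub>R g x"] poly_map_scale[of r g "- 1"] by simp

lemma poly_map_mono: "r \<le> s \<Longrightarrow> poly_map r f \<Longrightarrow> poly_map s f"
  unfolding poly_map_def using poly_fun_mono by blast

lemma poly_map_const: "poly_map r (\<lambda>x. a)"
  by (simp add: poly_map_def poly_fun_const)

lemma poly_map_continuous:
  assumes "poly_map r f" shows "continuous_on S f"
proof -
  have "continuous_on UNIV (\<lambda>x. \<Sum>b\<in>Basis. (f x \<bullet> b) *\<^sub>R b)"
    using assms by (intro continuous_intros poly_fun_continuous) (auto simp: poly_map_def)
  then show ?thesis by (auto simp: euclidean_representation intro: continuous_on_subset)
qed

lemma vpoly_on_iff: "vpoly_on r S f \<longleftrightarrow> (\<exists>p. poly_map r p \<and> (\<forall>x\<in>S. f x = p x))"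
proof
  assume "vpoly_on r S f"
  then obtain P where P: "\<And>i. poly_fun r (P i) \<and> (\<forall>x\<in>S. f x $ i = P i x)"
    unfolding vpoly_on_def poly_on_def by metis
  then show "\<exists>p. poly_map r p \<and> (\<forall>x\<in>S. f x = p x)"
    by (intro exI[of _ "\<lambda>x. \<chi> i. P i x"]) (simp add: poly_map_vector vec_eq_iff)
next
  assume "\<exists>p. poly_map r p \<and> (\<forall>x\<in>S. f x = p x)"
  then obtain p where "poly_map r p" "\<forall>x\<in>S. f x = p x" by blast
  then show "vpoly_on r S f" unfolding vpoly_on_def poly_on_def poly_map_vector by metis
qed

lemma mpoly_on_iff: "mpoly_on r S f \<longleftrightarrow> (\<exists>p. poly_map r p \<and> (\<forall>x\<in>S. f x = p x))"
proof
  assume "mpoly_on r S f"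
  then obtain P where P: "\<And>i j. poly_fun r (P i j) \<and> (\<forall>x\<in>S. f x $ i $ j = P i j x)"
    unfolding mpoly_on_def poly_on_def by metis
  then show "\<exists>p. poly_map r p \<and> (\<forall>x\<in>S. f x = p x)"
    by (intro exI[of _ "\<lambda>x. \<chi> i j. P i j x"]) (simp add: poly_map_matrix vec_eq_iff)
next
  assume "\<exists>p. poly_map r p \<and> (\<forall>x\<in>S. f x = p x)"
  then obtain p where "poly_map r p" "\<forall>x\<in>S. f x = p x" by blast
  then show "mpoly_on r S f" unfolding mpoly_on_def poly_on_def poly_map_matrix by metis
qed

lemma poly_on_iff: "poly_on r S f \<longleftrightarrow> (\<exists>p. poly_map r p \<and> (\<forall>x\<in>S. f x = p x))"
  by (simp add: poly_on_def poly_map_real)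

text \<open>The linear span under pointwise operations, generated inductively so that identities between
  linear functionals pass from the generators to the span by induction.\<close>
inductive_set fspan :: "('a \<Rightarrow> 'b::real_vector) set \<Rightarrow> ('a \<Rightarrow> 'b) set" for A where
  base: "f \<in> A \<Longrightarrow> f \<in> fspan A"
| zero: "(\<lambda>x. 0) \<in> fspan A"
| add: "f \<in> fspan A \<Longrightarrow> g \<in> fspan A \<Longrightarrow> (\<lambda>x. f x + g x) \<in> fspan A"
| scale: "f \<in> fspan A \<Longrightarrow> (\<lambda>x. a *\<^sub>R f x) \<in> fspan A"

lemma fspan_mono: "A \<subseteq> B \<Longrightarrow> fspan A \<subseteq> fspan B"
proof
  fix f assume AB: "A \<subseteq> B" and "f \<in> fspan A"
  from this(2) show "f \<in> fspan B" using AB by (induction rule: fspan.induct) (auto intro: fspan.intros)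
qed

lemma fspan_sum:
  assumes "finite I" "\<And>i. i \<in> I \<Longrightarrow> f i \<in> fspan A"
  shows "(\<lambda>x. \<Sum>i\<in>I. f i x) \<in> fspan A"
  using assms by (induction I) (auto intro: fspan.intros)

definition linear_functional_on :: "('a \<Rightarrow> 'b::real_vector) set \<Rightarrow> (('a \<Rightarrow> 'b) \<Rightarrow> real) \<Rightarrow> bool" where
  "linear_functional_on V l \<longleftrightarrow>
     (\<forall>f\<in>V. \<forall>g\<in>V. l (\<lambda>x. f x + g x) = l f + l g) \<and> (\<forall>f\<in>V. \<forall>a. l (\<lambda>x. a *\<^sub>R f x) = a * l f)"

text \<open>Representation of a functional by a positive semidefinite form, provided that it vanishes on the
  null vectors of the form. Adding one generator \<open>\<phi>\<close> at a time, Gram-Schmidt splits off the part \<open>\<psi>\<close> of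
  \<open>\<phi>\<close> orthogonal to the previous span; if \<open>\<psi>\<close> is null, nothing has to be added to the representing
  element. The form is only semidefinite because it sees the values on an element or a face, not on the
  whole space; on a face, nonzero polynomials do vanish.\<close>
lemma riesz_fspan:
  fixes B :: "('a \<Rightarrow> 'b::real_vector) \<Rightarrow> ('a \<Rightarrow> 'b) \<Rightarrow> real" and V :: "('a \<Rightarrow> 'b) set"
  assumes fin: "finite A" and AV: "fspan A \<subseteq> V"
    and Vadd: "\<And>f g. f \<in> V \<Longrightarrow> g \<in> V \<Longrightarrow> (\<lambda>x. f x + g x) \<in> V"
    and Vscale: "\<And>f a. f \<in> V \<Longrightarrow> (\<lambda>x. a *\<^sub>R f x) \<in> V"
    and B: "\<And>f. f \<in> V \<Longrightarrow> linear_functional_on V (B f)"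
    and sym: "\<And>f g. f \<in> V \<Longrightarrow> g \<in> V \<Longrightarrow> B f g = B g f" and pos: "\<And>f. f \<in> V \<Longrightarrow> 0 \<le> B f f"
    and l: "linear_functional_on V l" and ker: "\<And>f. f \<in> V \<Longrightarrow> B f f = 0 \<Longrightarrow> l f = 0"
  shows "\<exists>g\<in>fspan A. \<forall>f\<in>fspan A. B g f = l f"
  using fin AV l ker
proof (induction A arbitrary: l rule: finite_induct)
  case empty
  have 0: "f = (\<lambda>x. 0)" if "f \<in> fspan {}" for f :: "'a \<Rightarrow> 'b"
    using that by (induction rule: fspan.induct) auto
  have z: "(\<lambda>x. 0) \<in> V" using empty.prems(1) fspan.zero by blast
  have zero: "m (\<lambda>x. 0) = 0" if "linear_functional_on V m" for m :: "('a \<Rightarrow> 'b) \<Rightarrow> real"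
  proof -
    have "m (\<lambda>x. 0 *\<^sub>R (0 :: 'b)) = 0 * m (\<lambda>x. 0)"
      using that z unfolding linear_functional_on_def by fast
    then show ?thesis by simp
  qed
  show ?case
    using 0 zero[OF B[OF z]] zero[OF empty.prems(2)] fspan.zero by metis
next
  case (insert \<phi> A)
  have sub: "fspan A \<subseteq> fspan (insert \<phi> A)" by (rule fspan_mono) auto
  then have AV: "fspan A \<subseteq> V" using insert.prems(1) by blast
  have \<phi>V: "\<phi> \<in> V" using insert.prems(1) fspan.base by blast
  have lin: "m (\<lambda>x. f x + g x) = m f + m g" "m (\<lambda>x. a *\<^sub>R f x) = a * m f"
    if "linear_functional_on V m" "f \<in> V" "g \<in> V" for m f g a
    using that by (auto simp: linear_functional_on_def)
  have comb: "m (\<lambda>x. f x + a *\<^sub>R g x) = m f + a * m g"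
    if "linear_functional_on V m" "f \<in> V" "g \<in> V" for m f g a
    using lin(1)[OF that(1,2) Vscale[OF that(3)], of a] lin(2)[OF that(1,3,3)] by simp
  have combV: "(\<lambda>x. f x + a *\<^sub>R g x) \<in> V" if "f \<in> V" "g \<in> V" for f g a
    by (rule Vadd[OF that(1) Vscale[OF that(2)]])
  have comb': "B (\<lambda>x. f x + a *\<^sub>R g x) h = B f h + a * B g h"
    if "f \<in> V" "g \<in> V" "h \<in> V" for f g h a
    using comb[OF B[OF that(3)] that(1,2), of a] sym[OF combV[OF that(1,2), of a] that(3)]
      sym[OF that(1,3)] sym[OF that(2,3)] by simp
  have cs: "B \<phi> f = 0" if f: "f \<in> V" "B f f = 0" for f
  proof (rule ccontr)
    assume nz: "B \<phi> f \<noteq> 0"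
    \<comment> \<open>With this multiple of the null vector \<open>f\<close> added, \<open>\<phi>\<close> would have square \<open>-1\<close>.\<close>
    define t where "t = - (B \<phi> \<phi> + 1) / (2 * B \<phi> f)"
    let ?h = "\<lambda>x. \<phi> x + t *\<^sub>R f x"
    have h: "?h \<in> V" by (rule combV[OF \<phi>V f(1)])
    have "B ?h ?h = B \<phi> \<phi> + 2 * t * B \<phi> f"
      using f sym[OF f(1) \<phi>V]
      by (simp add: comb'[OF \<phi>V f(1) h] comb[OF B[OF \<phi>V] \<phi>V f(1)] comb[OF B[OF f(1)] \<phi>V f(1)])
    also have "\<dots> = -1" using nz by (simp add: t_def field_simps)
    finally show False using pos[OF h] by simp
  qed
  obtain g' where g': "g' \<in> fspan A" "\<And>f. f \<in> fspan A \<Longrightarrow> B g' f = l f"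
    using insert.IH[OF AV insert.prems(2,3)] by blast
  obtain p where p: "p \<in> fspan A" "\<And>f. f \<in> fspan A \<Longrightarrow> B p f = B \<phi> f"
    using insert.IH[OF AV B[OF \<phi>V] cs] by blast
  have V: "g' \<in> V" "p \<in> V" using g' p AV by auto
  define \<psi> where "\<psi> = (\<lambda>x. \<phi> x + (-1) *\<^sub>R p x)"
  have \<psi>V: "\<psi> \<in> V" unfolding \<psi>_def by (rule combV[OF \<phi>V V(2)])
  have \<psi>0: "B \<psi> f = 0" if "f \<in> fspan A" for f
    using comb'[OF \<phi>V V(2), of f "-1"] p(2)[OF that] that AV by (auto simp: \<psi>_def)
  have l\<psi>: "l \<psi> = l \<phi> - l p"
    using comb[OF insert.prems(2) \<phi>V V(2), of "-1"] by (simp add: \<psi>_def)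
  have g'\<phi>: "B g' \<phi> = l p"
    using g'(2)[OF p(1)] p(2)[OF g'(1)] sym[OF V(1) V(2)] sym[OF V(1) \<phi>V] by simp
  have D: "B \<psi> \<psi> = B \<psi> \<phi>"
    using comb[OF B[OF \<psi>V] \<phi>V V(2), of "-1"] \<psi>0[OF p(1)] by (simp add: \<psi>_def)
  have \<psi>s: "\<psi> \<in> fspan (insert \<phi> A)"
    unfolding \<psi>_def using p(1) sub by (intro fspan.add fspan.scale) (auto intro: fspan.base)
  define a where "a = (if B \<psi> \<psi> = 0 then 0 else l \<psi> / B \<psi> \<psi>)"
  define g where "g = (\<lambda>x. g' x + a *\<^sub>R \<psi> x)"
  have gs: "g \<in> fspan (insert \<phi> A)"
    unfolding g_def using g'(1) sub \<psi>s by (intro fspan.add fspan.scale) auto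
  then have gV: "g \<in> V" using insert.prems(1) by blast
  have "B g f = l f" if "f \<in> fspan (insert \<phi> A)" for f
    using that
  proof (induction rule: fspan.induct)
    case (base f)
    have fV: "f \<in> V" using base insert.prems(1) fspan.base by blast
    have gf: "B g f = B g' f + a * B \<psi> f"
      unfolding g_def by (rule comb'[OF V(1) \<psi>V fV])
    show ?case
    proof (cases "f = \<phi>")
      case True
      have "a * B \<psi> \<psi> = l \<psi>" using insert.prems(3)[OF \<psi>V] by (simp add: a_def)
      then show ?thesis using gf g'\<phi> D l\<psi> True by simp
    next
      case False
      then have "f \<in> fspan A" using base fspan.base by blast
      then show ?thesis using gf g'(2) \<psi>0 by simp
    qed
  next
    case zero
    have z: "(\<lambda>x. 0) \<in> V" using insert.prems(1) fspan.zero by blast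
    show ?case
      using lin(2)[OF B[OF gV] z z, of 0] lin(2)[OF insert.prems(2) z z, of 0] by simp
  next
    case (add f h)
    then have "f \<in> V" "h \<in> V" using insert.prems(1) by auto
    then show ?case using add.IH lin(1)[OF B[OF gV]] lin(1)[OF insert.prems(2)] by simp
  next
    case (scale f b)
    then have "f \<in> V" using insert.prems(1) by auto
    then show ?case using scale.IH lin(2)[OF B[OF gV]] lin(2)[OF insert.prems(2)] by simp
  qed
  then show ?case using gs by blast
qed

lemma poly_map_riesz:
  fixes B :: "(real^'n \<Rightarrow> 'b::euclidean_space) \<Rightarrow> (real^'n \<Rightarrow> 'b) \<Rightarrow> real" and r :: nat
  defines "V \<equiv> Collect (poly_map r)"
  assumes B: "\<And>f. poly_map r f \<Longrightarrow> linear_functional_on V (B f)"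
    and sym: "\<And>f g. B f g = B g f" and pos: "\<And>f. 0 \<le> B f f"
    and l: "linear_functional_on V l" and ker: "\<And>f. poly_map r f \<Longrightarrow> B f f = 0 \<Longrightarrow> l f = 0"
  shows "\<exists>g. poly_map r g \<and> (\<forall>f. poly_map r f \<longrightarrow> B g f = l f)"
proof -
  define A :: "(real^'n \<Rightarrow> 'b) set" where
    "A = (\<lambda>(\<alpha>, b) x. monomial \<alpha> x *\<^sub>R b) ` (exponents r \<times> Basis)"
  have fin: "finite A" unfolding A_def by (intro finite_imageI finite_cartesian_product finite_exponents) simp
  have sub: "poly_map r f" if "f \<in> fspan A" for f
    using that
  proof (induction rule: fspan.induct)
    case (base f)
    then obtain \<alpha> b where "\<alpha> \<in> exponents r" "f = (\<lambda>x. monomial \<alpha> x *\<^sub>R b)" by (auto simp: A_def)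
    then show ?case using poly_fun_scale[OF poly_fun_monomial[of \<alpha> r]]
      by (simp add: poly_map_def mult.commute)
  qed (auto intro: poly_map_0 poly_map_add poly_map_scale)
  have sup: "f \<in> fspan A" if f: "poly_map r f" for f
  proof -
    have "\<forall>b\<in>Basis. \<exists>c. (\<lambda>x. f x \<bullet> b) = (\<lambda>x. \<Sum>\<alpha>\<in>exponents r. c \<alpha> * monomial \<alpha> x)"
      using f by (simp add: poly_map_def poly_fun_iff)
    then obtain c where c: "\<And>b. b \<in> Basis \<Longrightarrow> (\<lambda>x. f x \<bullet> b) = (\<lambda>x. \<Sum>\<alpha>\<in>exponents r. c b \<alpha> * monomial \<alpha> x)"
      by metis
    have "(\<lambda>x. \<Sum>b\<in>Basis. \<Sum>\<alpha>\<in>exponents r. c b \<alpha> *\<^sub>R (monomial \<alpha> x *\<^sub>R b)) \<in> fspan A"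
      by (intro fspan_sum fspan.scale fspan.base finite_exponents) (auto simp: A_def image_iff)
    moreover have "(\<Sum>b\<in>Basis. \<Sum>\<alpha>\<in>exponents r. c b \<alpha> *\<^sub>R (monomial \<alpha> x *\<^sub>R b)) = f x" for x
    proof -
      have "(\<Sum>b\<in>Basis. \<Sum>\<alpha>\<in>exponents r. c b \<alpha> *\<^sub>R (monomial \<alpha> x *\<^sub>R b)) = (\<Sum>b\<in>Basis. (f x \<bullet> b) *\<^sub>R b)"
        using fun_cong[OF c, of _ x] by (intro sum.cong) (auto simp: scaleR_sum_left)
      then show ?thesis by (simp add: euclidean_representation)
    qed
    ultimately show ?thesis by simp
  qed
  have "\<exists>g\<in>fspan A. \<forall>f\<in>fspan A. B g f = l f"
    using B sym pos l ker
    by (intro riesz_fspan[of A V]) (auto simp: V_def fin sub poly_map_add poly_map_scale)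
  then show ?thesis using sub sup by blast
qed

section \<open>Inner products on elements and faces\<close>

text \<open>Nonempty open sets have positive measure.\<close>
lemma AE_zero_open:
  fixes f :: "'a::euclidean_space \<Rightarrow> 'b::real_normed_vector"
  assumes U: "open U" and f: "continuous_on U f" and ae: "AE x in lebesgue. x \<in> U \<longrightarrow> f x = 0" and x: "x \<in> U"
  shows "f x = 0"
proof -
  let ?W = "U \<inter> f -` (- {0})"
  have W: "open ?W" by (rule continuous_open_preimage[OF f U]) auto
  have "AE x in lebesgue. x \<notin> ?W" using ae by eventually_elim auto
  then have "?W \<in> null_sets lebesgue"
    using W by (subst completion.null_sets_iff_AE) auto
  then have "negligible ?W" by (simp add: negligible_iff_null_sets)
  then have "?W = {}" using open_not_negligible[OF W] by blast
  then show ?thesis using x by auto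
qed

lemma ip_commute: "ip T f g = ip T g f"
  by (simp add: ip_def inner_commute)

lemma ip_zero [simp]: "ip T (\<lambda>x. 0) g = 0" "ip T g (\<lambda>x. 0) = 0"
  by (simp_all add: ip_def)

lemma ip_scale: "ip T (\<lambda>x. a *\<^sub>R f x) g = a * ip T f g" "ip T f (\<lambda>x. a *\<^sub>R g x) = a * ip T f g"
  by (simp_all add: ip_def)

lemma ip_nonneg: "0 \<le> ip T f f"
  unfolding ip_def set_lebesgue_integral_def by (intro integral_nonneg_AE) (auto simp: indicator_def)

lemma ip_cong_AE:
  assumes "AE x in lebesgue. x \<in> T \<longrightarrow> f x \<bullet> g x = f' x \<bullet> g' x"
  shows "ip T f g = ip T f' g'"
  unfolding ip_def set_lebesgue_integral_def
proof (rule completion.integral_cong_AE_complete(1))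
  show "AE x in lebesgue. indicat_real T x *\<^sub>R (f x \<bullet> g x) = indicat_real T x *\<^sub>R (f' x \<bullet> g' x)"
    using assms by eventually_elim (auto simp: indicator_def)
qed

lemma ip_cong: "(\<And>x. x \<in> T \<Longrightarrow> f x \<bullet> g x = f' x \<bullet> g' x) \<Longrightarrow> ip T f g = ip T f' g'"
  by (rule ip_cong_AE) auto

lemma ip_face_commute: "ip_face e f g = ip_face e g f"
  by (simp add: ip_face_def inner_commute)

lemma ip_face_zero [simp]: "ip_face e (\<lambda>x. 0) g = 0" "ip_face e g (\<lambda>x. 0) = 0"
  by (simp_all add: ip_face_def)

lemma ip_face_scale: "ip_face e (\<lambda>x. a *\<^sub>R f x) g = a * ip_face e f g" "ip_face e f (\<lambda>x. a *\<^sub>R g x) = a * ip_face e f g"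
  by (simp_all add: ip_face_def)

lemma ip_face_nonneg: "0 \<le> ip_face e f f"
  unfolding ip_face_def by (intro integral_nonneg_AE) auto

context polyhedral_mesh
begin

lemma set_integrable_element:
  fixes f :: "real^'n \<Rightarrow> real"
  assumes T: "T \<in> \<T>" and f: "continuous_on T f"
  shows "set_integrable lebesgue T f"
proof -
  have i: "integrable lborel (\<lambda>x. indicator T x *\<^sub>R f x)"
    using borel_integrable_compact[OF element(1)[OF T] f] by simp
  show ?thesis unfolding set_integrable_def
    using i borel_measurable_integrable[OF i] by (simp add: integrable_completion)
qed

lemma ip_add:
  assumes "T \<in> \<T>" "continuous_on T f" "continuous_on T g" "continuous_on T h"
  shows "ip T (\<lambda>x. f x + g x) h = ip T f h + ip T g h" "ip T h (\<lambda>x. f x + g x) = ip T h f + ip T h g"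
proof -
  have "set_integrable lebesgue T (\<lambda>x. f x \<bullet> h x)" "set_integrable lebesgue T (\<lambda>x. g x \<bullet> h x)"
    using assms by (auto intro!: set_integrable_element continuous_intros)
  then show "ip T (\<lambda>x. f x + g x) h = ip T f h + ip T g h"
    by (simp add: ip_def inner_add_left set_integral_add)
  then show "ip T h (\<lambda>x. f x + g x) = ip T h f + ip T h g"
    by (simp add: ip_commute[of T h])
qed

lemma ip_diff:
  assumes "T \<in> \<T>" "continuous_on T f" "continuous_on T g" "continuous_on T h"
  shows "ip T (\<lambda>x. f x - g x) h = ip T f h - ip T g h" "ip T h (\<lambda>x. f x - g x) = ip T h f - ip T h g"
proof -
  have "continuous_on T (\<lambda>x. (- 1) *\<^sub>R g x)" by (intro continuous_intros assms)
  note A = ip_add[OF assms(1,2) this assms(4)]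
  show "ip T (\<lambda>x. f x - g x) h = ip T f h - ip T g h" using A(1) by (simp only: ip_scale) simp
  show "ip T h (\<lambda>x. f x - g x) = ip T h f - ip T h g" using A(2) by (simp only: ip_scale) simp
qed

lemma ip_cong_interior:
  assumes T: "T \<in> \<T>" and "\<And>x. x \<in> interior T \<Longrightarrow> f x \<bullet> g x = f' x \<bullet> g' x"
  shows "ip T f g = ip T f' g'"
proof (rule ip_cong_AE)
  have "AE x in lebesgue. x \<notin> frontier T"
    using negligible_frontier_element[OF T] by (simp add: negligible_iff_null_sets AE_not_in)
  then show "AE x in lebesgue. x \<in> T \<longrightarrow> f x \<bullet> g x = f' x \<bullet> g' x"
    by eventually_elim (use assms(2) closure_subset[of T] in \<open>auto simp: frontier_def\<close>)
qed

lemma constant_on_element: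
  fixes f :: "real^'n \<Rightarrow> 'b::t1_space"
  assumes T: "T \<in> \<T>" and f: "continuous_on T f" and z: "\<And>x. x \<in> interior T \<Longrightarrow> f x = c" and x: "x \<in> T"
  shows "f x = c"
  using continuous_constant_on_closure[of "interior T" f c x] element(3)[OF T] f z x by simp

lemma ip_definite:
  assumes T: "T \<in> \<T>" and f: "continuous_on T f" and z: "ip T f f = 0" and x: "x \<in> T"
  shows "f x = 0"
proof (rule constant_on_element[OF T f _ x])
  fix y assume y: "y \<in> interior T"
  have "set_integrable lebesgue T (\<lambda>x. f x \<bullet> f x)"
    by (intro set_integrable_element[OF T] continuous_intros f)
  then have "AE x in lebesgue. indicat_real T x *\<^sub>R (f x \<bullet> f x) = 0"
    using z unfolding ip_def set_lebesgue_integral_def set_integrable_def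
    by (subst (asm) integral_nonneg_eq_0_iff_AE) (auto simp: indicator_def)
  then have "AE x in lebesgue. x \<in> interior T \<longrightarrow> f x = 0"
    by eventually_elim (use interior_subset[of T] in \<open>auto simp: indicator_def\<close>)
  then show "f y = 0"
    using AE_zero_open[OF open_interior continuous_on_subset[OF f interior_subset] _ y] by blast
qed

lemma face_integrable:
  fixes f :: "real^'n \<Rightarrow> real"
  assumes e: "e \<in> \<E>" and f: "continuous_on e f"
  shows "integrable (surface_measure e) f"
proof -
  obtain F where F: "continuous_on UNIV F" "\<And>x. x \<in> e \<Longrightarrow> F x = f x"
    using Tietze_unbounded[of e f UNIV] f face(2)[OF e] by auto
  show ?thesis
    using surface_integral(1)[OF face(5)[OF e] face(1)[OF e] F(1)]
      surface_integral_cong(2)[OF face(5)[OF e] face(1)[OF e], of F f] F(2) by blast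
qed

lemma ip_face_cong:
  assumes e: "e \<in> \<E>" and "\<And>x. x \<in> e \<Longrightarrow> f x \<bullet> g x = f' x \<bullet> g' x"
  shows "ip_face e f g = ip_face e f' g'"
  unfolding ip_face_def by (rule surface_integral_cong(1)[OF face(5)[OF e] face(1)[OF e] assms(2)])

lemma ip_face_add:
  assumes "e \<in> \<E>" "continuous_on e f" "continuous_on e g" "continuous_on e h"
  shows "ip_face e (\<lambda>x. f x + g x) h = ip_face e f h + ip_face e g h"
    "ip_face e h (\<lambda>x. f x + g x) = ip_face e h f + ip_face e h g"
proof -
  have "integrable (surface_measure e) (\<lambda>x. f x \<bullet> h x)" "integrable (surface_measure e) (\<lambda>x. g x \<bullet> h x)"
    using assms by (auto intro!: face_integrable continuous_intros)
  then show "ip_face e (\<lambda>x. f x + g x) h = ip_face e f h + ip_face e g h"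
    by (simp add: ip_face_def inner_add_left)
  then show "ip_face e h (\<lambda>x. f x + g x) = ip_face e h f + ip_face e h g"
    by (simp add: ip_face_commute[of e h])
qed

lemma ip_face_diff:
  assumes "e \<in> \<E>" "continuous_on e f" "continuous_on e g" "continuous_on e h"
  shows "ip_face e (\<lambda>x. f x - g x) h = ip_face e f h - ip_face e g h"
    "ip_face e h (\<lambda>x. f x - g x) = ip_face e h f - ip_face e h g"
proof -
  have "continuous_on e (\<lambda>x. (- 1) *\<^sub>R g x)" by (intro continuous_intros assms)
  note A = ip_face_add[OF assms(1,2) this assms(4)]
  show "ip_face e (\<lambda>x. f x - g x) h = ip_face e f h - ip_face e g h"
    using A(1) by (simp only: ip_face_scale) simp
  show "ip_face e h (\<lambda>x. f x - g x) = ip_face e h f - ip_face e h g"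
    using A(2) by (simp only: ip_face_scale) simp
qed

text \<open>The squared norm of \<open>f\<close>, extended continuously and composed with the projection to the hyperplane,
  integrates to zero over the right prism. The prism contains an open half ball with centre at each relative
  interior point of the face, so the composition vanishes there.\<close>
lemma ip_face_definite:
  assumes e: "e \<in> \<E>" and f: "continuous_on e f" and z: "ip_face e f f = 0" and x: "x \<in> e"
  shows "f x = 0"
proof -
  define n where "n = unit_normal e"
  have nt: "normal_to e n" unfolding n_def by (rule normal_to_unit_normal[OF face(5)[OF e]])
  then have nn: "n \<bullet> n = 1" "norm n = 1" by (auto simp: normal_to_def dot_square_norm)
  have "continuous_on e (\<lambda>x. f x \<bullet> f x)" by (intro continuous_intros f)
  then obtain H where H: "continuous_on UNIV H" "\<And>x. x \<in> e \<Longrightarrow> H x = f x \<bullet> f x"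
    using Tietze_unbounded[of e "\<lambda>x. f x \<bullet> f x" UNIV] face(2)[OF e] by auto
  let ?cp = "closest_point (affine hull e)"
  note S = surface_integral[OF face(5)[OF e] face(1)[OF e] H(1)]
  have "(LINT x|surface_measure e. H x) = 0"
    using z surface_integral_cong(1)[OF face(5)[OF e] face(1)[OF e], of H "\<lambda>x. f x \<bullet> f x"] H(2)
    by (simp add: ip_face_def)
  then have "(LINT x|lborel. indicator (prism e) x *\<^sub>R H (?cp x)) = 0" using S(3) by simp
  moreover have "AE x in lborel. 0 \<le> indicator (prism e) x *\<^sub>R H (?cp x)"
  proof (rule AE_I2)
    fix x
    show "0 \<le> indicator (prism e) x *\<^sub>R H (?cp x)"
    proof (cases "x \<in> prism e")
      case True
      then have "?cp x \<in> e" by (auto simp: prism_def closest_point_prism[OF face(5)[OF e]])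
      then show ?thesis using H(2) by (simp add: indicator_def)
    qed simp
  qed
  ultimately have ae: "AE x in lborel. indicator (prism e) x *\<^sub>R H (?cp x) = 0"
    using integral_nonneg_eq_0_iff_AE[OF S(2)] by blast
  have "f y = 0" if y: "y \<in> rel_interior e" for y
  proof -
    have ye: "y \<in> e" using y rel_interior_subset by blast
    obtain r where r: "r > 0" "\<And>x. x \<in> ball y r \<Longrightarrow> x - (n \<bullet> (x - y)) *\<^sub>R n \<in> e"
      using rel_interior_projection[OF e nt y] by metis
    \<comment> \<open>The half ball at \<open>y\<close>, cut off at height one to stay inside the prism.\<close>
    define U where "U = ball y r \<inter> ({x. n \<bullet> x > n \<bullet> y} \<inter> {x. n \<bullet> x < n \<bullet> y + 1})"
    have U: "open U" unfolding U_def by (intro open_Int open_ball open_halfspace_lt open_halfspace_gt)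
    have UP: "x \<in> prism e" if "x \<in> U" for x
    proof -
      have "x = (x - (n \<bullet> (x - y)) *\<^sub>R n) + (n \<bullet> (x - y)) *\<^sub>R unit_normal e" by (simp add: n_def)
      moreover have "0 \<le> n \<bullet> (x - y)" "n \<bullet> (x - y) \<le> 1" using that by (auto simp: U_def inner_diff_right)
      ultimately show ?thesis using r(2)[of x] that unfolding prism_def U_def by blast
    qed
    have c: "continuous_on U (\<lambda>x. H (?cp x))"
      by (rule continuous_on_compose2[OF H(1) continuous_on_subset[OF continuous_closest_point_hull[OF face(5)[OF e]]]]) auto
    have "AE x in lborel. x \<in> U \<longrightarrow> H (?cp x) = 0"
      using ae by eventually_elim (use UP in \<open>auto simp: indicator_def split: if_splits\<close>)
    then have ae': "AE x in lebesgue. x \<in> U \<longrightarrow> H (?cp x) = 0" by (rule AE_completion)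
    define s where "s = min r 1 / 2"
    have s: "0 < s" "s < r" "s < 1" using r(1) by (auto simp: s_def)
    have "y + s *\<^sub>R n \<in> U" using s nn by (simp add: U_def inner_add_right dist_norm)
    then have "H (?cp (y + s *\<^sub>R n)) = 0" by (rule AE_zero_open[OF U c ae'])
    moreover have "?cp (y + s *\<^sub>R n) = y" unfolding n_def by (rule closest_point_prism[OF face(5)[OF e] ye])
    ultimately show ?thesis using H(2)[OF ye] by simp
  qed
  then show ?thesis
    using continuous_constant_on_closure[of "rel_interior e" f 0 x] face(3)[OF e] f x by simp
qed

end

section \<open>Weak derivatives and Green's identity\<close>

lemma row_div_partial: "row_div q x = (\<chi> i. \<Sum>j\<in>UNIV. partial (\<lambda>y. q y $ i $ j) j x)"
  by (simp add: row_div_def partial_def)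

lemma grad_partial: "grad \<phi> x = (\<chi> j. partial \<phi> j x)"
  by (simp add: grad_def partial_def)

lemma poly_map_row_div: "poly_map r q \<Longrightarrow> poly_map (r - 1) (row_div q)"
  unfolding poly_map_matrix poly_map_vector row_div_partial vec_lambda_beta
  by (intro allI poly_fun_sum poly_fun_derivative(2)) blast

lemma poly_map_grad: "poly_map r \<phi> \<Longrightarrow> poly_map (r - 1) (grad \<phi>)"
  unfolding poly_map_vector poly_map_real grad_partial vec_lambda_beta
  by (intro allI poly_fun_derivative(2))

lemma row_div_add: "poly_map r p \<Longrightarrow> poly_map r q \<Longrightarrow> row_div (\<lambda>x. p x + q x) = (\<lambda>x. row_div p x + row_div q x)"
  unfolding poly_map_matrix
  by (auto simp: row_div_partial fun_eq_iff vec_eq_iff sum.distrib[symmetric] intro!: sum.cong partial_add)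

lemma row_div_scale: "poly_map r q \<Longrightarrow> row_div (\<lambda>x. a *\<^sub>R q x) = (\<lambda>x. a *\<^sub>R row_div q x)"
  unfolding poly_map_matrix
  by (auto simp: row_div_partial fun_eq_iff vec_eq_iff sum_distrib_left intro!: sum.cong partial_scale)

lemma grad_add: "poly_map r p \<Longrightarrow> poly_map r q \<Longrightarrow> grad (\<lambda>x. p x + q x) = (\<lambda>x. grad p x + grad q x)"
  unfolding poly_map_real by (auto simp: grad_partial fun_eq_iff vec_eq_iff intro!: partial_add)

lemma grad_scale: "poly_map r q \<Longrightarrow> grad (\<lambda>x. a *\<^sub>R q x) = (\<lambda>x. a *\<^sub>R grad q x)"
  unfolding poly_map_real by (auto simp: grad_partial fun_eq_iff vec_eq_iff intro!: partial_scale)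

lemma row_div_cong_open:
  assumes "open S" "x \<in> S" "\<And>y. y \<in> S \<Longrightarrow> p y = q y" shows "row_div p x = row_div q x"
  unfolding row_div_partial vec_eq_iff
  by (auto intro!: sum.cong partial_cong_open[OF assms(1,2)] simp: assms(3))

lemma grad_cong_open:
  assumes "open S" "x \<in> S" "\<And>y. y \<in> S \<Longrightarrow> p y = q y" shows "grad p x = grad q x"
  unfolding grad_partial vec_eq_iff
  by (auto intro!: partial_cong_open[OF assms(1,2)] simp: assms(3))

lemma row_div_zero: "row_div (\<lambda>x. 0 :: real^'n^'n) = (\<lambda>x. 0)"
  using row_div_scale[OF poly_map_0, of 0] by simp

lemma grad_zero: "grad (\<lambda>x::real^'n. 0) = (\<lambda>x. 0)"
  using grad_scale[OF poly_map_0, of 0] by simp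

lemma continuous_on_matrix_vector:
  fixes q :: "'a::topological_space \<Rightarrow> real^'n^'m"
  shows "continuous_on S q \<Longrightarrow> continuous_on S (\<lambda>x. q x *v n)"
  unfolding matrix_vector_mult_def by (intro continuous_on_vec_lambda continuous_intros)

lemma poly_map_matrix_vector:
  fixes q :: "real^'k \<Rightarrow> real^'n^'m"
  shows "poly_map r q \<Longrightarrow> poly_map r (\<lambda>x. q x *v n)"
  unfolding poly_map_matrix poly_map_vector matrix_vector_mult_def
  by (auto simp: mult.commute[of _ "n $ _"] intro!: poly_fun_sum poly_fun_scale)

lemma vpoly_on_continuous: "vpoly_on r S f \<Longrightarrow> continuous_on S f"
  unfolding vpoly_on_iff using poly_map_continuous by (metis continuous_on_cong)

lemma mpoly_on_continuous: "mpoly_on r S f \<Longrightarrow> continuous_on S f"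
  unfolding mpoly_on_iff using poly_map_continuous by (metis continuous_on_cong)

context polyhedral_mesh
begin

lemma riesz_element:
  fixes l :: "(real^'n \<Rightarrow> 'b::euclidean_space) \<Rightarrow> real"
  assumes T: "T \<in> \<T>" and l: "linear_functional_on (Collect (poly_map r)) l"
    and ker: "\<And>f. poly_map r f \<Longrightarrow> (\<And>x. x \<in> T \<Longrightarrow> f x = 0) \<Longrightarrow> l f = 0"
  shows "\<exists>g. poly_map r g \<and> (\<forall>f. poly_map r f \<longrightarrow> ip T g f = l f)"
proof (rule poly_map_riesz[OF _ ip_commute ip_nonneg l])
  show "linear_functional_on (Collect (poly_map r)) (ip T f)" if "poly_map r f" for f :: "real^'n \<Rightarrow> 'b"
    using that unfolding linear_functional_on_def
    by (auto simp: ip_scale intro!: ip_add[OF T] poly_map_continuous)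
  show "l f = 0" if "poly_map r f" "ip T f f = 0" for f
    using ker[OF that(1)] ip_definite[OF T poly_map_continuous[OF that(1)] that(2)] by blast
qed

lemma riesz_face:
  fixes l :: "(real^'n \<Rightarrow> 'b::euclidean_space) \<Rightarrow> real"
  assumes e: "e \<in> \<E>" and l: "linear_functional_on (Collect (poly_map r)) l"
    and ker: "\<And>f. poly_map r f \<Longrightarrow> (\<And>x. x \<in> e \<Longrightarrow> f x = 0) \<Longrightarrow> l f = 0"
  shows "\<exists>g. poly_map r g \<and> (\<forall>f. poly_map r f \<longrightarrow> ip_face e g f = l f)"
proof (rule poly_map_riesz[OF _ ip_face_commute ip_face_nonneg l])
  show "linear_functional_on (Collect (poly_map r)) (ip_face e f)" if "poly_map r f" for f :: "real^'n \<Rightarrow> 'b"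
    using that unfolding linear_functional_on_def
    by (auto simp: ip_face_scale intro!: ip_face_add[OF e] poly_map_continuous)
  show "l f = 0" if "poly_map r f" "ip_face e f f = 0" for f
    using ker[OF that(1)] ip_face_definite[OF e poly_map_continuous[OF that(1)] that(2)] by blast
qed

definition continuous_components :: "'n wfun \<Rightarrow> (real^'n) set \<Rightarrow> bool" where
  "continuous_components v T \<longleftrightarrow> continuous_on T (fst v T) \<and> (\<forall>e\<in>faces \<E> T. continuous_on e (snd v T e))"

text \<open>The right-hand sides of the equations that define the weak derivatives. They are linear in both
  arguments whatever the weak derivatives are, so bilinearity of the forms is derived from them.\<close>
definition grad_rhs :: "'n wfun \<Rightarrow> (real^'n) set \<Rightarrow> (real^'n \<Rightarrow> real^'n^'n) \<Rightarrow> real" where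
  "grad_rhs v T q = - ip T (fst v T) (row_div q)
     + (\<Sum>e\<in>faces \<E> T. ip_face e (snd v T e) (\<lambda>x. q x *v outward_normal T e))"

definition div_rhs :: "'n wfun \<Rightarrow> (real^'n) set \<Rightarrow> (real^'n \<Rightarrow> real) \<Rightarrow> real" where
  "div_rhs v T \<phi> = - ip T (fst v T) (grad \<phi>)
     + (\<Sum>e\<in>faces \<E> T. ip_face e (\<lambda>x. snd v T e x \<bullet> outward_normal T e) \<phi>)"

lemma grad_rhs_cong:
  assumes T: "T \<in> \<T>" and eq: "\<And>x. x \<in> T \<Longrightarrow> p x = q x"
  shows "grad_rhs v T p = grad_rhs v T q"
proof -
  have "ip T (fst v T) (row_div p) = ip T (fst v T) (row_div q)"
    using eq interior_subset[of T]
    by (intro ip_cong_interior[OF T]) (metis row_div_cong_open open_interior subsetD)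
  moreover have "ip_face e (snd v T e) (\<lambda>x. p x *v outward_normal T e) = ip_face e (snd v T e) (\<lambda>x. q x *v outward_normal T e)"
    if "e \<in> faces \<E> T" for e
    using eq faces_subset[OF T that] by (intro ip_face_cong) auto
  ultimately show ?thesis by (simp add: grad_rhs_def)
qed

lemma div_rhs_cong:
  assumes T: "T \<in> \<T>" and eq: "\<And>x. x \<in> T \<Longrightarrow> p x = q x"
  shows "div_rhs v T p = div_rhs v T q"
proof -
  have "ip T (fst v T) (grad p) = ip T (fst v T) (grad q)"
    using eq interior_subset[of T]
    by (intro ip_cong_interior[OF T]) (metis grad_cong_open open_interior subsetD)
  moreover have "ip_face e (\<lambda>x. snd v T e x \<bullet> outward_normal T e) p = ip_face e (\<lambda>x. snd v T e x \<bullet> outward_normal T e) q"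
    if "e \<in> faces \<E> T" for e
    using eq faces_subset[OF T that] by (intro ip_face_cong) auto
  ultimately show ?thesis by (simp add: div_rhs_def)
qed

lemma linear_grad_rhs:
  assumes T: "T \<in> \<T>" and v: "continuous_components v T"
  shows "linear_functional_on (Collect (poly_map r)) (grad_rhs v T)"
  unfolding linear_functional_on_def
proof (intro conjI ballI allI)
  have c: "continuous_on T (fst v T)" "\<And>e. e \<in> faces \<E> T \<Longrightarrow> continuous_on e (snd v T e)"
    using v by (auto simp: continuous_components_def)
  fix p q :: "real^'n \<Rightarrow> real^'n^'n" assume "p \<in> Collect (poly_map r)" "q \<in> Collect (poly_map r)"
  then have p: "poly_map r p" and q: "poly_map r q" by auto
  have "ip T (fst v T) (row_div (\<lambda>x. p x + q x)) = ip T (fst v T) (row_div p) + ip T (fst v T) (row_div q)"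
    unfolding row_div_add[OF p q]
    by (rule ip_add(2)[OF T poly_map_continuous[OF poly_map_row_div[OF p]] poly_map_continuous[OF poly_map_row_div[OF q]] c(1)])
  moreover have "ip_face e (snd v T e) (\<lambda>x. (p x + q x) *v outward_normal T e)
      = ip_face e (snd v T e) (\<lambda>x. p x *v outward_normal T e) + ip_face e (snd v T e) (\<lambda>x. q x *v outward_normal T e)"
    if "e \<in> faces \<E> T" for e
    unfolding matrix_vector_mult_add_rdistrib
    by (intro ip_face_add(2)[OF faces_subset(1)[OF T that] _ _ c(2)[OF that]]
        continuous_on_matrix_vector poly_map_continuous[OF p] poly_map_continuous[OF q])
  ultimately show "grad_rhs v T (\<lambda>x. p x + q x) = grad_rhs v T p + grad_rhs v T q"
    by (simp add: grad_rhs_def sum.distrib)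
next
  fix p :: "real^'n \<Rightarrow> real^'n^'n" and a assume "p \<in> Collect (poly_map r)"
  then have p: "poly_map r p" by simp
  show "grad_rhs v T (\<lambda>x. a *\<^sub>R p x) = a * grad_rhs v T p"
    unfolding grad_rhs_def row_div_scale[OF p] ip_scale scaleR_matrix_vector_assoc[symmetric] ip_face_scale
    by (simp add: sum_distrib_left algebra_simps)
qed

lemma linear_div_rhs:
  assumes T: "T \<in> \<T>" and v: "continuous_components v T"
  shows "linear_functional_on (Collect (poly_map r)) (div_rhs v T)"
  unfolding linear_functional_on_def
proof (intro conjI ballI allI)
  have c: "continuous_on T (fst v T)" "\<And>e. e \<in> faces \<E> T \<Longrightarrow> continuous_on e (\<lambda>x. snd v T e x \<bullet> outward_normal T e)"
    using v by (auto simp: continuous_components_def intro!: continuous_intros)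
  fix p q :: "real^'n \<Rightarrow> real" assume "p \<in> Collect (poly_map r)" "q \<in> Collect (poly_map r)"
  then have p: "poly_map r p" and q: "poly_map r q" by auto
  have "ip T (fst v T) (grad (\<lambda>x. p x + q x)) = ip T (fst v T) (grad p) + ip T (fst v T) (grad q)"
    unfolding grad_add[OF p q]
    by (rule ip_add(2)[OF T poly_map_continuous[OF poly_map_grad[OF p]] poly_map_continuous[OF poly_map_grad[OF q]] c(1)])
  moreover have "ip_face e (\<lambda>x. snd v T e x \<bullet> outward_normal T e) (\<lambda>x. p x + q x)
      = ip_face e (\<lambda>x. snd v T e x \<bullet> outward_normal T e) p + ip_face e (\<lambda>x. snd v T e x \<bullet> outward_normal T e) q"
    if "e \<in> faces \<E> T" for e
    by (intro ip_face_add(2)[OF faces_subset(1)[OF T that] _ _ c(2)[OF that]]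
        poly_map_continuous[OF p] poly_map_continuous[OF q])
  ultimately show "div_rhs v T (\<lambda>x. p x + q x) = div_rhs v T p + div_rhs v T q"
    by (simp add: div_rhs_def sum.distrib)
next
  fix p :: "real^'n \<Rightarrow> real" and a assume "p \<in> Collect (poly_map r)"
  then have p: "poly_map r p" by simp
  show "div_rhs v T (\<lambda>x. a *\<^sub>R p x) = a * div_rhs v T p"
    unfolding div_rhs_def grad_scale[OF p] ip_scale ip_face_scale
    by (simp add: sum_distrib_left algebra_simps)
qed

text \<open>The right-hand side depends only on the values of the test function on \<open>T\<close>, its derivatives being
  determined almost everywhere by these. It therefore vanishes on the null vectors of the inner product and
  is represented by a polynomial; the choice in the definition of the weak gradient is then a proper one.\<close>
lemma weak_grad:
  assumes T: "T \<in> \<T>" and v: "continuous_components v T"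
  shows "mpoly_on (k - 1) T (weak_grad k \<E> v T)"
    and "mpoly_on (k - 1) T q \<Longrightarrow> ip T (weak_grad k \<E> v T) q = grad_rhs v T q"
proof -
  have "grad_rhs v T f = 0" if "\<And>x. x \<in> T \<Longrightarrow> f x = 0" for f
    using grad_rhs_cong[where v = v, OF T that] by (simp add: grad_rhs_def row_div_zero)
  then obtain G where G: "poly_map (k - 1) G" "\<And>f. poly_map (k - 1) f \<Longrightarrow> ip T G f = grad_rhs v T f"
    using riesz_element[OF T linear_grad_rhs[OF T v, of "k - 1"]] by blast
  have "ip T G q = grad_rhs v T q" if q: "mpoly_on (k - 1) T q" for q
  proof -
    obtain p where p: "poly_map (k - 1) p" "\<And>x. x \<in> T \<Longrightarrow> q x = p x" using q unfolding mpoly_on_iff by blast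
    have "ip T G q = ip T G p" using p(2) by (intro ip_cong) simp
    then show ?thesis using G(2)[OF p(1)] grad_rhs_cong[where v = v, OF T p(2)] by simp
  qed
  moreover have "mpoly_on (k - 1) T G" using G(1) by (auto simp: mpoly_on_iff)
  ultimately have "\<exists>G. mpoly_on (k - 1) T G \<and> (\<forall>q. mpoly_on (k - 1) T q \<longrightarrow> ip T G q = grad_rhs v T q)"
    by blast
  from someI_ex[OF this[unfolded grad_rhs_def]]
  show "mpoly_on (k - 1) T (weak_grad k \<E> v T)"
    "mpoly_on (k - 1) T q \<Longrightarrow> ip T (weak_grad k \<E> v T) q = grad_rhs v T q"
    unfolding weak_grad_def grad_rhs_def by blast+
qed

lemma weak_div:
  assumes T: "T \<in> \<T>" and v: "continuous_components v T"
  shows "poly_on (k - 1) T (weak_div k \<E> v T)"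
    and "poly_on (k - 1) T q \<Longrightarrow> ip T (weak_div k \<E> v T) q = div_rhs v T q"
proof -
  have "div_rhs v T f = 0" if "\<And>x. x \<in> T \<Longrightarrow> f x = 0" for f
    using div_rhs_cong[where v = v, OF T that] by (simp add: div_rhs_def grad_zero)
  then obtain G where G: "poly_map (k - 1) G" "\<And>f. poly_map (k - 1) f \<Longrightarrow> ip T G f = div_rhs v T f"
    using riesz_element[OF T linear_div_rhs[OF T v, of "k - 1"]] by blast
  have "ip T G q = div_rhs v T q" if q: "poly_on (k - 1) T q" for q
  proof -
    obtain p where p: "poly_map (k - 1) p" "\<And>x. x \<in> T \<Longrightarrow> q x = p x" using q unfolding poly_on_iff by blast
    have "ip T G q = ip T G p" using p(2) by (intro ip_cong) simp
    then show ?thesis using G(2)[OF p(1)] div_rhs_cong[where v = v, OF T p(2)] by simp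
  qed
  moreover have "poly_on (k - 1) T G" using G(1) by (auto simp: poly_on_iff)
  ultimately have "\<exists>G. poly_on (k - 1) T G \<and> (\<forall>q. poly_on (k - 1) T q \<longrightarrow> ip T G q = div_rhs v T q)"
    by blast
  from someI_ex[OF this[unfolded div_rhs_def]]
  show "poly_on (k - 1) T (weak_div k \<E> v T)"
    "poly_on (k - 1) T q \<Longrightarrow> ip T (weak_div k \<E> v T) q = div_rhs v T q"
    unfolding weak_div_def div_rhs_def by blast+
qed

lemma Qb:
  assumes e: "e \<in> \<E>" and w: "continuous_on e w"
  shows "vpoly_on (k - 1) e (Qb k e w)"
    and "vpoly_on (k - 1) e \<phi> \<Longrightarrow> ip_face e (Qb k e w) \<phi> = ip_face e w \<phi>"
proof -
  have l: "linear_functional_on (Collect (poly_map (k - 1))) (ip_face e w)"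
    unfolding linear_functional_on_def
    by (auto simp: ip_face_scale intro!: ip_face_add[OF e] poly_map_continuous w)
  have "ip_face e w f = 0" if "\<And>x. x \<in> e \<Longrightarrow> f x = 0" for f
    using ip_face_cong[OF e, of w f w "\<lambda>x. 0"] that by simp
  then obtain G where G: "poly_map (k - 1) G" "\<And>f. poly_map (k - 1) f \<Longrightarrow> ip_face e G f = ip_face e w f"
    using riesz_face[OF e l] by blast
  have "ip_face e G q = ip_face e w q" if q: "vpoly_on (k - 1) e q" for q
  proof -
    obtain p where p: "poly_map (k - 1) p" "\<And>x. x \<in> e \<Longrightarrow> q x = p x" using q unfolding vpoly_on_iff by blast
    have "ip_face e G q = ip_face e G p" "ip_face e w q = ip_face e w p"
      using p(2) by (auto intro!: ip_face_cong[OF e])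
    then show ?thesis using G(2)[OF p(1)] by simp
  qed
  moreover have "vpoly_on (k - 1) e G" using G(1) by (auto simp: vpoly_on_iff)
  ultimately have "\<exists>G. vpoly_on (k - 1) e G \<and> (\<forall>q. vpoly_on (k - 1) e q \<longrightarrow> ip_face e G q = ip_face e w q)"
    by blast
  from someI_ex[OF this]
  show "vpoly_on (k - 1) e (Qb k e w)"
    "vpoly_on (k - 1) e \<phi> \<Longrightarrow> ip_face e (Qb k e w) \<phi> = ip_face e w \<phi>"
    unfolding Qb_def by blast+
qed

text \<open>The divergence theorem in the direction of the \<open>j\<close>-th axis is applied to the \<open>j\<close>-th component of \<open>V\<close>
  multiplied by the matrix \<open>Q\<close>, and the results are added.\<close>
lemma green_identity:
  assumes T: "T \<in> \<T>" and V: "poly_map r V" and Q: "poly_map s Q"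
  shows "ip T V (row_div Q) + ip T (\<lambda>x. \<chi> i. grad (\<lambda>y. V y $ i) x) Q
    = (\<Sum>e\<in>faces \<E> T. ip_face e V (\<lambda>x. Q x *v outward_normal T e))"
proof -
  define F where "F = (\<lambda>j x. \<Sum>i\<in>UNIV. V x $ i * Q x $ i $ j)"
  define F' where "F' = (\<lambda>j x h. \<Sum>i\<in>UNIV. V x $ i * (\<Sum>l\<in>UNIV. h $ l * partial (\<lambda>y. Q y $ i $ j) l x)
      + (\<Sum>l\<in>UNIV. h $ l * partial (\<lambda>y. V y $ i) l x) * Q x $ i $ j)"
  define dF where "dF = (\<lambda>j x. \<Sum>i\<in>UNIV. V x $ i * partial (\<lambda>y. Q y $ i $ j) j x + partial (\<lambda>y. V y $ i) j x * Q x $ i $ j)"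
  have pV: "poly_fun r (\<lambda>y. V y $ i)" for i using V by (simp add: poly_map_vector)
  have pQ: "poly_fun s (\<lambda>y. Q y $ i $ j)" for i j using Q by (simp add: poly_map_matrix)
  have F: "(F j has_derivative F' j x) (at x)" for j x
    unfolding F_def F'_def
    by (intro has_derivative_sum has_derivative_mult poly_fun_derivative(1)[OF pV] poly_fun_derivative(1)[OF pQ])
  have F'_axis: "F' j x (axis j 1) = dF j x" for j x
    by (simp add: F'_def dF_def axis_def if_distrib[of "\<lambda>c. c * _"] cong: if_cong)
  have csub: "continuous_on S p" if "poly_fun m p" for S m and p :: "real^'n \<Rightarrow> real"
    using poly_fun_continuous[OF that] by (rule continuous_on_subset) simp
  note cont = csub[OF pV] csub[OF pQ] csub[OF poly_fun_derivative(2)[OF pV]]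
    csub[OF poly_fun_derivative(2)[OF pQ]]
  have cF: "continuous_on S (F j)" for S j
    unfolding F_def by (intro continuous_intros cont)
  have cdF: "continuous_on S (dF j)" for S j
    unfolding dF_def by (intro continuous_intros cont)
  have div: "(LINT x:T|lebesgue. dF j x)
      = (\<Sum>e\<in>faces \<E> T. outward_normal T e $ j * (LINT x|surface_measure e. F j x))" for j
    using divergence_theorem_directional[OF T F, of j "axis j 1"] cdF[of UNIV j]
    by (simp add: F'_axis inner_axis)
  have "ip T V (row_div Q) + ip T (\<lambda>x. \<chi> i. grad (\<lambda>y. V y $ i) x) Q
      = (LINT x:T|lebesgue. (\<Sum>j\<in>UNIV. dF j x))"
  proof -
    have c1: "continuous_on T (row_div Q)" by (rule poly_map_continuous[OF poly_map_row_div[OF Q]])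
    have "poly_map (r - 1) (\<lambda>x. \<chi> i. grad (\<lambda>y. V y $ i) x)"
      using poly_fun_derivative(2)[OF pV] by (simp add: poly_map_matrix grad_partial)
    then have c2: "continuous_on T (\<lambda>x. \<chi> i. grad (\<lambda>y. V y $ i) x)" by (rule poly_map_continuous)
    have eq: "V x \<bullet> row_div Q x + (\<chi> i. grad (\<lambda>y. V y $ i) x) \<bullet> Q x = (\<Sum>j\<in>UNIV. dF j x)" for x
    proof -
      have "V x \<bullet> row_div Q x + (\<chi> i. grad (\<lambda>y. V y $ i) x) \<bullet> Q x
        = (\<Sum>i\<in>UNIV. \<Sum>j\<in>UNIV. V x $ i * partial (\<lambda>y. Q y $ i $ j) j x + partial (\<lambda>y. V y $ i) j x * Q x $ i $ j)"
        by (simp add: inner_vec_def row_div_partial grad_partial sum_distrib_left sum.distrib)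
      then show ?thesis unfolding dF_def by (subst sum.swap) simp
    qed
    have I: "set_integrable lebesgue T (\<lambda>x. V x \<bullet> row_div Q x)"
      "set_integrable lebesgue T (\<lambda>x. (\<chi> i. grad (\<lambda>y. V y $ i) x) \<bullet> Q x)"
      by (intro set_integrable_element[OF T] continuous_on_inner c1 c2 poly_map_continuous[OF V] poly_map_continuous[OF Q])+
    show ?thesis unfolding ip_def set_integral_add(2)[OF I, symmetric] eq ..
  qed
  also have "\<dots> = (\<Sum>j\<in>UNIV. LINT x:T|lebesgue. dF j x)"
    unfolding set_lebesgue_integral_def scaleR_sum_right
    using set_integrable_element[OF T cdF] by (intro Bochner_Integration.integral_sum) (simp add: set_integrable_def)
  also have "\<dots> = (\<Sum>e\<in>faces \<E> T. \<Sum>j\<in>UNIV. outward_normal T e $ j * (LINT x|surface_measure e. F j x))"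
    unfolding div by (rule sum.swap)
  also have "\<dots> = (\<Sum>e\<in>faces \<E> T. ip_face e V (\<lambda>x. Q x *v outward_normal T e))"
  proof (rule sum.cong)
    fix e assume "e \<in> faces \<E> T"
    then have e: "e \<in> \<E>" by (rule faces_subset(1)[OF T])
    have "V x \<bullet> (Q x *v n) = (\<Sum>j\<in>UNIV. n $ j * F j x)" for x n
    proof -
      have "V x \<bullet> (Q x *v n) = (\<Sum>i\<in>UNIV. \<Sum>j\<in>UNIV. V x $ i * (Q x $ i $ j * n $ j))"
        by (simp add: inner_vec_def matrix_vector_mult_def sum_distrib_left)
      then show ?thesis unfolding F_def sum_distrib_left by (subst sum.swap) (simp add: mult_ac)
    qed
    then show "(\<Sum>j\<in>UNIV. outward_normal T e $ j * (LINT x|surface_measure e. F j x)) = ip_face e V (\<lambda>x. Q x *v outward_normal T e)"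
      unfolding ip_face_def using face_integrable[OF e cF]
      by (simp add: Bochner_Integration.integral_sum)
  qed simp
  finally show ?thesis .
qed

end

section \<open>Equivalence of the two schemes\<close>

lemma vpoly_on_diff:
  assumes "vpoly_on r S f" "vpoly_on r S g"
  shows "vpoly_on r S (\<lambda>x. f x - g x)"
proof -
  obtain p q where "poly_map r p" "\<forall>x\<in>S. f x = p x" "poly_map r q" "\<forall>x\<in>S. g x = q x"
    using assms unfolding vpoly_on_iff by blast
  then show ?thesis unfolding vpoly_on_iff by (intro exI[of _ "\<lambda>x. p x - q x"]) (simp add: poly_map_diff)
qed

lemma vpoly_on_poly_map: "poly_map r f \<Longrightarrow> vpoly_on r S f"
  by (auto simp: vpoly_on_iff)

definition wfun_diff :: "'n wfun \<Rightarrow> 'n wfun \<Rightarrow> 'n::finite wfun" where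
  "wfun_diff u w = (\<lambda>T x. fst u T x - fst w T x, \<lambda>T e x. snd u T e x - snd w T e x)"

context polyhedral_mesh
begin

lemma V_hD:
  assumes "v \<in> V_h k \<T> \<E>" "T \<in> \<T>"
  shows "vpoly_on k T (fst v T)" "\<And>e. e \<in> faces \<E> T \<Longrightarrow> vpoly_on (k - 1) e (snd v T e)" "continuous_components v T"
proof -
  show 1: "vpoly_on k T (fst v T)" "\<And>e. e \<in> faces \<E> T \<Longrightarrow> vpoly_on (k - 1) e (snd v T e)"
    using assms by (auto simp: V_h_def split: prod.splits)
  show "continuous_components v T"
    unfolding continuous_components_def using 1 vpoly_on_continuous by blast
qed

lemma V_hI:
  assumes "\<And>T. T \<in> \<T> \<Longrightarrow> vpoly_on k T (fst v T)"
    and "\<And>T e. T \<in> \<T> \<Longrightarrow> e \<in> faces \<E> T \<Longrightarrow> vpoly_on (k - 1) e (snd v T e)"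
  shows "v \<in> V_h k \<T> \<E>"
  using assms by (cases v) (simp add: V_h_def)

lemma V_h_wfun_diff: "u \<in> V_h k \<T> \<E> \<Longrightarrow> w \<in> V_h k \<T> \<E> \<Longrightarrow> wfun_diff u w \<in> V_h k \<T> \<E>"
  unfolding wfun_diff_def by (rule V_hI) (simp_all only: fst_conv snd_conv vpoly_on_diff V_hD)

lemma grad_rhs_wfun_diff:
  assumes T: "T \<in> \<T>" and u: "continuous_components u T" and w: "continuous_components w T" and q: "mpoly_on r T q"
  shows "grad_rhs (wfun_diff u w) T q = grad_rhs u T q - grad_rhs w T q"
proof -
  obtain p where p: "poly_map r p" "\<And>x. x \<in> T \<Longrightarrow> q x = p x" using q unfolding mpoly_on_iff by blast
  have "ip T (\<lambda>x. fst u T x - fst w T x) (row_div p) = ip T (fst u T) (row_div p) - ip T (fst w T) (row_div p)"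
    using u w by (intro ip_diff(1)[OF T _ _ poly_map_continuous[OF poly_map_row_div[OF p(1)]]]) (auto simp: continuous_components_def)
  moreover have "ip_face e (\<lambda>x. snd u T e x - snd w T e x) (\<lambda>x. p x *v outward_normal T e)
    = ip_face e (snd u T e) (\<lambda>x. p x *v outward_normal T e) - ip_face e (snd w T e) (\<lambda>x. p x *v outward_normal T e)"
    if "e \<in> faces \<E> T" for e
    using u w that
    by (intro ip_face_diff(1)[OF faces_subset(1)[OF T that] _ _ poly_map_continuous[OF poly_map_matrix_vector[OF p(1)]]])
       (auto simp: continuous_components_def)
  ultimately have "grad_rhs (wfun_diff u w) T p = grad_rhs u T p - grad_rhs w T p"
    by (simp add: grad_rhs_def wfun_diff_def sum_subtractf)
  then show ?thesis by (simp only: grad_rhs_cong[where p = q, OF T p(2)])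
qed

lemma div_rhs_wfun_diff:
  assumes T: "T \<in> \<T>" and u: "continuous_components u T" and w: "continuous_components w T" and p: "poly_map r p"
  shows "div_rhs (wfun_diff u w) T p = div_rhs u T p - div_rhs w T p"
proof -
  have "ip T (\<lambda>x. fst u T x - fst w T x) (grad p) = ip T (fst u T) (grad p) - ip T (fst w T) (grad p)"
    using u w by (intro ip_diff(1)[OF T _ _ poly_map_continuous[OF poly_map_grad[OF p]]]) (auto simp: continuous_components_def)
  moreover have "ip_face e (\<lambda>x. snd u T e x \<bullet> outward_normal T e - snd w T e x \<bullet> outward_normal T e) p
    = ip_face e (\<lambda>x. snd u T e x \<bullet> outward_normal T e) p - ip_face e (\<lambda>x. snd w T e x \<bullet> outward_normal T e) p"
    if "e \<in> faces \<E> T" for e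
    using u w that
    by (intro ip_face_diff(1)[OF faces_subset(1)[OF T that] _ _ poly_map_continuous[OF p]])
       (auto simp: continuous_components_def intro!: continuous_intros)
  ultimately show ?thesis
    by (simp add: div_rhs_def wfun_diff_def inner_diff_left sum_subtractf)
qed

text \<open>Against polynomials on the face the projection can be dropped, so the residual is linear in \<open>v\<close>
  although \<open>Qb\<close> is given by a choice.\<close>
lemma residual:
  assumes T: "T \<in> \<T>" and e: "e \<in> faces \<E> T" and v: "v \<in> V_h k \<T> \<E>"
  shows "vpoly_on (k - 1) e (\<lambda>x. Qb k e (fst v T) x - snd v T e x)"
    and "vpoly_on (k - 1) e \<phi> \<Longrightarrow>
      ip_face e (\<lambda>x. Qb k e (fst v T) x - snd v T e x) \<phi> = ip_face e (fst v T) \<phi> - ip_face e (snd v T e) \<phi>"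
proof -
  have eE: "e \<in> \<E>" by (rule faces_subset(1)[OF T e])
  have c: "continuous_on e (fst v T)"
    using continuous_on_subset[OF vpoly_on_continuous[OF V_hD(1)[OF v T]] faces_subset(3)[OF T e]] .
  note Q = Qb[OF eE c]
  show "vpoly_on (k - 1) e (\<lambda>x. Qb k e (fst v T) x - snd v T e x)"
    by (rule vpoly_on_diff[OF Q(1) V_hD(2)[OF v T e]])
  assume \<phi>: "vpoly_on (k - 1) e \<phi>"
  have "ip_face e (\<lambda>x. Qb k e (fst v T) x - snd v T e x) \<phi> = ip_face e (Qb k e (fst v T)) \<phi> - ip_face e (snd v T e) \<phi>"
    by (rule ip_face_diff(1)[OF eE vpoly_on_continuous[OF Q(1)] vpoly_on_continuous[OF V_hD(2)[OF v T e]]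
        vpoly_on_continuous[OF \<phi>]])
  then show "ip_face e (\<lambda>x. Qb k e (fst v T) x - snd v T e x) \<phi> = ip_face e (fst v T) \<phi> - ip_face e (snd v T e) \<phi>"
    by (simp only: Q(2)[OF \<phi>])
qed

text \<open>The first argument enters only through expressions that are visibly linear in it.\<close>
lemma a_form_eq:
  assumes u: "u \<in> V_h k \<T> \<E>" and v: "v \<in> V_h k \<T> \<E>"
  shows "a_form k \<T> \<E> u v = (\<Sum>T\<in>\<T>. grad_rhs u T (weak_grad k \<E> v T)) +
    (\<Sum>T\<in>\<T>. inverse (diameter T) * (\<Sum>e\<in>faces \<E> T.
       ip_face e (fst u T) (\<lambda>x. Qb k e (fst v T) x - snd v T e x) - ip_face e (snd u T e) (\<lambda>x. Qb k e (fst v T) x - snd v T e x)))"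
proof -
  have "ip T (weak_grad k \<E> u T) (weak_grad k \<E> v T) = grad_rhs u T (weak_grad k \<E> v T)" if T: "T \<in> \<T>" for T
    by (rule weak_grad(2)[OF T V_hD(3)[OF u T] weak_grad(1)[OF T V_hD(3)[OF v T]]])
  moreover have "ip_face e (\<lambda>x. Qb k e (fst u T) x - snd u T e x) (\<lambda>x. Qb k e (fst v T) x - snd v T e x)
      = ip_face e (fst u T) (\<lambda>x. Qb k e (fst v T) x - snd v T e x) - ip_face e (snd u T e) (\<lambda>x. Qb k e (fst v T) x - snd v T e x)"
    if T: "T \<in> \<T>" and e: "e \<in> faces \<E> T" for T e
    by (rule residual(2)[OF T e u residual(1)[OF T e v]])
  ultimately show ?thesis by (simp add: a_form_def s_form_def)
qed

lemma a_form_wfun_diff: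
  assumes u: "u \<in> V_h k \<T> \<E>" and w: "w \<in> V_h k \<T> \<E>" and v: "v \<in> V_h k \<T> \<E>"
  shows "a_form k \<T> \<E> (wfun_diff u w) v = a_form k \<T> \<E> u v - a_form k \<T> \<E> w v"
proof -
  let ?\<phi> = "\<lambda>T e x. Qb k e (fst v T) x - snd v T e x"
  have g: "grad_rhs (wfun_diff u w) T (weak_grad k \<E> v T) = grad_rhs u T (weak_grad k \<E> v T) - grad_rhs w T (weak_grad k \<E> v T)"
    if T: "T \<in> \<T>" for T
    by (rule grad_rhs_wfun_diff[OF T V_hD(3)[OF u T] V_hD(3)[OF w T] weak_grad(1)[OF T V_hD(3)[OF v T]]])
  have s: "ip_face e (fst (wfun_diff u w) T) (?\<phi> T e) - ip_face e (snd (wfun_diff u w) T e) (?\<phi> T e)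
      = (ip_face e (fst u T) (?\<phi> T e) - ip_face e (snd u T e) (?\<phi> T e)) - (ip_face e (fst w T) (?\<phi> T e) - ip_face e (snd w T e) (?\<phi> T e))"
    if T: "T \<in> \<T>" and e: "e \<in> faces \<E> T" for T e
  proof -
    have eE: "e \<in> \<E>" by (rule faces_subset(1)[OF T e])
    have c: "continuous_on e (?\<phi> T e)" by (rule vpoly_on_continuous[OF residual(1)[OF T e v]])
    have cu: "continuous_on e (fst u T)" "continuous_on e (snd u T e)"
      "continuous_on e (fst w T)" "continuous_on e (snd w T e)"
      using V_hD(3)[OF u T] V_hD(3)[OF w T] e faces_subset(3)[OF T e]
      by (auto simp: continuous_components_def intro: continuous_on_subset)
    show ?thesis
      unfolding wfun_diff_def fst_conv snd_conv ip_face_diff(1)[OF eE cu(1,3) c] ip_face_diff(1)[OF eE cu(2,4) c]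
      by simp
  qed
  show ?thesis
    unfolding a_form_eq[OF V_h_wfun_diff[OF u w] v] a_form_eq[OF u v] a_form_eq[OF w v]
    by (simp add: g s sum_subtractf right_diff_distrib cong: sum.cong)
qed

lemma a_form_zero:
  assumes u: "u \<in> V_h k \<T> \<E>" and v: "v \<in> V_h k \<T> \<E>"
    and 0: "\<And>T x. T \<in> \<T> \<Longrightarrow> x \<in> T \<Longrightarrow> fst u T x = 0"
      "\<And>T e x. T \<in> \<T> \<Longrightarrow> e \<in> faces \<E> T \<Longrightarrow> x \<in> e \<Longrightarrow> snd u T e x = 0"
  shows "a_form k \<T> \<E> u v = 0"
proof -
  have ipT: "ip T (fst u T) q = 0" if T: "T \<in> \<T>" for T q
    using ip_cong[of T "fst u T" q "\<lambda>x. 0" q] 0(1)[OF T] by simp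
  have ipe: "ip_face e (snd u T e) q = 0" "ip_face e (fst u T) q = 0" if T: "T \<in> \<T>" and e: "e \<in> faces \<E> T" for T e q
    using ip_face_cong[OF faces_subset(1)[OF T e], of "snd u T e" q "\<lambda>x. 0" q]
      ip_face_cong[OF faces_subset(1)[OF T e], of "fst u T" q "\<lambda>x. 0" q] 0(2)[OF T e] 0(1)[OF T]
      faces_subset(3)[OF T e] by (auto simp: subset_iff)
  show ?thesis
    unfolding a_form_eq[OF u v] by (simp add: grad_rhs_def ipT ipe)
qed

lemma W_h_representative:
  assumes "q \<in> W_h k \<Omega> \<T>"
  obtains r where "\<And>T. T \<in> \<T> \<Longrightarrow> poly_map (k - 1) (r T)"
    "\<And>T. T \<in> \<T> \<Longrightarrow> AE x in lebesgue. x \<in> T \<longrightarrow> q x = r T x"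
proof -
  have "\<forall>T\<in>\<T>. \<exists>r. poly_fun (k - 1) r \<and> (AE x in lebesgue_on T. q x = r x)"
    using assms by (simp add: W_h_def)
  then obtain r where r: "\<And>T. T \<in> \<T> \<Longrightarrow> poly_fun (k - 1) (r T) \<and> (AE x in lebesgue_on T. q x = r T x)"
    by metis
  show ?thesis
  proof (rule that[of r])
    fix T assume T: "T \<in> \<T>"
    show "poly_map (k - 1) (r T)" using r[OF T] by (simp add: poly_map_real)
    have "T \<in> sets lebesgue" using element(2)[OF T] by (simp add: borel_closed)
    then show "AE x in lebesgue. x \<in> T \<longrightarrow> q x = r T x"
      using r[OF T] by (simp add: AE_restrict_space_iff)
  qed
qed

lemma b_form_eq:
  assumes v: "v \<in> V_h k \<T> \<E>" and r: "\<And>T. T \<in> \<T> \<Longrightarrow> poly_map (k - 1) (r T)"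
    and q: "\<And>T. T \<in> \<T> \<Longrightarrow> AE x in lebesgue. x \<in> T \<longrightarrow> q x = r T x"
  shows "b_form k \<T> \<E> v q = (\<Sum>T\<in>\<T>. div_rhs v T (r T))"
  unfolding b_form_def
proof (rule sum.cong)
  fix T assume T: "T \<in> \<T>"
  have "ip T (weak_div k \<E> v T) q = ip T (weak_div k \<E> v T) (r T)"
  proof (rule ip_cong_AE)
    show "AE x in lebesgue. x \<in> T \<longrightarrow> weak_div k \<E> v T x \<bullet> q x = weak_div k \<E> v T x \<bullet> r T x"
      using q[OF T] by eventually_elim auto
  qed
  also have "\<dots> = div_rhs v T (r T)"
    using r[OF T] by (intro weak_div(2)[OF T V_hD(3)[OF v T]]) (auto simp: poly_on_iff)
  finally show "ip T (weak_div k \<E> v T) q = div_rhs v T (r T)" .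
qed simp

lemma zero_grad_constant:
  fixes p :: "real^'n \<Rightarrow> real"
  assumes T: "T \<in> \<T>" and p: "poly_map r p" and 0: "\<And>x. x \<in> T \<Longrightarrow> grad p x = 0"
  obtains c where "\<And>x. x \<in> T \<Longrightarrow> p x = c"
proof -
  have pf: "poly_fun r p" using p by (simp add: poly_map_real)
  have "(p has_derivative (\<lambda>h. 0)) (at x)" if x: "x \<in> interior T" for x
  proof -
    have "grad p x = 0" using 0 x interior_subset by blast
    then have "partial p j x = 0" for j by (simp add: grad_partial vec_eq_iff)
    then show ?thesis using poly_fun_derivative(1)[OF pf, of x] by simp
  qed
  then have "p x = p y" if "x \<in> interior T" "y \<in> interior T" for x y
    using has_derivative_zero_unique_connected[OF open_interior element(4)[OF T]] that by blast
  then obtain c where "\<And>x. x \<in> interior T \<Longrightarrow> p x = c"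
    using element(5)[OF T] by blast
  then show ?thesis using that constant_on_element[OF T poly_map_continuous[OF p]] by blast
qed

text \<open>Let \<open>Q\<close> be the classical gradient of the interior part. Since the boundary part is the projection of
  the interior part, it may be replaced by the latter in the definition of the weak gradient tested with \<open>Q\<close>;
  Green's identity then turns the vanishing of the weak gradient into the vanishing of the norm of \<open>Q\<close>.
  This choice of \<open>Q\<close> has degree \<open>k - 1\<close>, as the test matrices must have. Once the interior
  part is a constant \<open>c\<close>, its projection is \<open>c\<close> as well.\<close>
lemma element_rigidity:
  assumes k: "k \<ge> 1" and T: "T \<in> \<T>" and v: "v \<in> V_h k \<T> \<E>"
    and g: "ip T (weak_grad k \<E> v T) (weak_grad k \<E> v T) = 0"
    and s: "\<And>e. e \<in> faces \<E> T \<Longrightarrow>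
      ip_face e (\<lambda>x. Qb k e (fst v T) x - snd v T e x) (\<lambda>x. Qb k e (fst v T) x - snd v T e x) = 0"
  obtains c where "\<And>x. x \<in> T \<Longrightarrow> fst v T x = c" "\<And>e x. e \<in> faces \<E> T \<Longrightarrow> x \<in> e \<Longrightarrow> snd v T e x = c"
proof -
  note vT = V_hD[OF v T]
  note G = weak_grad[OF T vT(3), of k]
  have G0: "weak_grad k \<E> v T x = 0" if "x \<in> T" for x
    by (rule ip_definite[OF T mpoly_on_continuous[OF G(1)] g that])
  obtain V where V: "poly_map k V" "\<And>x. x \<in> T \<Longrightarrow> fst v T x = V x" using vT(1) unfolding vpoly_on_iff by blast
  have pV: "poly_fun k (\<lambda>y. V y $ i)" for i using V(1) by (simp add: poly_map_vector)
  have proj: "ip_face e (snd v T e) \<phi> = ip_face e V \<phi>" if e: "e \<in> faces \<E> T" and \<phi>: "vpoly_on (k - 1) e \<phi>" for e \<phi>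
  proof -
    have eE: "e \<in> \<E>" by (rule faces_subset(1)[OF T e])
    have "Qb k e (fst v T) x - snd v T e x = 0" if "x \<in> e" for x
      by (rule ip_face_definite[OF eE vpoly_on_continuous[OF residual(1)[OF T e v]] s[OF e] that])
    then have "ip_face e (\<lambda>x. Qb k e (fst v T) x - snd v T e x) \<phi> = ip_face e (\<lambda>x. 0) \<phi>"
      by (intro ip_face_cong[OF eE]) simp
    then have "ip_face e (snd v T e) \<phi> = ip_face e (fst v T) \<phi>"
      using residual(2)[OF T e v \<phi>] by simp
    also have "\<dots> = ip_face e V \<phi>"
      using V(2) faces_subset(3)[OF T e] by (intro ip_face_cong[OF eE]) auto
    finally show ?thesis .
  qed
  define Q where "Q = (\<lambda>x. \<chi> i. grad (\<lambda>y. V y $ i) x)"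
  have Q: "poly_map (k - 1) Q"
    unfolding Q_def poly_map_matrix grad_partial vec_lambda_beta by (intro allI poly_fun_derivative(2)[OF pV])
  have "0 = ip T (weak_grad k \<E> v T) Q"
    using ip_cong[of T "weak_grad k \<E> v T" Q "\<lambda>x. 0" Q] G0 by simp
  also have "\<dots> = grad_rhs v T Q" using Q by (intro G(2)) (auto simp: mpoly_on_iff)
  also have "\<dots> = - ip T V (row_div Q) + (\<Sum>e\<in>faces \<E> T. ip_face e V (\<lambda>x. Q x *v outward_normal T e))"
  proof -
    have "ip T (fst v T) (row_div Q) = ip T V (row_div Q)" using V(2) by (intro ip_cong) simp
    moreover have "ip_face e (snd v T e) (\<lambda>x. Q x *v outward_normal T e) = ip_face e V (\<lambda>x. Q x *v outward_normal T e)"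
      if e: "e \<in> faces \<E> T" for e
      by (rule proj[OF e vpoly_on_poly_map[OF poly_map_matrix_vector[OF Q]]])
    ultimately show ?thesis by (simp add: grad_rhs_def)
  qed
  also have "\<dots> = ip T Q Q"
    using green_identity[OF T V(1) Q] by (simp flip: Q_def)
  finally have QQ: "ip T Q Q = 0" by simp
  have "\<exists>c. \<forall>x\<in>T. V x $ i = c" for i
  proof -
    have "grad (\<lambda>y. V y $ i) x = 0" if "x \<in> T" for x
      using ip_definite[OF T poly_map_continuous[OF Q] QQ that] by (simp add: Q_def vec_eq_iff)
    then show ?thesis using zero_grad_constant[OF T, of k "\<lambda>y. V y $ i"] pV by (metis poly_map_real)
  qed
  then obtain d where d: "\<And>i x. x \<in> T \<Longrightarrow> V x $ i = d i" by metis
  define c where "c = (\<chi> i. d i)"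
  have Vc: "V x = c" if "x \<in> T" for x using d[OF that] by (simp add: c_def vec_eq_iff)
  have "snd v T e x = c" if e: "e \<in> faces \<E> T" and x: "x \<in> e" for e x
  proof -
    have eE: "e \<in> \<E>" by (rule faces_subset(1)[OF T e])
    let ?\<phi> = "\<lambda>x. snd v T e x - c"
    have \<phi>: "vpoly_on (k - 1) e ?\<phi>"
      by (rule vpoly_on_diff[OF vT(2)[OF e] vpoly_on_poly_map[OF poly_map_const]])
    have "ip_face e V ?\<phi> = ip_face e (\<lambda>x. c) ?\<phi>"
      using Vc faces_subset(3)[OF T e] by (intro ip_face_cong[OF eE]) auto
    then have "ip_face e (snd v T e) ?\<phi> - ip_face e (\<lambda>x. c) ?\<phi> = 0"
      using proj[OF e \<phi>] by simp
    then have "ip_face e ?\<phi> ?\<phi> = 0"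
      using ip_face_diff(1)[OF eE vpoly_on_continuous[OF vT(2)[OF e]] continuous_on_const vpoly_on_continuous[OF \<phi>], of c]
      by simp
    then show ?thesis using ip_face_definite[OF eE vpoly_on_continuous[OF \<phi>] _ x] by simp
  qed
  then show ?thesis using that Vc V(2) by metis
qed

lemma diameter_pos: "T \<in> \<T> \<Longrightarrow> 0 < diameter T"
proof -
  assume T: "T \<in> \<T>"
  obtain x where x: "x \<in> interior T" using element(5)[OF T] by blast
  then obtain r where r: "r > 0" "ball x r \<subseteq> T" by (meson mem_interior)
  obtain b :: "real^'n" where b: "b \<in> Basis" using nonempty_Basis by blast
  have "x + (r / 2) *\<^sub>R b \<in> T" using r b by (auto simp: dist_norm subset_iff)
  moreover have "x \<in> T" using r by auto
  ultimately have "dist (x + (r / 2) *\<^sub>R b) x \<le> diameter T"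
    by (rule diameter_bounded_bound[OF compact_imp_bounded[OF element(1)[OF T]]])
  then show ?thesis using r(1) b by (simp add: dist_norm)
qed

text \<open>The constants that \<open>element_rigidity\<close> gives for the single elements agree across interior faces, as
  there are no jumps, and one of them is zero because of the boundary condition.\<close>
lemma a_form_definite:
  assumes k: "k \<ge> 1" and v: "v \<in> cV_h0 k \<Omega> \<T> \<E>" and a: "a_form k \<T> \<E> v v = 0"
  shows "\<And>T x. T \<in> \<T> \<Longrightarrow> x \<in> T \<Longrightarrow> fst v T x = 0"
    and "\<And>T e x. T \<in> \<T> \<Longrightarrow> e \<in> faces \<E> T \<Longrightarrow> x \<in> e \<Longrightarrow> snd v T e x = 0"
proof -
  have vV: "v \<in> V_h k \<T> \<E>" and jump: "\<And>e. e \<in> interior_faces \<Omega> \<E> \<Longrightarrow> no_jump \<T> \<E> v e"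
    and bdry: "bdry_eq \<Omega> \<T> \<E> v (\<lambda>e x. 0)"
    using v by (auto simp: cV_h0_def cV_h_def)
  let ?G = "\<lambda>T. ip T (weak_grad k \<E> v T) (weak_grad k \<E> v T)"
  let ?s = "\<lambda>T e. ip_face e (\<lambda>x. Qb k e (fst v T) x - snd v T e x) (\<lambda>x. Qb k e (fst v T) x - snd v T e x)"
  let ?S = "\<lambda>T. inverse (diameter T) * (\<Sum>e\<in>faces \<E> T. ?s T e)"
  have nonneg: "0 \<le> ?G T" "0 \<le> ?S T" if "T \<in> \<T>" for T
    using diameter_pos[OF that] by (auto intro!: ip_nonneg mult_nonneg_nonneg sum_nonneg ip_face_nonneg)
  have "(\<Sum>T\<in>\<T>. ?G T) + (\<Sum>T\<in>\<T>. ?S T) = 0" using a by (simp add: a_form_def s_form_def)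
  moreover have "0 \<le> (\<Sum>T\<in>\<T>. ?G T)" "0 \<le> (\<Sum>T\<in>\<T>. ?S T)" using nonneg by (auto intro!: sum_nonneg)
  ultimately have "(\<Sum>T\<in>\<T>. ?G T) = 0" "(\<Sum>T\<in>\<T>. ?S T) = 0" by linarith+
  then have G0: "?G T = 0" and S0: "?S T = 0" if "T \<in> \<T>" for T
    using that nonneg finite_elements sum_nonneg_eq_0_iff[of \<T> ?G] sum_nonneg_eq_0_iff[of \<T> ?S] by blast+
  have s0: "?s T e = 0" if T: "T \<in> \<T>" and e: "e \<in> faces \<E> T" for T e
  proof -
    have "(\<Sum>e\<in>faces \<E> T. ?s T e) = 0" using S0[OF T] diameter_pos[OF T] by simp
    then show ?thesis
      using sum_nonneg_eq_0_iff[OF finite_faces, of T "?s T"] ip_face_nonneg e by blast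
  qed
  have "\<exists>c. (\<forall>x\<in>T. fst v T x = c) \<and> (\<forall>e\<in>faces \<E> T. \<forall>x\<in>e. snd v T e x = c)" if T: "T \<in> \<T>" for T
    using element_rigidity[OF k T vV G0[OF T] s0[OF T]] by metis
  then obtain c where c: "\<And>T x. T \<in> \<T> \<Longrightarrow> x \<in> T \<Longrightarrow> fst v T x = c T"
    "\<And>T e x. T \<in> \<T> \<Longrightarrow> e \<in> faces \<E> T \<Longrightarrow> x \<in> e \<Longrightarrow> snd v T e x = c T"
    by metis
  have ne: "e \<noteq> {}" if "e \<in> \<E>" for e using face(4)[OF that] rel_interior_subset[of e] by blast
  have "{T \<in> \<T>. c T = 0} = \<T>"
  proof (rule elements_connected)
    obtain T e where Te: "T \<in> \<T>" "e \<in> faces \<E> T" "e \<in> boundary_faces \<Omega> \<E>" by (rule boundary_face_exists)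
    then obtain x where "x \<in> e" using ne faces_subset(1) by blast
    then have "c T = 0" using c(2)[OF Te(1,2)] bdry Te by (simp add: bdry_eq_def)
    then show "{T \<in> \<T>. c T = 0} \<noteq> {}" using Te(1) by blast
  next
    fix e T1 T2 assume s: "shared_by \<T> \<E> e T1 T2" and T1: "T1 \<in> {T \<in> \<T>. c T = 0}"
    then have T: "T1 \<in> \<T>" "T2 \<in> \<T>" "e \<in> faces \<E> T1" "e \<in> faces \<E> T2" by (auto simp: shared_by_def)
    then obtain x where x: "x \<in> e" using ne faces_subset(1) by blast
    have "snd v T1 e x = snd v T2 e x"
      using jump[OF shared_face(2)[OF s]] s x by (auto simp: no_jump_def jump_def)
    then have "c T2 = 0" using c(2)[OF T(1,3) x] c(2)[OF T(2,4) x] T1 by simp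
    then show "T2 \<in> {T \<in> \<T>. c T = 0}" using T(2) by simp
  qed auto
  then have "c T = 0" if "T \<in> \<T>" for T using that by blast
  then show "\<And>T x. T \<in> \<T> \<Longrightarrow> x \<in> T \<Longrightarrow> fst v T x = 0"
    "\<And>T e x. T \<in> \<T> \<Longrightarrow> e \<in> faces \<E> T \<Longrightarrow> x \<in> e \<Longrightarrow> snd v T e x = 0"
    using c by auto
qed

lemma sum_over_face:
  fixes g :: "(real^'n) set \<Rightarrow> real"
  assumes s: "shared_by \<T> \<E> e T1 T2"
  shows "(\<Sum>T\<in>\<T>. \<Sum>e'\<in>faces \<E> T. if e' = e then g T else 0) = g T1 + g T2"
proof -
  have "(\<Sum>T\<in>\<T>. \<Sum>e'\<in>faces \<E> T. if e' = e then g T else 0) = (\<Sum>T\<in>\<T>. if e \<in> faces \<E> T then g T else 0)"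
    by (simp add: finite_faces)
  also have "\<dots> = (\<Sum>T\<in>{T \<in> \<T>. e \<in> faces \<E> T}. g T)"
    by (rule sum.inter_filter[OF finite_elements, symmetric])
  also have "\<dots> = g T1 + g T2"
    unfolding shared_elements[OF s] using s by (simp add: shared_by_def)
  finally show ?thesis .
qed

text \<open>Two families of test functions suffice: the gradients of \<open>r\<close> inside the elements, and a normal
  vector on one interior face. The latter is single valued, whereas the outward normals on both sides are
  opposite, so its pairing is the difference of the two constants times the area of the face.\<close>
lemma pressure_constant:
  assumes r: "\<And>T. T \<in> \<T> \<Longrightarrow> poly_map (k - 1) (r T)"
    and b: "\<And>v. v \<in> cV_h0 k \<Omega> \<T> \<E> \<Longrightarrow> (\<Sum>T\<in>\<T>. div_rhs v T (r T)) = 0"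
  obtains c where "\<And>T x. T \<in> \<T> \<Longrightarrow> x \<in> T \<Longrightarrow> r T x = c"
proof -
  have "(\<Sum>T\<in>\<T>. ip T (grad (r T)) (grad (r T))) = 0"
  proof -
    let ?v = "(\<lambda>T. grad (r T), \<lambda>T e x. 0) :: 'n wfun"
    have "?v \<in> V_h k \<T> \<E>"
    proof (rule V_hI)
      fix T assume "T \<in> \<T>"
      then have "poly_map k (grad (r T))" by (intro poly_map_mono[OF _ poly_map_grad[OF r]]) auto
      then show "vpoly_on k T (fst ?v T)" by (simp add: vpoly_on_poly_map)
    qed (simp add: vpoly_on_poly_map poly_map_0)
    then have "?v \<in> cV_h0 k \<Omega> \<T> \<E>"
      by (simp add: cV_h0_def cV_h_def bdry_eq_def no_jump_def jump_def)
    from b[OF this] show ?thesis by (simp add: div_rhs_def sum_negf)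
  qed
  then have "ip T (grad (r T)) (grad (r T)) = 0" if "T \<in> \<T>" for T
    using that sum_nonneg_eq_0_iff[OF finite_elements, of "\<lambda>T. ip T (grad (r T)) (grad (r T))"] ip_nonneg by blast
  then have "grad (r T) x = 0" if "T \<in> \<T>" "x \<in> T" for T x
    using ip_definite[OF that(1) poly_map_continuous[OF poly_map_grad[OF r[OF that(1)]]]] that by blast
  then have "\<exists>c. \<forall>x\<in>T. r T x = c" if "T \<in> \<T>" for T
    using zero_grad_constant[OF that r[OF that]] that by metis
  then obtain c where c: "\<And>T x. T \<in> \<T> \<Longrightarrow> x \<in> T \<Longrightarrow> r T x = c T" by metis
  have eq: "c T1 = c T2" if s: "shared_by \<T> \<E> e T1 T2" for e T1 T2
  proof -
    have T: "T1 \<in> \<T>" "T2 \<in> \<T>" and e: "e \<in> faces \<E> T1" "e \<in> faces \<E> T2" using s by (auto simp: shared_by_def)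
    have eE: "e \<in> \<E>" by (rule faces_subset(1)[OF T(1) e(1)])
    define n where "n = outward_normal T1 e"
    have nn: "n \<bullet> n = 1" using normal_to_outward_normal[OF T(1) e(1)]
      by (simp add: n_def normal_to_def dot_square_norm)
    have n2: "outward_normal T2 e = - n" unfolding n_def by (rule shared_face(1)[OF s])
    define m where "m = ip_face e (\<lambda>x. 1::real) (\<lambda>x. 1)"
    obtain y where y: "y \<in> e" using face(4)[OF eE] rel_interior_subset[of e] by blast
    have m0: "m \<noteq> 0"
      using ip_face_definite[OF eE continuous_on_const, of "1::real", OF _ y] by (auto simp: m_def)
    let ?v = "(\<lambda>T x. 0, \<lambda>T e' x. if e' = e then n else 0) :: 'n wfun"
    have "?v \<in> V_h k \<T> \<E>"
      by (rule V_hI) (auto intro!: vpoly_on_poly_map poly_map_0 poly_map_const)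
    moreover have "e \<notin> boundary_faces \<Omega> \<E>"
      using shared_face(2)[OF s] by (simp add: interior_faces_def boundary_faces_def)
    ultimately have "?v \<in> cV_h0 k \<Omega> \<T> \<E>"
      by (auto simp: cV_h0_def cV_h_def bdry_eq_def no_jump_def jump_def)
    from b[OF this] have "(\<Sum>T\<in>\<T>. \<Sum>e'\<in>faces \<E> T. if e' = e then ip_face e (\<lambda>x. n \<bullet> outward_normal T e) (r T) else 0) = 0"
    proof -
      have "ip_face e' (\<lambda>x. (if e' = e then n else 0) \<bullet> outward_normal T e') (r T)
        = (if e' = e then ip_face e (\<lambda>x. n \<bullet> outward_normal T e) (r T) else 0)" for e' T by simp
      then show ?thesis using b[OF \<open>?v \<in> cV_h0 k \<Omega> \<T> \<E>\<close>] by (simp add: div_rhs_def)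
    qed
    then have "ip_face e (\<lambda>x. n \<bullet> outward_normal T1 e) (r T1) + ip_face e (\<lambda>x. n \<bullet> outward_normal T2 e) (r T2) = 0"
      unfolding sum_over_face[OF s] .
    moreover have "ip_face e (\<lambda>x. a) (r T) = a * c T * m" if "T \<in> \<T>" "e \<in> faces \<E> T" for T a
    proof -
      have "ip_face e (\<lambda>x. a) (r T) = ip_face e (\<lambda>x. a *\<^sub>R (1::real)) (\<lambda>x. c T *\<^sub>R 1)"
      proof (rule ip_face_cong[OF eE])
        fix x assume "x \<in> e"
        then have "r T x = c T" using c[OF that(1)] faces_subset(3)[OF that] by blast
        then show "a \<bullet> r T x = (a *\<^sub>R (1::real)) \<bullet> (c T *\<^sub>R 1)" by simp
      qed
      then show ?thesis by (simp only: ip_face_scale m_def)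
    qed
    ultimately have "c T1 * m - c T2 * m = 0" using T e by (simp add: n2 nn flip: n_def)
    then show ?thesis using m0 by simp
  qed
  obtain T0 e0 where T0: "T0 \<in> \<T>" "e0 \<in> faces \<E> T0" "e0 \<in> boundary_faces \<Omega> \<E>" by (rule boundary_face_exists)
  have "{T \<in> \<T>. c T = c T0} = \<T>"
  proof (rule elements_connected)
    show "T2 \<in> {T \<in> \<T>. c T = c T0}"
      if "shared_by \<T> \<E> e T1 T2" "T1 \<in> {T \<in> \<T>. c T = c T0}" for e T1 T2
      using eq[OF that(1)] that by (simp add: shared_by_def)
  qed (use T0(1) in auto)
  then have "r T x = c T0" if "T \<in> \<T>" "x \<in> T" for T x using c[OF that] that by auto
  then show ?thesis by (rule that)
qed

text \<open>The jump across \<open>e\<close>, taken with opposite signs on its two sides, is an admissible multiplier.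
  It vanishes outside \<open>e\<close>, and its pairing with \<open>u\<close> is the squared norm of the jump.\<close>
lemma multiplier_test_no_jump:
  assumes u: "u \<in> V_h k \<T> \<E>" and c: "\<And>\<mu>. \<mu> \<in> Xi_h k \<Omega> \<T> \<E> \<Longrightarrow> c_form \<T> \<E> u \<mu> = 0"
    and e: "e \<in> interior_faces \<Omega> \<E>"
  shows "no_jump \<T> \<E> u e"
  unfolding no_jump_def
proof (intro allI impI ballI)
  fix T1 T2 x assume s: "shared_by \<T> \<E> e T1 T2" and x: "x \<in> e"
  have T: "T1 \<in> \<T>" "T2 \<in> \<T>" "T1 \<noteq> T2" and eT: "e \<in> faces \<E> T1" "e \<in> faces \<E> T2" using s by (auto simp: shared_by_def)
  have eE: "e \<in> \<E>" by (rule faces_subset(1)[OF T(1) eT(1)])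
  define J where "J = jump e T1 T2 u"
  have J: "J = (\<lambda>x. snd u T1 e x - snd u T2 e x)" by (simp add: J_def jump_def fun_eq_iff)
  note u12 = V_hD(2)[OF u T(1) eT(1)] V_hD(2)[OF u T(2) eT(2)]
  have Jp: "vpoly_on (k - 1) e J" unfolding J by (rule vpoly_on_diff[OF u12])
  have zp: "vpoly_on (k - 1) e' (\<lambda>x. 0)" for e' by (rule vpoly_on_poly_map[OF poly_map_0])
  define M where "M = (\<lambda>T x. if T = T1 then J x else if T = T2 then 0 - J x else 0)"
  define \<mu> :: "'n bfun" where "\<mu> = (\<lambda>T e' x. if e' = e then M T x else 0)"
  have Mp: "vpoly_on (k - 1) e (M T)" for T
    using Jp vpoly_on_diff[OF zp Jp] zp[of e] by (cases "T = T1"; cases "T = T2") (simp_all add: M_def)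
  have "\<mu> \<in> Xi_h k \<Omega> \<T> \<E>"
    unfolding Xi_h_def Lambda_h_def mem_Collect_eq
  proof (intro conjI ballI allI impI)
    show "vpoly_on (k - 1) e' (\<mu> T e')" for T e'
      using Mp zp by (cases "e' = e") (auto simp: \<mu>_def)
    show "\<mu> S1 e' y + \<mu> S2 e' y = 0" if "shared_by \<T> \<E> e' S1 S2" for e' S1 S2 y
    proof (cases "e' = e")
      case True
      then have "{S1, S2} = {T1, T2}" using shared_elements[OF s] shared_elements[of e S1 S2] that by simp
      then have "(S1 = T1 \<and> S2 = T2) \<or> (S1 = T2 \<and> S2 = T1)" by (auto simp: doubleton_eq_iff)
      then show ?thesis using True T(3) by (auto simp: \<mu>_def M_def)
    qed (simp add: \<mu>_def)
    show "\<mu> T e' y = 0" if "e' \<in> boundary_faces \<Omega> \<E>" for e' T y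
      using that e by (auto simp: \<mu>_def boundary_faces_def interior_faces_def)
  qed
  from c[OF this] have "(\<Sum>T\<in>\<T>. \<Sum>e'\<in>faces \<E> T. ip_face e' (snd u T e') (\<mu> T e')) = 0"
    by (simp add: c_form_def)
  moreover have "ip_face e' (snd u T e') (\<mu> T e') = (if e' = e then ip_face e (snd u T e) (M T) else 0)" for T e'
    by (simp add: \<mu>_def)
  ultimately have "ip_face e (snd u T1 e) (M T1) + ip_face e (snd u T2 e) (M T2) = 0"
    by (simp only: sum_over_face[OF s])
  moreover have "M T1 = J" "M T2 = (\<lambda>x. (- 1) *\<^sub>R J x)" using T(3) by (auto simp: M_def)
  ultimately have "ip_face e (snd u T1 e) J - ip_face e (snd u T2 e) J = 0" by (simp only: ip_face_scale)
  then have "ip_face e J J = 0"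
    using ip_face_diff(1)[OF eE u12[THEN vpoly_on_continuous] vpoly_on_continuous[OF Jp]] by (simp flip: J)
  then show "jump e T1 T2 u x = 0"
    using ip_face_definite[OF eE vpoly_on_continuous[OF Jp] _ x] by (simp add: J_def)
qed

lemma c_form_orthogonal:
  assumes v: "v \<in> cV_h0 k \<Omega> \<T> \<E>" and l: "l \<in> Xi_h k \<Omega> \<T> \<E>"
  shows "c_form \<T> \<E> v l = 0"
proof -
  have jump: "\<And>e. e \<in> interior_faces \<Omega> \<E> \<Longrightarrow> no_jump \<T> \<E> v e"
    using v by (auto simp: cV_h0_def cV_h_def)
  let ?g = "\<lambda>T e. ip_face e (snd v T e) (l T e)"
  have "c_form \<T> \<E> v l = (\<Sum>T\<in>\<T>. \<Sum>e | e \<in> \<E> \<and> e \<in> faces \<E> T. ?g T e)"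
    unfolding c_form_def by (intro sum.cong refl) (auto simp: faces_def)
  also have "\<dots> = (\<Sum>e\<in>\<E>. \<Sum>T | T \<in> \<T> \<and> e \<in> faces \<E> T. ?g T e)"
    by (rule sum.swap_restrict[OF finite_elements finite_all_faces])
  also have "\<dots> = 0"
  proof (rule sum.neutral, rule ballI)
    fix e assume eE: "e \<in> \<E>"
    show "(\<Sum>T | T \<in> \<T> \<and> e \<in> faces \<E> T. ?g T e) = 0"
    proof (cases "e \<in> interior_faces \<Omega> \<E>")
      case True
      then obtain T1 T2 where T: "shared_by \<T> \<E> e T1 T2" "{T \<in> \<T>. e \<in> faces \<E> T} = {T1, T2}" "T1 \<noteq> T2"
        by (rule interior_face_shared)
      have "snd v T2 e x = snd v T1 e x" if "x \<in> e" for x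
        using jump[OF True] T(1) that by (auto simp: no_jump_def jump_def)
      moreover have "l T2 e x = - l T1 e x" if "x \<in> e" for x
      proof -
        have "l T1 e x + l T2 e x = 0" using l True T(1) that by (simp add: Xi_h_def)
        then show ?thesis by (simp add: eq_neg_iff_add_eq_0 add.commute)
      qed
      ultimately have "?g T2 e = ip_face e (snd v T1 e) (\<lambda>x. (- 1) *\<^sub>R l T1 e x)"
        by (intro ip_face_cong[OF eE]) simp
      then have "?g T2 e = - ?g T1 e" by (simp only: ip_face_scale)
      then show ?thesis using T(2,3) by simp
    next
      case False
      then have "e \<in> boundary_faces \<Omega> \<E>" using eE by (simp add: interior_faces_def boundary_faces_def)
      then have "l T e x = 0" if "T \<in> \<T>" "e \<in> faces \<E> T" "x \<in> e" for T x
        using l that by (simp add: Xi_h_def)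
      then have "?g T e = ip_face e (snd v T e) (\<lambda>x. 0)" if "T \<in> \<T>" "e \<in> faces \<E> T" for T
        using that by (intro ip_face_cong[OF eE]) simp
      then show ?thesis by (intro sum.neutral) simp
    qed
  qed
  finally show ?thesis .
qed

lemma zero_in_W_h: "(\<lambda>x. 0) \<in> W_h k \<Omega> \<T>"
  by (auto simp: W_h_def L2_on_def set_lebesgue_integral_def intro!: exI[of _ "\<lambda>x. 0"] poly_fun_0)

lemma zero_in_Xi_h: "(\<lambda>T e x. 0) \<in> Xi_h k \<Omega> \<T> \<E>"
  by (simp add: Xi_h_def Lambda_h_def vpoly_on_poly_map poly_map_0)

text \<open>The zero pressure and the zero multiplier decouple the two parts of the second equation.\<close>
lemma HWG_solution_imp_WG_solution:
  assumes H: "HWG_solution k \<Omega> \<T> \<E> f g u p l"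
  shows "WG_solution k \<Omega> \<T> \<E> f g u p"
proof -
  have u: "u \<in> V_h k \<T> \<E>" and p: "p \<in> W_h k \<Omega> \<T>" and l: "l \<in> Xi_h k \<Omega> \<T> \<E>"
    and bd: "bdry_eq \<Omega> \<T> \<E> u (\<lambda>e. Qb k e g)"
    and eq: "\<And>v. v \<in> V_h0 k \<Omega> \<T> \<E> \<Longrightarrow> a_form k \<T> \<E> u v - b_form k \<T> \<E> v p - c_form \<T> \<E> v l = load \<T> f v"
    and bc: "\<And>q \<mu>. q \<in> W_h k \<Omega> \<T> \<Longrightarrow> \<mu> \<in> Xi_h k \<Omega> \<T> \<E> \<Longrightarrow> b_form k \<T> \<E> u q + c_form \<T> \<E> u \<mu> = 0"
    using H unfolding HWG_solution_def by blast+
  have "c_form \<T> \<E> u \<mu> = 0" if "\<mu> \<in> Xi_h k \<Omega> \<T> \<E>" for \<mu>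
    using bc[OF zero_in_W_h that] by (simp add: b_form_def)
  then have "u \<in> cV_h k \<Omega> \<T> \<E>"
    using u multiplier_test_no_jump[OF u] by (simp add: cV_h_def)
  moreover have "a_form k \<T> \<E> u v - b_form k \<T> \<E> v p = load \<T> f v" if v: "v \<in> cV_h0 k \<Omega> \<T> \<E>" for v
  proof -
    have "v \<in> V_h0 k \<Omega> \<T> \<E>" using v by (simp add: cV_h0_def cV_h_def V_h0_def)
    then show ?thesis using eq c_form_orthogonal[OF v l] by fastforce
  qed
  moreover have "b_form k \<T> \<E> u q = 0" if "q \<in> W_h k \<Omega> \<T>" for q
    using bc[OF that zero_in_Xi_h] by (simp add: c_form_def)
  ultimately show ?thesis using p bd unfolding WG_solution_def by blast
qed

lemma W_h_integrable:
  assumes "q \<in> W_h k \<Omega> \<T>"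
  shows "integrable (lebesgue_on \<Omega>) q" "(LINT x|lebesgue_on \<Omega>. q x) = 0"
proof -
  have L: "\<Omega> \<in> lmeasurable" by (rule lmeasurable_open[OF Omega(1,2)])
  have q: "q \<in> borel_measurable (lebesgue_on \<Omega>)" "integrable (lebesgue_on \<Omega>) (\<lambda>x. (norm (q x))\<^sup>2)"
    "(LINT x:\<Omega>|lebesgue. q x) = 0" using assms by (auto simp: W_h_def L2_on_def)
  interpret finite_measure "lebesgue_on \<Omega>" by (rule finite_measure_lebesgue_on[OF L])
  have "integrable (lebesgue_on \<Omega>) (\<lambda>x. 1 + (norm (q x))\<^sup>2)"
    by (intro Bochner_Integration.integrable_add integrable_const q(2))
  then show "integrable (lebesgue_on \<Omega>) q"
  proof (rule Bochner_Integration.integrable_bound[OF _ q(1)])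
    have "\<bar>t\<bar> \<le> \<bar>1 + t\<^sup>2\<bar>" for t :: real
    proof -
      have "0 \<le> (\<bar>t\<bar> - 1 / 2)\<^sup>2 + 3 / 4" by simp
      then show ?thesis by (simp add: power2_eq_square algebra_simps abs_mult_self_eq)
    qed
    then show "AE x in lebesgue_on \<Omega>. norm (q x) \<le> norm (1 + (norm (q x))\<^sup>2)" by simp
  qed
  show "(LINT x|lebesgue_on \<Omega>. q x) = 0"
    using q(3) L by (subst integral_restrict_space) (auto simp: set_lebesgue_integral_def)
qed

lemma WG_solution_unique:
  assumes k: "k \<ge> 1" and S1: "WG_solution k \<Omega> \<T> \<E> f g u p" and S2: "WG_solution k \<Omega> \<T> \<E> f g w q"
  shows "same_wfun \<T> \<E> u w" and "AE x in lebesgue_on \<Omega>. p x = q x"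
proof -
  have u: "u \<in> V_h k \<T> \<E>" and w: "w \<in> V_h k \<T> \<E>" and p: "p \<in> W_h k \<Omega> \<T>" and q: "q \<in> W_h k \<Omega> \<T>"
    using S1 S2 by (auto simp: WG_solution_def cV_h_def)
  obtain P where P: "\<And>T. T \<in> \<T> \<Longrightarrow> poly_map (k - 1) (P T)" "\<And>T. T \<in> \<T> \<Longrightarrow> AE x in lebesgue. x \<in> T \<longrightarrow> p x = P T x"
    using W_h_representative[OF p] by metis
  obtain Q where Q: "\<And>T. T \<in> \<T> \<Longrightarrow> poly_map (k - 1) (Q T)" "\<And>T. T \<in> \<T> \<Longrightarrow> AE x in lebesgue. x \<in> T \<longrightarrow> q x = Q T x"
    using W_h_representative[OF q] by metis
  define d where "d = wfun_diff u w"
  have dV: "d \<in> V_h k \<T> \<E>" unfolding d_def by (rule V_h_wfun_diff[OF u w])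
  \<comment> \<open>Both solutions have the same values \<open>Qb k e g\<close> on the boundary faces, so \<open>d\<close> may serve as a test
    function.\<close>
  have d: "d \<in> cV_h0 k \<Omega> \<T> \<E>"
  proof -
    have "no_jump \<T> \<E> d e" if "e \<in> interior_faces \<Omega> \<E>" for e
    proof -
      have "no_jump \<T> \<E> u e" "no_jump \<T> \<E> w e"
        using S1 S2 that by (auto simp: WG_solution_def cV_h_def)
      then show ?thesis by (simp add: no_jump_def jump_def d_def wfun_diff_def)
    qed
    moreover have "bdry_eq \<Omega> \<T> \<E> u (\<lambda>e. Qb k e g)" "bdry_eq \<Omega> \<T> \<E> w (\<lambda>e. Qb k e g)"
      using S1 S2 by (auto simp: WG_solution_def)
    then have "bdry_eq \<Omega> \<T> \<E> d (\<lambda>e x. 0)" by (simp add: bdry_eq_def d_def wfun_diff_def)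
    ultimately show ?thesis using dV by (simp add: cV_h0_def cV_h_def)
  qed
  have bd: "b_form k \<T> \<E> d r = 0" if r: "r \<in> W_h k \<Omega> \<T>" for r
  proof -
    obtain R where R: "\<And>T. T \<in> \<T> \<Longrightarrow> poly_map (k - 1) (R T)" "\<And>T. T \<in> \<T> \<Longrightarrow> AE x in lebesgue. x \<in> T \<longrightarrow> r x = R T x"
      using W_h_representative[OF r] by metis
    have "(\<Sum>T\<in>\<T>. div_rhs d T (R T)) = (\<Sum>T\<in>\<T>. div_rhs u T (R T) - div_rhs w T (R T))"
      unfolding d_def
      by (intro sum.cong refl) (rule div_rhs_wfun_diff[OF _ V_hD(3)[OF u] V_hD(3)[OF w] R(1)])
    then have "b_form k \<T> \<E> d r = b_form k \<T> \<E> u r - b_form k \<T> \<E> w r"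
      using b_form_eq[OF dV R(1) R(2)] b_form_eq[OF u R(1) R(2)] b_form_eq[OF w R(1) R(2)]
      by (simp add: sum_subtractf)
    also have "\<dots> = 0" using S1 S2 r by (simp add: WG_solution_def)
    finally show ?thesis .
  qed
  have eq: "a_form k \<T> \<E> d v = b_form k \<T> \<E> v p - b_form k \<T> \<E> v q" if v: "v \<in> cV_h0 k \<Omega> \<T> \<E>" for v
  proof -
    have vV: "v \<in> V_h k \<T> \<E>" using v by (simp add: cV_h0_def cV_h_def)
    have "a_form k \<T> \<E> u v - b_form k \<T> \<E> v p = load \<T> f v" "a_form k \<T> \<E> w v - b_form k \<T> \<E> v q = load \<T> f v"
      using S1 S2 v by (auto simp: WG_solution_def)
    then show ?thesis unfolding d_def a_form_wfun_diff[OF u w vV] by linarith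
  qed
  \<comment> \<open>The pressure terms vanish because \<open>d\<close> is weakly divergence free.\<close>
  have "a_form k \<T> \<E> d d = 0" using eq[OF d] bd[OF p] bd[OF q] by simp
  note d0 = a_form_definite[OF k d this]
  show "same_wfun \<T> \<E> u w"
    using d0 by (simp add: same_wfun_def d_def wfun_diff_def)
  have PQ: "poly_map (k - 1) (\<lambda>x. P T x - Q T x)" if "T \<in> \<T>" for T
    by (rule poly_map_diff[OF P(1)[OF that] Q(1)[OF that]])
  have b0: "(\<Sum>T\<in>\<T>. div_rhs v T (\<lambda>x. P T x - Q T x)) = 0" if v: "v \<in> cV_h0 k \<Omega> \<T> \<E>" for v
  proof -
    have vV: "v \<in> V_h k \<T> \<E>" using v by (simp add: cV_h0_def cV_h_def)
    have "div_rhs v T (\<lambda>x. P T x - Q T x) = div_rhs v T (P T) - div_rhs v T (Q T)" if T: "T \<in> \<T>" for T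
    proof -
      note lin = linear_div_rhs[OF T V_hD(3)[OF vV T], of "k - 1", unfolded linear_functional_on_def]
      have "div_rhs v T (\<lambda>x. (P T x - Q T x) + Q T x) = div_rhs v T (\<lambda>x. P T x - Q T x) + div_rhs v T (Q T)"
        using poly_map_diff[OF P(1)[OF T] Q(1)[OF T]] Q(1)[OF T]
        by (intro lin[THEN conjunct1, THEN bspec, THEN bspec]) simp_all
      then show ?thesis by simp
    qed
    then have "(\<Sum>T\<in>\<T>. div_rhs v T (\<lambda>x. P T x - Q T x)) = b_form k \<T> \<E> v p - b_form k \<T> \<E> v q"
      using b_form_eq[OF vV P(1) P(2)] b_form_eq[OF vV Q(1) Q(2)] by (simp add: sum_subtractf)
    also have "\<dots> = a_form k \<T> \<E> d v" using eq[OF v] by simp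
    also have "\<dots> = 0" by (rule a_form_zero[OF dV vV d0])
    finally show ?thesis .
  qed
  obtain c where c: "\<And>T x. T \<in> \<T> \<Longrightarrow> x \<in> T \<Longrightarrow> P T x - Q T x = c"
    using pressure_constant[where r = "\<lambda>T x. P T x - Q T x", OF PQ b0] by blast
  have "AE x in lebesgue. \<forall>T\<in>\<T>. x \<in> T \<longrightarrow> p x = q x + c"
  proof (intro AE_finite_allI finite_elements)
    fix T assume T: "T \<in> \<T>"
    show "AE x in lebesgue. x \<in> T \<longrightarrow> p x = q x + c"
      using P(2)[OF T] Q(2)[OF T] by eventually_elim (use c[OF T] in \<open>auto simp: algebra_simps\<close>)
  qed
  then have "AE x in lebesgue. x \<in> \<Omega> \<longrightarrow> p x = q x + c"
    by eventually_elim (use Union_elements closure_subset[of \<Omega>] in blast)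
  then have ae: "AE x in lebesgue_on \<Omega>. p x = q x + c"
    using Omega(2) by (subst AE_restrict_space_iff) auto
  have L: "\<Omega> \<in> lmeasurable" by (rule lmeasurable_open[OF Omega(1,2)])
  interpret finite_measure "lebesgue_on \<Omega>" by (rule finite_measure_lebesgue_on[OF L])
  note ip = W_h_integrable[OF p] and iq = W_h_integrable[OF q]
  have "(LINT x|lebesgue_on \<Omega>. p x) = (LINT x|lebesgue_on \<Omega>. q x + c)"
    using ip(1) iq(1) by (intro integral_cong_AE ae) auto
  also have "\<dots> = (LINT x|lebesgue_on \<Omega>. q x) + measure (lebesgue_on \<Omega>) \<Omega> * c"
    using iq(1) by (subst Bochner_Integration.integral_add) auto
  finally have "measure lebesgue \<Omega> * c = 0"
    using ip(2) iq(2) L by (simp add: measure_restrict_space)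
  moreover have "measure lebesgue \<Omega> \<noteq> 0"
    using open_not_negligible[OF Omega(2,4)] negligible_iff_measure[of \<Omega>] L by blast
  ultimately have "c = 0" by simp
  then show "AE x in lebesgue_on \<Omega>. p x = q x" using ae by simp
qed

end

theorem theorem4p2:
  fixes \<Omega> :: "(real^'n) set" and \<T> \<E> :: "(real^'n) set set"
    and f g :: "real^'n \<Rightarrow> real^'n" and k N :: nat
    and \<rho>v \<rho>e \<kappa> \<sigma>s \<theta>0 \<gamma>s \<tau> :: real
    and u :: "'n wfun" and p :: "real^'n \<Rightarrow> real" and lh :: "'n bfun"
  assumes "CARD('n) = 2 \<or> CARD('n) = 3"
    and "polyhedral_domain \<Omega>"
    and "mesh \<Omega> \<T> \<E>"
    and "shape_regular \<rho>v \<rho>e \<kappa> \<sigma>s \<theta>0 \<gamma>s \<tau> N \<T> \<E>"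
    and "k \<ge> 1"
    and "L2_on \<Omega> f"
    and "dirichlet_data \<Omega> \<E> g"
    and "HWG_solution k \<Omega> \<T> \<E> f g u p lh"
  shows "(\<forall>e\<in>interior_faces \<Omega> \<E>. no_jump \<T> \<E> u e) \<and>
    u \<in> cV_h k \<Omega> \<T> \<E> \<and>
    bdry_eq \<Omega> \<T> \<E> u (\<lambda>e. Qb k e g) \<and>
    WG_solution k \<Omega> \<T> \<E> f g u p \<and>
    (\<forall>ubar pbar. WG_solution k \<Omega> \<T> \<E> f g ubar pbar \<longrightarrow>
       same_wfun \<T> \<E> u ubar \<and> (AE x in lebesgue_on \<Omega>. p x = pbar x))"
proof -
  interpret polyhedral_mesh \<Omega> \<T> \<E>
    using assms(1-3) by unfold_locales auto
  have WG: "WG_solution k \<Omega> \<T> \<E> f g u p"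
    by (rule HWG_solution_imp_WG_solution[OF assms(8)])
  then have "u \<in> cV_h k \<Omega> \<T> \<E>" "bdry_eq \<Omega> \<T> \<E> u (\<lambda>e. Qb k e g)"
    by (auto simp: WG_solution_def)
  moreover from this(1) have "\<forall>e\<in>interior_faces \<Omega> \<E>. no_jump \<T> \<E> u e"
    by (simp add: cV_h_def)
  ultimately show ?thesis
    using WG WG_solution_unique[OF assms(5) WG] by blast
qed

end
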